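(* Let $m\ge 1$ and let $I$ be a homogeneous ideal of $\mathbb{C}[X_0,\dots,X_m]$. Suppose that, for some integer $D\ge 1$, the set of common zeros in $\mathbb{P}^m(\mathbb{C})$ of the elements of $I_D$ is finite and non-empty. Then the generic resultant $\mathrm{Res}_D$ for homogeneous polynomials of degree $D$ in $m+1$ variables vanishes to order at least $\deg(I)$ at each point of $(I_D)^{m+1}$ (i.e. all its partial derivatives of order $<\deg(I)$ vanish there).
   Context: For a homogeneous ideal $I$, $I_D$ denotes its homogeneous part of degree $D$, and $\mathbb{C}[X_0,\dots,X_m]_D$ the space of homogeneous polynomials of degree $D$. $\deg(I)$ is the degree of $I$, i.e. $r!$ times the leading coefficient of the Hilbert polynomial of $\mathbb{C}[X_0,\dots,X_m]/I$, where $r$ is its degree (for an ideal with finitely many projective zeros this is the eventually constant value of $\dim_{\mathbb{C}}(\mathbb{C}[X_0,\dots,X_m]/I)_\nu$). The resultant in degree $D$ is the polynomial map $\mathrm{Res}_D:\mathbb{C}[X_0,\dots,X_m]_D^{m+1}\to\mathbb{C}$ whose zeros are the $(m+1)$-tuples having a common zero in $\mathbb{P}^m(\mathbb{C})$, whose underlying polynomial in the coefficients (with respect to the monomial basis) has integer coefficients and is irreducible over $\mathbb{Z}$; it is homogeneous of degree $D^m$ in each argument. *)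

theory Defs
  imports
    Complex_Main
    "HOL-Library.Poly_Mapping"
    "HOL-Computational_Algebra.Computational_Algebra"
begin

section \<open>Multivariate polynomials\<close>

text \<open>
  A monomial is a finitely supported exponent function, and a polynomial is a finitely supported
  function from monomials to coefficients; the ring structure is the one of
  \<^theory>\<open>HOL-Library.Poly_Mapping\<close>.
\<close>

type_synonym ('v, 'a) mpoly = "('v \<Rightarrow>\<^sub>0 nat) \<Rightarrow>\<^sub>0 'a"

definition mpoly_vars :: "('v, 'a::zero) mpoly \<Rightarrow> 'v set" where
  "mpoly_vars p = (\<Union>a\<in>Poly_Mapping.keys p. Poly_Mapping.keys a)"

definition mpoly_eval :: "('v \<Rightarrow> 'a::comm_semiring_1) \<Rightarrow> ('v, 'a) mpoly \<Rightarrow> 'a" where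
  "mpoly_eval x p =
    (\<Sum>a\<in>Poly_Mapping.keys p. Poly_Mapping.lookup p a *
      (\<Prod>v\<in>Poly_Mapping.keys a. x v ^ Poly_Mapping.lookup a v))"

text \<open>
  Formal partial derivative. The subtraction of exponents is truncated, which is harmless: the
  coefficient vanishes when \<open>v\<close> does not occur in the monomial.
\<close>

definition mpoly_pderiv :: "'v \<Rightarrow> ('v, 'a::comm_semiring_1) mpoly \<Rightarrow> ('v, 'a) mpoly" where
  "mpoly_pderiv v p =
    (\<Sum>a\<in>Poly_Mapping.keys p. Poly_Mapping.single (a - Poly_Mapping.single v 1)
      (of_nat (Poly_Mapping.lookup a v) * Poly_Mapping.lookup p a))"

text \<open>
  The bound \<open>k\<close> is rational because the degree of an ideal is defined below as a rational number.
\<close>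

definition vanishes_to_order ::
    "'v set \<Rightarrow> ('v, 'a::comm_semiring_1) mpoly \<Rightarrow> ('v \<Rightarrow> 'a) \<Rightarrow> rat \<Rightarrow> bool" where
  "vanishes_to_order V p x k \<longleftrightarrow>
    (\<forall>vs \<in> lists V. of_nat (length vs) < k \<longrightarrow> mpoly_eval x (fold mpoly_pderiv vs p) = 0)"


section \<open>Homogeneous ideals of $\mathbb{C}[X_0,\dots,X_m]$\<close>

text \<open>\<open>\<complex>[X\<^sub>0, \<dots>, X\<^sub>m]\<close> is the set of polynomials in variables indexed by \<open>nat\<close> that only involve
  the indices \<open>0, \<dots>, m\<close>.\<close>

definition poly_ring :: "nat \<Rightarrow> (nat, complex) mpoly set" where
  "poly_ring m = {p. mpoly_vars p \<subseteq> {..m}}"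

definition mon_degree :: "('v \<Rightarrow>\<^sub>0 nat) \<Rightarrow> nat" where
  "mon_degree a = (\<Sum>v\<in>Poly_Mapping.keys a. Poly_Mapping.lookup a v)"

definition homog_polys :: "nat \<Rightarrow> nat \<Rightarrow> (nat, complex) mpoly set" where
  "homog_polys m D = {p \<in> poly_ring m. \<forall>a\<in>Poly_Mapping.keys p. mon_degree a = D}"

definition hom_component :: "nat \<Rightarrow> ('v, 'a::comm_monoid_add) mpoly \<Rightarrow> ('v, 'a) mpoly" where
  "hom_component d p =
    (\<Sum>a | a \<in> Poly_Mapping.keys p \<and> mon_degree a = d.
      Poly_Mapping.single a (Poly_Mapping.lookup p a))"

definition homogeneous_ideal :: "nat \<Rightarrow> (nat, complex) mpoly set \<Rightarrow> bool" where
  "homogeneous_ideal m I \<longleftrightarrow>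
    I \<subseteq> poly_ring m \<and> 0 \<in> I \<and>
    (\<forall>p\<in>I. \<forall>q\<in>I. p + q \<in> I) \<and>
    (\<forall>r\<in>poly_ring m. \<forall>p\<in>I. r * p \<in> I) \<and>
    (\<forall>p\<in>I. \<forall>d. hom_component d p \<in> I)"

definition ideal_part :: "nat \<Rightarrow> (nat, complex) mpoly set \<Rightarrow> nat \<Rightarrow> (nat, complex) mpoly set" where
  "ideal_part m I D = I \<inter> homog_polys m D"


section \<open>Projective zeros\<close>

text \<open>
  Vectors of \<open>\<complex>\<^sup>m\<^sup>+\<^sup>1\<close> are functions on \<open>nat\<close> vanishing beyond \<open>m\<close>; a point of projective space is a
  class of nonzero vectors up to nonzero scalars.
\<close>

definition proj_space :: "nat \<Rightarrow> (nat \<Rightarrow> complex) set set" where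
  "proj_space m =
    {x. (\<forall>i>m. x i = 0) \<and> (\<exists>i. x i \<noteq> 0)} // {(x, y). \<exists>c. c \<noteq> 0 \<and> y = (\<lambda>i. c * x i)}"

definition proj_zeros :: "nat \<Rightarrow> (nat, complex) mpoly set \<Rightarrow> (nat \<Rightarrow> complex) set set" where
  "proj_zeros m S = {z \<in> proj_space m. \<forall>x\<in>z. \<forall>p\<in>S. mpoly_eval x p = 0}"


section \<open>Hilbert polynomial and degree\<close>

global_interpretation cmpoly: vector_space
  "\<lambda>(c::complex) (p::(nat, complex) mpoly). Poly_Mapping.single 0 c * p"
  defines cmpoly_dim = cmpoly.dim
  by unfold_locales
    (simp_all add: algebra_simps single_add mult_single flip: mult.assoc)

text \<open>
  The component of degree \<open>n\<close> of \<open>\<complex>[X\<^sub>0, \<dots>, X\<^sub>m] / I\<close> is \<open>\<complex>[X\<^sub>0, \<dots>, X\<^sub>m]\<^sub>n / I\<^sub>n\<close>, whose dimension is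
  the difference of the two (finite) dimensions.
\<close>

definition hilbert_function :: "nat \<Rightarrow> (nat, complex) mpoly set \<Rightarrow> nat \<Rightarrow> int" where
  "hilbert_function m I n =
    int (cmpoly_dim (homog_polys m n)) - int (cmpoly_dim (ideal_part m I n))"

definition hilbert_polynomial :: "nat \<Rightarrow> (nat, complex) mpoly set \<Rightarrow> rat poly" where
  "hilbert_polynomial m I =
    (THE h. eventually (\<lambda>n. poly h (of_nat n) = of_int (hilbert_function m I n)) sequentially)"

text \<open>If the Hilbert polynomial is zero, this gives degree \<open>0\<close>.\<close>

definition ideal_degree :: "nat \<Rightarrow> (nat, complex) mpoly set \<Rightarrow> rat" where
  "ideal_degree m I =
    fact (degree (hilbert_polynomial m I)) * lead_coeff (hilbert_polynomial m I)"


section \<open>The resultant in degree $D$\<close>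

text \<open>
  The coefficients of a tuple \<open>(F\<^sub>0, \<dots>, F\<^sub>m)\<close> of forms of degree \<open>D\<close> are indexed by the pairs
  \<open>(i, a)\<close> with \<open>i \<le> m\<close> and \<open>a\<close> a monomial of degree \<open>D\<close> in \<open>X\<^sub>0, \<dots>, X\<^sub>m\<close>.
\<close>

definition coeff_vars :: "nat \<Rightarrow> nat \<Rightarrow> (nat \<times> (nat \<Rightarrow>\<^sub>0 nat)) set" where
  "coeff_vars m D = {..m} \<times> {a. Poly_Mapping.keys a \<subseteq> {..m} \<and> mon_degree a = D}"

definition coeff_point ::
    "(nat \<Rightarrow> (nat, complex) mpoly) \<Rightarrow> nat \<times> (nat \<Rightarrow>\<^sub>0 nat) \<Rightarrow> complex" where
  "coeff_point F = (\<lambda>(i, a). Poly_Mapping.lookup (F i) a)"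

definition complexify :: "('v, int) mpoly \<Rightarrow> ('v, complex) mpoly" where
  "complexify R = Poly_Mapping.map of_int R"

text \<open>
  The resultant is characterised up to sign by this predicate. Irreducibility is stated in the
  polynomial ring over \<open>\<int>\<close> in all variables of the index type; this is the same as irreducibility in
  the subring on \<open>coeff_vars m D\<close>, because a factor of a nonzero polynomial involves no new variables.
\<close>

definition is_resultant :: "nat \<Rightarrow> nat \<Rightarrow> (nat \<times> (nat \<Rightarrow>\<^sub>0 nat), int) mpoly \<Rightarrow> bool" where
  "is_resultant m D R \<longleftrightarrow>
    mpoly_vars R \<subseteq> coeff_vars m D \<and> irreducible R \<and>
    (\<forall>F. (\<forall>i\<le>m. F i \<in> homog_polys m D) \<longrightarrow>
      (mpoly_eval (coeff_point F) (complexify R) = 0 \<longleftrightarrow> proj_zeros m (F ` {..m}) \<noteq> {}))"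

end

theory Submission
  imports
    Defs
    "HOL-Computational_Algebra.Field_as_Ring"
    "Subresultants.Subresultant_Gcd"
begin

text \<open>
  Only one direction of the characterisation of the resultant is used: a polynomial \<open>p\<close> in the
  coefficients that vanishes on all tuples with a common zero vanishes to order \<open>d = deg I\<close> on
  \<open>(I\<^sub>D)\<^sup>m\<^sup>+\<^sup>1\<close>. Let \<open>F\<close> be a tuple in \<open>I\<^sub>D\<close> whose first \<open>m\<close> members have finitely many common zeros,
  \<open>q\<close> a form of degree \<open>D\<close> without zeros among them, and consider a pencil \<open>f = F + t G\<close>, with
  \<open>s q\<close> added to the last member. Since the polynomial ring is Cohen--Macaulay, the forms
  \<open>f\<^sub>0, \<dots>, f\<^bsub>m-1\<^esub>\<close> span a space of codimension \<open>D\<^sup>m\<close> in each large degree \<open>\<nu>\<close>, for all \<open>t\<close> near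
  \<open>0\<close>; so there is a square matrix, whose rows are multiples of degree \<open>\<nu>\<close> of the \<open>f\<^sub>i\<close>, such that
  its determinant \<open>\<delta>(t, s)\<close> has degree \<open>D\<^sup>m\<close> in \<open>s\<close>, with a leading coefficient that does not vanish
  at \<open>t = 0\<close>, and vanishes at \<open>(t, s)\<close> if and only if the tuple has a common zero. For a generic
  direction \<open>G\<close> and almost all \<open>t\<close> the roots of \<open>\<delta>(t, \<cdot>)\<close> are simple, hence \<open>\<delta>\<close> divides \<open>p\<close> on the
  pencil up to a power of the leading coefficient. At \<open>t = s = 0\<close> all rows of the matrix lie in
  \<open>I\<^sub>\<nu>\<close>, which has codimension \<open>d\<close>, so \<open>t\<^sup>d\<close> divides \<open>\<delta>(t, 0)\<close> and therefore \<open>p(F + t G)\<close>.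
\<close>

section \<open>Dimensions of subspaces\<close>

text \<open>A determinant formed from multiples of \<open>m + 1\<close> forms can vanish without a
  common zero. Adding \<open>s q\<close> to the last member cures this: where the top coefficient in
  \<open>s\<close> is nonzero, \<open>q\<close> has no zero in common with the first
  \<open>m\<close> members, and a root in \<open>s\<close> forces a common zero, because otherwise
  the last member would be a nonzerodivisor modulo the first \<open>m\<close>.

  The number \<open>D^m\<close> and the simplicity of the roots come from one explicit system, the
  forms \<open>X_i^D - X_m^D\<close>. Its codimension is bounded above by counting monomials and
  below by counting points; complete intersections of the same degrees share it. A last member with
  distinct ratios to \<open>q\<close> at these points gives \<open>D^m\<close> different roots, and
  a discriminant carries this example to almost all parameters of any pencil through it.

  It remains to pass from generic to arbitrary directions, from generic to arbitrary
  \<open>F\<close>, and from lines to partial derivatives. Each time some polynomial in one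
  auxiliary parameter vanishes for all but finitely many values, hence everywhere.\<close>

context vector_space
begin

lemma span_Un_image_expand:
  assumes "finite K" "x \<in> span (B \<union> v ` K)"
  shows "\<exists>u\<in>span B. \<exists>a. x = u + (\<Sum>i\<in>K. scale (a i) (v i))"
  using assms
proof (induction K arbitrary: x rule: finite_induct)
  case empty
  then show ?case by auto
next
  case (insert k K)
  have "x \<in> span (insert (v k) (B \<union> v ` K))" using insert.prems by simp
  then obtain c where "x - scale c (v k) \<in> span (B \<union> v ` K)" by (auto simp: span_insert)
  from insert.IH[OF this] obtain u a where u: "u \<in> span B"
    and e: "x - scale c (v k) = u + (\<Sum>i\<in>K. scale (a i) (v i))" by blast
  have "(\<Sum>i\<in>K. scale ((a(k:=c)) i) (v i)) = (\<Sum>i\<in>K. scale (a i) (v i))"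
    using insert.hyps by (intro sum.cong) auto
  then have "x = u + (\<Sum>i\<in>insert k K. scale ((a(k:=c)) i) (v i))"
    using e insert.hyps by (simp add: algebra_simps)
  then show ?case using u by blast
qed

lemma basis_extension_exists:
  assumes "U \<subseteq> V" "finite S" "V \<subseteq> span S"
  obtains B C where "B \<subseteq> C" "C \<subseteq> V" "independent C" "finite C" "B \<subseteq> U" "U \<subseteq> span B"
    "V \<subseteq> span C" "card B = dim U" "card C = dim V"
proof -
  obtain B where B: "B \<subseteq> U" "independent B" "U \<subseteq> span B" "card B = dim U"
    using basis_exists by blast
  obtain C where C: "B \<subseteq> C" "C \<subseteq> V" "independent C" "V \<subseteq> span C"
    using maximal_independent_subset_extend[of B V] B assms by blast
  have "finite C" using independent_span_bound[of S C] C assms by auto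
  moreover have "card C = dim V" using C basis_card_eq_dim by blast
  ultimately show ?thesis using that B C by blast
qed

lemma dim_mono_finite:
  assumes "U \<subseteq> V" "finite S" "V \<subseteq> span S"
  shows "dim U \<le> dim V"
  using basis_extension_exists[OF assms] by (metis card_mono)

lemma subspace_eq_of_dim_le:
  assumes "U \<subseteq> V" "finite S" "V \<subseteq> span S" "subspace U" "dim V \<le> dim U"
  shows "U = V"
proof -
  obtain B C where BC: "B \<subseteq> C" "finite C" "B \<subseteq> U" "V \<subseteq> span C" "card B = dim U" "card C = dim V"
    using basis_extension_exists[OF assms(1-3)] by metis
  have "B = C" using card_seteq[of C B] BC assms by simp
  then show ?thesis using BC assms span_minimal[of B U] by blast
qed

text \<open>Independence modulo \<open>U\<close> is expressed through the coefficients of an indexed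
  family, so no quotient space is formed, and injectivity of \<open>v\<close> comes out of the
  proof. This is the main source of lower bounds on dimensions below.\<close>

lemma independent_mod_card_le:
  assumes V: "U \<subseteq> V" "finite S" "V \<subseteq> span S" "subspace U" and K: "finite K" "\<And>i. i \<in> K \<Longrightarrow> v i \<in> V"
    and ind: "\<And>a. (\<Sum>i\<in>K. scale (a i) (v i)) \<in> U \<Longrightarrow> \<forall>i\<in>K. a i = 0"
  shows "dim U + card K \<le> dim V"
proof -
  obtain B where B: "B \<subseteq> U" "independent B" "U \<subseteq> span B" "card B = dim U"
    using basis_exists by blast
  have BU: "span B \<subseteq> U" using B V span_minimal by blast
  have "B \<subseteq> span S" using B(1) V(1,3) by (meson order_trans)
  then have fB: "finite B" using independent_span_bound V(2) B(2) by blast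
  have "K' \<subseteq> K \<Longrightarrow> independent (B \<union> v ` K') \<and> card (B \<union> v ` K') = card B + card K'" if "finite K'" for K'
    using that
  proof (induction K' rule: finite_induct)
    case empty
    then show ?case using B by simp
  next
    case (insert k K')
    have n: "v k \<notin> span (B \<union> v ` K')"
    proof
      assume "v k \<in> span (B \<union> v ` K')"
      from span_Un_image_expand[OF insert.hyps(1) this]
      obtain u a where u: "u \<in> span B" "v k = u + (\<Sum>i\<in>K'. scale (a i) (v i))" by blast
      \<comment> \<open>Moving \<open>v k\<close> to the other side gives a combination in
        \<open>U\<close> with coefficient \<open>-1\<close> at \<open>k\<close>.\<close>
      define b where "b = (\<lambda>i. if i = k then -1 else if i \<in> K' then a i else 0)"
      have "(\<Sum>i\<in>K. scale (b i) (v i)) = (\<Sum>i\<in>insert k K'. scale (b i) (v i))"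
        using insert.prems K(1) by (intro sum.mono_neutral_right) (auto simp: b_def)
      also have "\<dots> = - v k + (\<Sum>i\<in>K'. scale (b i) (v i))"
        using insert.hyps by (simp add: b_def)
      also have "(\<Sum>i\<in>K'. scale (b i) (v i)) = (\<Sum>i\<in>K'. scale (a i) (v i))"
        using insert.hyps by (intro sum.cong) (auto simp: b_def)
      also have "- v k + (\<Sum>i\<in>K'. scale (a i) (v i)) = - u" using u by simp
      finally have "(\<Sum>i\<in>K. scale (b i) (v i)) \<in> U"
        using subspace_neg[OF V(4) subsetD[OF BU u(1)]] by simp
      from ind[OF this] insert.prems have "b k = 0" by blast
      then show False by (simp add: b_def)
    qed
    then have "v k \<notin> B \<union> v ` K'" using span_base[of "v k" "B \<union> v ` K'"] by argo
    moreover have "finite (B \<union> v ` K')" using fB insert.hyps by simp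
    moreover have "independent (B \<union> v ` K')" "card (B \<union> v ` K') = card B + card K'"
      using insert by auto
    moreover have "B \<union> v ` insert k K' = insert (v k) (B \<union> v ` K')" by auto
    ultimately show ?case using independent_insertI[OF n] insert.hyps by simp
  qed
  from this[OF K(1)] have I: "independent (B \<union> v ` K)" "card (B \<union> v ` K) = card B + card K" by auto
  have "B \<union> v ` K \<subseteq> V" using B V K by auto
  then have "dim (B \<union> v ` K) \<le> dim V" using dim_mono_finite V(2,3) by blast
  then show ?thesis using dim_eq_card_independent[OF I(1)] I(2) B(4) by simp
qed

lemma dim_le_add_card:
  assumes V: "finite S" "U \<subseteq> span S" and K: "finite K"
    and sp: "\<And>x. x \<in> V \<Longrightarrow> \<exists>u\<in>U. \<exists>a. x = u + (\<Sum>i\<in>K. scale (a i) (v i))"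
  shows "dim V \<le> dim U + card K"
proof -
  obtain B where B: "B \<subseteq> U" "independent B" "U \<subseteq> span B" "card B = dim U"
    using basis_exists by blast
  have fB: "finite B" using independent_span_bound[of S B] B V by auto
  have "V \<subseteq> span (B \<union> v ` K)"
  proof
    fix x assume "x \<in> V"
    then obtain u a where u: "u \<in> U" "x = u + (\<Sum>i\<in>K. scale (a i) (v i))" using sp by blast
    have "u \<in> span (B \<union> v ` K)" using u B span_mono[of B "B \<union> v ` K"] by blast
    moreover have "(\<Sum>i\<in>K. scale (a i) (v i)) \<in> span (B \<union> v ` K)"
      by (intro span_sum span_scale span_base) auto
    ultimately show "x \<in> span (B \<union> v ` K)" using u span_add by simp
  qed
  then have "dim V \<le> card (B \<union> v ` K)" using dim_le_card fB K by blast
  also have "\<dots> \<le> card B + card (v ` K)" by (rule card_Un_le)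
  also have "\<dots> \<le> card B + card K" using K card_image_le by auto
  finally show ?thesis using B by simp
qed

text \<open>Rank-nullity for the map from \<open>V\<close> to \<open>(U + f V) / U\<close> induced
  by \<open>f\<close>, written without quotients: a basis of the kernel is extended to a basis of
  \<open>V\<close>, and the images of the added vectors form a basis modulo
  \<open>U\<close>.\<close>

lemma dim_add_image:
  assumes f: "Vector_Spaces.linear scale scale f" and V: "subspace V" "finite S" "V \<subseteq> span S"
    and U: "subspace U" "finite T" "U \<subseteq> span T"
  shows "dim {u + f v | u v. u \<in> U \<and> v \<in> V} + dim {v\<in>V. f v \<in> U} = dim U + dim V"
proof -
  interpret f: Vector_Spaces.linear scale scale f by fact
  define W where "W = {v\<in>V. f v \<in> U}"
  define Q where "Q = {u + f v | u v. u \<in> U \<and> v \<in> V}"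
  have W: "W \<subseteq> V" "subspace W" using V U
    by (auto simp: W_def subspace_def f.add f.scale)
  obtain B C where BC: "B \<subseteq> C" "C \<subseteq> V" "independent C" "finite C" "B \<subseteq> W" "W \<subseteq> span B"
    "V \<subseteq> span C" "card B = dim W" "card C = dim V"
    using basis_extension_exists[OF W(1) V(2,3)] by metis
  have fS: "f ` V \<subseteq> span (f ` S)" using V(3) f.span_image[of S] by auto
  have QS: "Q \<subseteq> span (T \<union> f ` S)"
  proof
    fix x assume "x \<in> Q"
    then obtain u v where "x = u + f v" "u \<in> U" "v \<in> V" by (auto simp: Q_def)
    moreover from this have "u \<in> span (T \<union> f ` S)" "f v \<in> span (T \<union> f ` S)"
      
      using U(3) fS span_mono[of T "T \<union> f ` S"] span_mono[of "f ` S" "T \<union> f ` S"] by (meson Un_upper1 Un_upper2 image_subset_iff subsetD)+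
    ultimately show "x \<in> span (T \<union> f ` S)" using span_add by simp
  qed
  have UQ: "U \<subseteq> Q" 
  proof
    fix u assume "u \<in> U"
    moreover have "u = u + f 0" using f.zero by simp
    ultimately show "u \<in> Q" using V(1) subspace_0 unfolding Q_def by blast
  qed
  have fQ: "f c \<in> Q" if "c \<in> V" for c 
  proof -
    have "f c = 0 + f c" by simp
    then show ?thesis using U(1) subspace_0 that unfolding Q_def by blast
  qed
  have fC: "finite (C - B)" using BC by simp
  have "dim U + card (C - B) \<le> dim Q"
  proof (rule independent_mod_card_le[OF UQ _ QS U(1) fC])
    show "finite (T \<union> f ` S)" using U V by simp
    show "f i \<in> Q" if "i \<in> C - B" for i using that BC fQ by blast
    show "\<forall>i\<in>C - B. a i = 0" if "(\<Sum>i\<in>C - B. scale (a i) (f i)) \<in> U" for a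
    proof -
      let ?x = "\<Sum>i\<in>C - B. scale (a i) i"
      have "f ?x \<in> U" using that by (simp add: f.sum f.scale)
      moreover have "?x \<in> V" using BC V by (intro subspace_sum) (auto intro: subspace_scale)
      ultimately have "?x \<in> span B" using BC by (auto simp: W_def)
      have fB: "finite B" using BC finite_subset by blast
      obtain b where b: "?x = (\<Sum>i\<in>B. scale (b i) i)"
        using span_Un_image_expand[OF fB, of ?x "{}" id] \<open>?x \<in> span B\<close> by auto
      \<comment> \<open>Equating the expansions of \<open>?x\<close> in \<open>B\<close> and in
        \<open>C - B\<close> gives a relation on the basis \<open>C\<close>, so all its coefficients
        vanish.\<close>
      define c where "c = (\<lambda>i. if i \<in> B then - b i else a i)"
      have "(\<Sum>i\<in>C. scale (c i) i) = (\<Sum>i\<in>B. scale (c i) i) + (\<Sum>i\<in>C - B. scale (c i) i)"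
        using sum.subset_diff[OF BC(1,4)] by (simp add: add.commute)
      also have "(\<Sum>i\<in>B. scale (c i) i) = - ?x" unfolding b by (simp add: c_def sum_negf)
      also have "(\<Sum>i\<in>C - B. scale (c i) i) = ?x" by (intro sum.cong) (auto simp: c_def)
      finally have "(\<Sum>i\<in>C. scale (c i) i) = 0" by simp
      then have "\<forall>i\<in>C. c i = 0" using BC independent_explicit_finite_subsets by blast
      then show ?thesis by (auto simp: c_def)
    qed
  qed
  moreover have "dim Q \<le> dim U + card (C - B)"
  proof (rule dim_le_add_card[OF U(2,3) fC])
    fix x assume "x \<in> Q"
    then obtain u v where uv: "x = u + f v" "u \<in> U" "v \<in> V" by (auto simp: Q_def)
    have "v \<in> span (B \<union> id ` (C - B))" using uv BC by (auto simp: Un_absorb1)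
    from span_Un_image_expand[OF fC this] obtain w a
      where w: "w \<in> span B" "v = w + (\<Sum>i\<in>C - B. scale (a i) i)" by auto
    have "w \<in> W" using w BC W span_minimal by blast
    then have "u + f w \<in> U" using uv U by (auto simp: W_def subspace_add)
    moreover have "x = (u + f w) + (\<Sum>i\<in>C - B. scale (a i) (f i))"
      using uv w by (simp add: f.add f.sum f.scale add.assoc)
    ultimately show "\<exists>u\<in>U. \<exists>a. x = u + (\<Sum>i\<in>C - B. scale (a i) (f i))" by blast
  qed
  moreover have "card (C - B) + card B = card C" using BC
    by (metis card_Diff_subset card_mono finite_subset le_add_diff_inverse2)
  ultimately show ?thesis using BC unfolding W_def Q_def by linarith
qed

end

section \<open>Polynomials and homogeneous ideals\<close>

lemma poly_mapping_sum_singles: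
  fixes p :: "'k \<Rightarrow>\<^sub>0 'b::comm_monoid_add"
  shows "(\<Sum>a\<in>Poly_Mapping.keys p. Poly_Mapping.single a (Poly_Mapping.lookup p a)) = p"
proof (rule poly_mapping_eqI)
  fix k
  have "(\<Sum>a\<in>Poly_Mapping.keys p. Poly_Mapping.lookup p a when a = k) = Poly_Mapping.lookup p k"
    by (simp add: when_def in_keys_iff)
  then show "Poly_Mapping.lookup (\<Sum>a\<in>Poly_Mapping.keys p. Poly_Mapping.single a (Poly_Mapping.lookup p a)) k
      = Poly_Mapping.lookup p k"
    by (simp add: lookup_sum lookup_single)
qed

lemma poly_mapping_single_induct [case_names zero single add]:
  fixes p :: "'k \<Rightarrow>\<^sub>0 'b::comm_monoid_add"
  assumes "P 0" "\<And>a c. P (Poly_Mapping.single a c)" "\<And>p q. P p \<Longrightarrow> P q \<Longrightarrow> P (p + q)"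
  shows "P p"
proof -
  have "P (\<Sum>a\<in>S. Poly_Mapping.single a (Poly_Mapping.lookup p a))" if "finite S" for S
    using that by induction (auto intro: assms)
  from this[OF finite_keys[of p]] show ?thesis by (simp add: poly_mapping_sum_singles)
qed

section \<open>Evaluation of polynomials\<close>

definition monomial_value :: "('v \<Rightarrow> 'b::comm_semiring_1) \<Rightarrow> ('v \<Rightarrow>\<^sub>0 nat) \<Rightarrow> 'b" where
  "monomial_value X a = (\<Prod>v\<in>Poly_Mapping.keys a. X v ^ Poly_Mapping.lookup a v)"

lemma monomial_value_superset:
  assumes "finite S" "Poly_Mapping.keys a \<subseteq> S"
  shows "monomial_value X a = (\<Prod>v\<in>S. X v ^ Poly_Mapping.lookup a v)"
  unfolding monomial_value_def using assms
  by (intro prod.mono_neutral_left) (auto simp: in_keys_iff)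

lemma monomial_value_zero [simp]: "monomial_value X 0 = 1"
  by (simp add: monomial_value_def)

lemma monomial_value_single [simp]: "monomial_value X (Poly_Mapping.single v n) = X v ^ n"
  by (subst monomial_value_superset[of "{v}"]) auto

lemma monomial_value_add: "monomial_value X (a + b) = monomial_value X a * monomial_value X b"
proof -
  let ?S = "Poly_Mapping.keys a \<union> Poly_Mapping.keys b"
  have "Poly_Mapping.keys (a + b) \<subseteq> ?S" by (rule keys_add)
  then show ?thesis
    by (simp add: monomial_value_superset[of ?S] lookup_add power_add prod.distrib)
qed

text \<open>Evaluation with the coefficients moved along \<open>h\<close>. Besides
  \<open>mpoly_eval\<close> it covers the substitution of polynomials in one or two parameters,
  which is how restrictions to lines and surfaces are formed later.\<close>

definition mpoly_hom :: "('a::zero \<Rightarrow> 'b::comm_semiring_1) \<Rightarrow> ('v \<Rightarrow> 'b) \<Rightarrow> ('v, 'a) mpoly \<Rightarrow> 'b" where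
  "mpoly_hom h X p = (\<Sum>a\<in>Poly_Mapping.keys p. h (Poly_Mapping.lookup p a) * monomial_value X a)"

lemma mpoly_eval_eq_hom: "mpoly_eval x p = mpoly_hom (\<lambda>c. c) x p"
  by (simp add: mpoly_eval_def mpoly_hom_def monomial_value_def)

context
  fixes h :: "'a::comm_semiring_1 \<Rightarrow> 'b::comm_semiring_1"
  assumes h: "h 0 = 0" "h 1 = 1" "\<And>a b. h (a + b) = h a + h b" "\<And>a b. h (a * b) = h a * h b"
begin

lemma mpoly_hom_superset:
  assumes "finite S" "Poly_Mapping.keys p \<subseteq> S"
  shows "mpoly_hom h X p = (\<Sum>a\<in>S. h (Poly_Mapping.lookup p a) * monomial_value X a)"
  unfolding mpoly_hom_def using assms
  by (intro sum.mono_neutral_left) (auto simp: in_keys_iff h)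

lemma mpoly_hom_zero [simp]: "mpoly_hom h X 0 = 0"
  by (simp add: mpoly_hom_def)

lemma mpoly_hom_single: "mpoly_hom h X (Poly_Mapping.single a c) = h c * monomial_value X a"
  by (subst mpoly_hom_superset[of "{a}"]) auto

lemma mpoly_hom_one: "mpoly_hom h X 1 = 1"
  using mpoly_hom_single[of X 0 1] h by simp

lemma mpoly_hom_add: "mpoly_hom h X (p + q) = mpoly_hom h X p + mpoly_hom h X q"
proof -
  let ?S = "Poly_Mapping.keys p \<union> Poly_Mapping.keys q"
  have "Poly_Mapping.keys (p + q) \<subseteq> ?S" by (rule keys_add)
  then show ?thesis
    by (simp add: mpoly_hom_superset[of ?S] lookup_add h algebra_simps sum.distrib)
qed

lemma mpoly_hom_mult_single:
  "mpoly_hom h X (Poly_Mapping.single a c * q) = h c * monomial_value X a * mpoly_hom h X q"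
proof (induction q rule: poly_mapping_single_induct)
  case (single b d)
  then show ?case by (simp add: mult_single mpoly_hom_single h monomial_value_add mult_ac)
next
  case (add p q)
  then show ?case by (simp add: distrib_left mpoly_hom_add)
qed simp

lemma mpoly_hom_mult: "mpoly_hom h X (p * q) = mpoly_hom h X p * mpoly_hom h X q"
proof (induction p rule: poly_mapping_single_induct)
  case (single b d)
  then show ?case by (simp add: mpoly_hom_mult_single mpoly_hom_single)
next
  case (add p q)
  then show ?case by (simp add: distrib_right mpoly_hom_add)
qed simp

end

lemma
  fixes x :: "'v \<Rightarrow> 'a::comm_semiring_1"
  shows mpoly_eval_zero [simp]: "mpoly_eval x 0 = 0"
    and mpoly_eval_one [simp]: "mpoly_eval x 1 = 1"
    and mpoly_eval_add: "mpoly_eval x (p + q) = mpoly_eval x p + mpoly_eval x q"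
    and mpoly_eval_mult: "mpoly_eval x (p * q) = mpoly_eval x p * mpoly_eval x q"
    and mpoly_eval_single: "mpoly_eval x (Poly_Mapping.single a c) = c * monomial_value x a"
  unfolding mpoly_eval_eq_hom
  by (simp_all add: mpoly_hom_one mpoly_hom_add mpoly_hom_mult mpoly_hom_single)

lemma mpoly_eval_uminus: "mpoly_eval x (- p :: ('v, 'a::comm_ring_1) mpoly) = - mpoly_eval x p"
  using mpoly_eval_add[of x p "- p"] by (simp add: eq_neg_iff_add_eq_0 add.commute)

lemma mpoly_eval_diff:
  "mpoly_eval x (p - q :: ('v, 'a::comm_ring_1) mpoly) = mpoly_eval x p - mpoly_eval x q"
  using mpoly_eval_add[of x p "- q"] by (simp add: mpoly_eval_uminus)

lemma mpoly_eval_sum: "mpoly_eval x (sum f S) = (\<Sum>i\<in>S. mpoly_eval x (f i))"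
  by (induction S rule: infinite_finite_induct) (auto simp: mpoly_eval_add)

lemma mpoly_eval_power: "mpoly_eval x (p ^ n) = mpoly_eval x p ^ n"
  by (induction n) (auto simp: mpoly_eval_mult)

section \<open>Degrees of monomials and spaces of forms\<close>

lemma mon_degree_superset:
  assumes "finite S" "Poly_Mapping.keys a \<subseteq> S"
  shows "mon_degree a = (\<Sum>v\<in>S. Poly_Mapping.lookup a v)"
  unfolding mon_degree_def using assms
  by (intro sum.mono_neutral_left) (auto simp: in_keys_iff)

lemma mon_degree_zero [simp]: "mon_degree 0 = 0"
  by (simp add: mon_degree_def)

lemma mon_degree_add: "mon_degree (a + b) = mon_degree a + mon_degree b"
proof -
  let ?S = "Poly_Mapping.keys a \<union> Poly_Mapping.keys b"
  have "Poly_Mapping.keys (a + b) \<subseteq> ?S" by (rule keys_add)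
  then show ?thesis
    by (simp add: mon_degree_superset[of ?S] lookup_add sum.distrib)
qed

lemma mon_degree_single [simp]: "mon_degree (Poly_Mapping.single v n) = n"
  by (subst mon_degree_superset[of "{v}"]) auto

lemma lookup_single_mult:
  "Poly_Mapping.lookup (Poly_Mapping.single a (c::'a::comm_semiring_1) * p) (a + b) = c * Poly_Mapping.lookup p b"
  for a :: "'v \<Rightarrow>\<^sub>0 nat"
proof (induction p rule: poly_mapping_single_induct)
  case (single d e)
  then show ?case by (auto simp: mult_single lookup_single when_def)
next
  case (add p q)
  then show ?case by (simp add: distrib_left lookup_add)
qed simp

lemma keys_single_mult: 
  "Poly_Mapping.keys (Poly_Mapping.single a (c::'a::comm_semiring_1) * p) \<subseteq> (\<lambda>b. a + b) ` Poly_Mapping.keys p"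
  using keys_mult[of "Poly_Mapping.single a c" p] by (auto split: if_splits)

lemma lookup_const_mult:
  "Poly_Mapping.lookup (Poly_Mapping.single 0 (c::'a::comm_semiring_1) * p) b = c * Poly_Mapping.lookup p b"
  for b :: "'v \<Rightarrow>\<^sub>0 nat"
  using lookup_single_mult[of 0 c p b] by simp

abbreviation mscale :: "complex \<Rightarrow> (nat, complex) mpoly \<Rightarrow> (nat, complex) mpoly" where
  "mscale c p \<equiv> Poly_Mapping.single 0 c * p"

lemma mpoly_eval_mscale: "mpoly_eval x (mscale c p) = c * mpoly_eval x p"
  by (simp add: mpoly_eval_mult mpoly_eval_single)

lemma linear_mult_right: "Vector_Spaces.linear mscale mscale (\<lambda>p. p * g)"
  by unfold_locales (simp_all add: algebra_simps)

locale projective_space =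
  fixes m :: nat
begin

abbreviation forms :: "nat \<Rightarrow> (nat, complex) mpoly set" where
  "forms n \<equiv> homog_polys m n"

definition monomials :: "nat \<Rightarrow> (nat \<Rightarrow>\<^sub>0 nat) set" where
  "monomials n = {a. Poly_Mapping.keys a \<subseteq> {..m} \<and> mon_degree a = n}"

lemma forms_iff: "p \<in> forms n \<longleftrightarrow> Poly_Mapping.keys p \<subseteq> monomials n"
  by (auto simp: homog_polys_def poly_ring_def mpoly_vars_def monomials_def)

lemma monomials_add: "a \<in> monomials k \<Longrightarrow> b \<in> monomials n \<Longrightarrow> a + b \<in> monomials (k + n)"
  using keys_add[of a b] by (auto simp: monomials_def mon_degree_add)

lemma monomials_single: "i \<le> m \<Longrightarrow> Poly_Mapping.single i n \<in> monomials n"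
  by (auto simp: monomials_def)

lemma finite_monomials [simp]: "finite (monomials n)"
proof -
  have "Poly_Mapping.lookup ` monomials n \<subseteq> {f. \<forall>i. (i \<in> {..m} \<longrightarrow> f i \<in> {..n}) \<and> (i \<notin> {..m} \<longrightarrow> f i = 0)}"
  proof clarify
    fix a i assume "a \<in> monomials n"
    then have a: "Poly_Mapping.keys a \<subseteq> {..m}" "n = (\<Sum>v\<in>{..m}. Poly_Mapping.lookup a v)"
      by (auto simp: monomials_def mon_degree_superset[of "{..m}" a])
    have "Poly_Mapping.lookup a i \<le> n" if "i \<le> m"
      unfolding a(2) using that by (intro member_le_sum) auto
    moreover have "Poly_Mapping.lookup a i = 0" if "\<not> i \<le> m" using that a(1) by (auto simp: in_keys_iff)
    ultimately show "(i \<in> {..m} \<longrightarrow> Poly_Mapping.lookup a i \<in> {..n}) \<and> (i \<notin> {..m} \<longrightarrow> Poly_Mapping.lookup a i = 0)"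
      by auto
  qed
  then have "finite (Poly_Mapping.lookup ` monomials n)"
    using finite_set_of_finite_funs[of "{..m}" "{..n}" 0] finite_subset by blast
  then show ?thesis
    by (rule finite_imageD) (simp add: inj_on_def lookup_inject)
qed

lemma forms_zero [simp]: "0 \<in> forms n"
  by (simp add: forms_iff)

lemma forms_add: "p \<in> forms n \<Longrightarrow> q \<in> forms n \<Longrightarrow> p + q \<in> forms n"
  using keys_add[of p q] by (auto simp: forms_iff)

lemma forms_mult: "p \<in> forms k \<Longrightarrow> q \<in> forms n \<Longrightarrow> p * q \<in> forms (k + n)"
  using keys_mult[of p q] monomials_add by (fastforce simp: forms_iff)

lemma forms_single: "a \<in> monomials n \<Longrightarrow> Poly_Mapping.single a c \<in> forms n"
  by (auto simp: forms_iff)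

lemma forms_const: "Poly_Mapping.single 0 c \<in> forms 0"
  by (rule forms_single) (simp add: monomials_def)

lemma forms_one [simp]: "1 \<in> forms 0"
  using forms_const[of 1] by simp

lemma forms_mscale: "p \<in> forms n \<Longrightarrow> mscale c p \<in> forms n"
  using forms_mult[OF forms_const] by fastforce

lemma subspace_forms: "cmpoly.subspace (forms n)"
  by (simp add: cmpoly.subspace_def forms_add forms_mscale)

lemma forms_diff: "p \<in> forms n \<Longrightarrow> q \<in> forms n \<Longrightarrow> p - q \<in> forms n"
  by (rule cmpoly.subspace_diff[OF subspace_forms])

lemma forms_sum: "(\<And>i. i \<in> S \<Longrightarrow> f i \<in> forms n) \<Longrightarrow> sum f S \<in> forms n"
  by (rule cmpoly.subspace_sum[OF subspace_forms])

lemma forms_power: "p \<in> forms d \<Longrightarrow> p ^ k \<in> forms (k * d)"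
  by (induction k) (auto simp: forms_mult)

definition var :: "nat \<Rightarrow> (nat, complex) mpoly" where
  "var i = Poly_Mapping.single (Poly_Mapping.single i 1) 1"

lemma forms_var: "i \<le> m \<Longrightarrow> var i \<in> forms (Suc 0)"
  unfolding var_def by (intro forms_single) (use monomials_single[of i 1] in simp)

lemma mpoly_eval_var [simp]: "mpoly_eval x (var i) = x i"
  by (simp add: var_def mpoly_eval_single)

definition form_basis :: "nat \<Rightarrow> (nat, complex) mpoly set" where
  "form_basis n = (\<lambda>a. Poly_Mapping.single a 1) ` monomials n"

lemma finite_form_basis [simp]: "finite (form_basis n)"
  by (simp add: form_basis_def)

lemma forms_subset_span: "forms n \<subseteq> cmpoly.span (form_basis n)"
proof
  fix p assume "p \<in> forms n"
  then have "Poly_Mapping.keys p \<subseteq> monomials n" by (simp add: forms_iff)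
  have "(\<Sum>a\<in>Poly_Mapping.keys p. mscale (Poly_Mapping.lookup p a) (Poly_Mapping.single a 1)) \<in> cmpoly.span (form_basis n)"
    using \<open>Poly_Mapping.keys p \<subseteq> monomials n\<close>
    by (intro cmpoly.span_sum cmpoly.span_scale cmpoly.span_base) (auto simp: form_basis_def)
  then show "p \<in> cmpoly.span (form_basis n)"
    by (simp add: mult_single poly_mapping_sum_singles)
qed

lemma form_basis_subset: "form_basis n \<subseteq> forms n"
  by (auto simp: form_basis_def forms_single)

lemma monomials_Suc:
  assumes "a \<in> monomials (Suc n)"
  obtains i b where "i \<le> m" "b \<in> monomials n" "a = Poly_Mapping.single i 1 + b"
proof -
  have "a \<noteq> 0" using assms by (auto simp: monomials_def)
  then obtain i where i: "i \<in> Poly_Mapping.keys a" by (metis all_not_in_conv keys_eq_empty)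
  then have im: "i \<le> m" using assms by (auto simp: monomials_def)
  define b where "b = a - Poly_Mapping.single i 1"
  have ab: "a = Poly_Mapping.single i 1 + b"
    using i by (intro poly_mapping_eqI) (auto simp: b_def lookup_add lookup_minus lookup_single when_def in_keys_iff)
  have "Poly_Mapping.keys b \<subseteq> Poly_Mapping.keys a"
    by (auto simp: b_def in_keys_iff lookup_minus)
  moreover have "mon_degree b = n"
    using assms ab by (auto simp: monomials_def mon_degree_add)
  ultimately have "b \<in> monomials n" using assms by (auto simp: monomials_def)
  then show ?thesis using that im ab by blast
qed

text \<open>A homogeneous ideal is represented by the sequence of its components.\<close>

definition graded :: "(nat \<Rightarrow> (nat, complex) mpoly set) \<Rightarrow> bool" where
  "graded J \<longleftrightarrow> (\<forall>n. cmpoly.subspace (J n) \<and> J n \<subseteq> forms n \<and>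
     (\<forall>k. \<forall>p\<in>forms k. \<forall>q\<in>J n. p * q \<in> J (k + n)))"

text \<open>The dimension of the degree \<open>n\<close> part of the quotient ring. For graded
  \<open>J\<close> the truncated subtraction is exact by \<open>graded_dim_le\<close>.\<close>

definition codim :: "(nat \<Rightarrow> (nat, complex) mpoly set) \<Rightarrow> nat \<Rightarrow> nat" where
  "codim J n = cmpoly_dim (forms n) - cmpoly_dim (J n)"

text \<open>For graded \<open>J\<close> this says that \<open>J\<close> contains a power of the
  irrelevant ideal \<open>(X_0, ..., X_m)\<close>; the unit ideal is included. One full component
  makes all later ones full, by \<open>primary_mono\<close>, and by \<open>primary_iff\<close> the
  property amounts to the absence of projective zeros.\<close>

definition primary :: "(nat \<Rightarrow> (nat, complex) mpoly set) \<Rightarrow> bool" where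
  "primary J \<longleftrightarrow> (\<exists>n. J n = forms n)"

text \<open>The ideal \<open>J + (g)\<close> for \<open>g\<close> of degree \<open>d\<close>, one
  degree at a time. The case distinction keeps the truncated \<open>n - d\<close> from admitting
  constant cofactors below degree \<open>d\<close>.\<close>

definition add_gen :: "nat \<Rightarrow> (nat, complex) mpoly \<Rightarrow> (nat \<Rightarrow> (nat, complex) mpoly set) \<Rightarrow>
    nat \<Rightarrow> (nat, complex) mpoly set" where
  "add_gen d g J n = {u + v * g | u v. u \<in> J n \<and> v \<in> (if d \<le> n then forms (n - d) else {0})}"

definition nonzerodivisor :: "nat \<Rightarrow> (nat, complex) mpoly \<Rightarrow> (nat \<Rightarrow> (nat, complex) mpoly set) \<Rightarrow> bool" where
  "nonzerodivisor d g J \<longleftrightarrow> (\<forall>n. \<forall>h\<in>forms n. h * g \<in> J (n + d) \<longrightarrow> h \<in> J n)"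

lemma graded_subspace: "graded J \<Longrightarrow> cmpoly.subspace (J n)"
  and graded_subset: "graded J \<Longrightarrow> J n \<subseteq> forms n"
  and graded_mult: "graded J \<Longrightarrow> p \<in> forms k \<Longrightarrow> q \<in> J n \<Longrightarrow> p * q \<in> J (k + n)"
  by (auto simp: graded_def)

lemma graded_mult': "graded J \<Longrightarrow> p \<in> forms k \<Longrightarrow> q \<in> J n \<Longrightarrow> q * p \<in> J (n + k)"
  using graded_mult[of J p k q n] by (simp add: mult.commute add.commute)

lemma
  assumes "graded J"
  shows graded_zero: "0 \<in> J n"
    and graded_add: "p \<in> J n \<Longrightarrow> q \<in> J n \<Longrightarrow> p + q \<in> J n"
    and graded_diff: "p \<in> J n \<Longrightarrow> q \<in> J n \<Longrightarrow> p - q \<in> J n"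
    and graded_uminus: "p \<in> J n \<Longrightarrow> - p \<in> J n"
    and graded_mscale: "p \<in> J n \<Longrightarrow> mscale c p \<in> J n"
    and graded_sum: "(\<And>i. i \<in> S \<Longrightarrow> f i \<in> J n) \<Longrightarrow> sum f S \<in> J n"
proof -
  have s: "cmpoly.subspace (J n)" using assms by (rule graded_subspace)
  show "0 \<in> J n" using s by (rule cmpoly.subspace_0)
  show "p \<in> J n \<Longrightarrow> q \<in> J n \<Longrightarrow> p + q \<in> J n" using s by (rule cmpoly.subspace_add)
  show "p \<in> J n \<Longrightarrow> q \<in> J n \<Longrightarrow> p - q \<in> J n" using s by (rule cmpoly.subspace_diff)
  show "p \<in> J n \<Longrightarrow> - p \<in> J n" using s by (rule cmpoly.subspace_neg)
  show "p \<in> J n \<Longrightarrow> mscale c p \<in> J n" using s by (rule cmpoly.subspace_scale)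
  show "(\<And>i. i \<in> S \<Longrightarrow> f i \<in> J n) \<Longrightarrow> sum f S \<in> J n" using s by (rule cmpoly.subspace_sum)
qed

lemma graded_dim_le: "graded J \<Longrightarrow> cmpoly_dim (J n) \<le> cmpoly_dim (forms n)"
  using cmpoly.dim_mono_finite[OF graded_subset finite_form_basis forms_subset_span] .

lemma graded_eq_forms_iff: "graded J \<Longrightarrow> J n = forms n \<longleftrightarrow> codim J n = 0"
  using cmpoly.subspace_eq_of_dim_le[of "J n" "forms n" "form_basis n"] graded_subset[of J n]
    forms_subset_span[of n] graded_subspace[of J n]
  by (auto simp: codim_def)

lemma graded_zero_ideal: "graded (\<lambda>n. {0})"
  by (auto simp: graded_def cmpoly.subspace_def)

lemma add_gen_alt:
  "add_gen d g J (k + d) = {u + v * g | u v. u \<in> J (k + d) \<and> v \<in> forms k}"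
  by (simp add: add_gen_def)

lemma add_gen_less: "n < d \<Longrightarrow> add_gen d g J n = J n"
  by (auto simp: add_gen_def)

lemma add_gen_supset: "J n \<subseteq> add_gen d g J n"
proof
  fix u assume "u \<in> J n"
  moreover have "u = u + 0 * g" by simp
  ultimately show "u \<in> add_gen d g J n" unfolding add_gen_def by force
qed

lemma add_gen_mult_mem: "graded J \<Longrightarrow> v \<in> forms k \<Longrightarrow> v * g \<in> add_gen d g J (k + d)"
  unfolding add_gen_alt using graded_zero[of J "k + d"] by force

lemma add_gen_mem: "graded J \<Longrightarrow> g \<in> add_gen d g J d"
  using add_gen_mult_mem[of J 1 0 g d] by simp

lemma graded_add_gen:
  assumes J: "graded J" and g: "g \<in> forms d"
  shows "graded (add_gen d g J)"
  unfolding graded_def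
proof (intro allI conjI ballI)
  fix n
  let ?F = "if d \<le> n then forms (n - d) else {0}"
  have F: "cmpoly.subspace ?F" using subspace_forms by (auto simp: cmpoly.subspace_def)
  show "add_gen d g J n \<subseteq> forms n"
  proof
    fix p assume "p \<in> add_gen d g J n"
    then obtain u v where uv: "p = u + v * g" "u \<in> J n" "v \<in> ?F" by (auto simp: add_gen_def)
    have "v * g \<in> forms n"
      using forms_mult[of v "n - d" g d] uv g by (cases "d \<le> n") auto
    then show "p \<in> forms n" using uv J graded_subset forms_add by blast
  qed
  show "cmpoly.subspace (add_gen d g J n)"
  proof (rule cmpoly.subspaceI)
    show "0 \<in> add_gen d g J n" using graded_zero[OF J] add_gen_supset by blast
    fix p q assume "p \<in> add_gen d g J n" "q \<in> add_gen d g J n"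
    then obtain u v u' v' where "p = u + v * g" "u \<in> J n" "v \<in> ?F" "q = u' + v' * g" "u' \<in> J n" "v' \<in> ?F"
      by (auto simp: add_gen_def)
    moreover have "u + v * g + (u' + v' * g) = (u + u') + (v + v') * g" by (simp add: algebra_simps)
    ultimately show "p + q \<in> add_gen d g J n"
      using graded_add[OF J] cmpoly.subspace_add[OF F] unfolding add_gen_def by blast
  next
    fix c p assume "p \<in> add_gen d g J n"
    then obtain u v where "p = u + v * g" "u \<in> J n" "v \<in> ?F" by (auto simp: add_gen_def)
    moreover have "mscale c (u + v * g) = mscale c u + mscale c v * g" by (simp add: algebra_simps)
    ultimately show "mscale c p \<in> add_gen d g J n"
      using graded_mscale[OF J] cmpoly.subspace_scale[OF F] unfolding add_gen_def by blast
  qed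
  fix k p q assume p: "p \<in> forms k" and "q \<in> add_gen d g J n"
  then obtain u v where uv: "q = u + v * g" "u \<in> J n" "v \<in> ?F" by (auto simp: add_gen_def)
  have "p * v \<in> (if d \<le> k + n then forms (k + n - d) else {0})"
    using forms_mult[OF p, of v "n - d"] uv(3) by (cases "d \<le> n") auto
  moreover have "p * u \<in> J (k + n)" using graded_mult[OF J p uv(2)] .
  moreover have "p * q = p * u + (p * v) * g" using uv by (simp add: algebra_simps)
  ultimately show "p * q \<in> add_gen d g J (k + n)" unfolding add_gen_def by blast
qed

text \<open>A monomial of degree \<open>n + 1\<close> is a variable times a monomial of degree
  \<open>n\<close>.\<close>

lemma primary_mono: "graded J \<Longrightarrow> J n = forms n \<Longrightarrow> n \<le> k \<Longrightarrow> J k = forms k"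
proof (induction "k - n" arbitrary: k)
  case (Suc j)
  then obtain k' where k: "k = Suc k'" and IH: "J k' = forms k'" by (cases k) auto
  have "Poly_Mapping.single a c \<in> J k" if "a \<in> monomials k" for a c
  proof -
    from that obtain i b where ib: "i \<le> m" "b \<in> monomials k'" "a = Poly_Mapping.single i 1 + b"
      using monomials_Suc k by blast
    have "var i * Poly_Mapping.single b c \<in> J (Suc 0 + k')"
      using ib IH Suc.prems by (intro graded_mult) (auto simp: forms_var forms_single)
    then show ?thesis using ib k by (simp add: var_def mult_single)
  qed
  then have "p \<in> J k" if "p \<in> forms k" for p
    using graded_sum[OF Suc.prems(1), of "Poly_Mapping.keys p" "\<lambda>a. Poly_Mapping.single a (Poly_Mapping.lookup p a)" k] that
    unfolding poly_mapping_sum_singles by (auto simp: forms_iff)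
  then show ?case using graded_subset Suc.prems by blast
qed simp

text \<open>Multiplication by \<open>g\<close> maps the quotient by \<open>J\<close> in degree
  \<open>n\<close> to the one in degree \<open>n + d\<close>, and its cokernel is the quotient by
  \<open>J + (g)\<close>. The rank of this map is at most the dimension of its source; for a
  nonzerodivisor the map is injective and equality holds. The recursions for Hilbert functions below
  all come from here.\<close>

lemma codim_add_gen:
  assumes J: "graded J" and g: "g \<in> forms d"
  shows "codim (add_gen d g J) (n + d) + codim J n \<ge> codim J (n + d)"
    and "nonzerodivisor d g J \<Longrightarrow> codim (add_gen d g J) (n + d) + codim J n = codim J (n + d)"
proof -
  let ?W = "{v \<in> forms n. v * g \<in> J (n + d)}"
  have fin: "J n \<subseteq> cmpoly.span (form_basis n)" for n
    using graded_subset[OF J] forms_subset_span by blast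
  have e: "cmpoly_dim (add_gen d g J (n + d)) + cmpoly_dim ?W = cmpoly_dim (J (n + d)) + cmpoly_dim (forms n)"
    unfolding add_gen_alt
    using cmpoly.dim_add_image[OF linear_mult_right[of g] subspace_forms finite_form_basis forms_subset_span
      graded_subspace[OF J] finite_form_basis fin] .
  have JW: "J n \<subseteq> ?W" using graded_subset[OF J] graded_mult'[OF J g] by blast
  have WA: "?W \<subseteq> forms n" by blast
  have "cmpoly_dim (J n) \<le> cmpoly_dim ?W"
    using cmpoly.dim_mono_finite[OF JW finite_form_basis] forms_subset_span by blast
  moreover have "cmpoly_dim (add_gen d g J (n + d)) \<le> cmpoly_dim (forms (n + d))"
    "cmpoly_dim (J (n + d)) \<le> cmpoly_dim (forms (n + d))" "cmpoly_dim (J n) \<le> cmpoly_dim (forms n)"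
    using graded_dim_le[OF graded_add_gen[OF J g]] graded_dim_le[OF J] by auto
  ultimately show "codim (add_gen d g J) (n + d) + codim J n \<ge> codim J (n + d)"
    using e unfolding codim_def by linarith
  assume "nonzerodivisor d g J"
  then have "?W = J n" using JW by (auto simp: nonzerodivisor_def)
  then show "codim (add_gen d g J) (n + d) + codim J n = codim J (n + d)"
    using e graded_dim_le[OF J] graded_dim_le[OF graded_add_gen[OF J g]] unfolding codim_def
    by (smt (verit) add_diff_cancel_left' diff_add_inverse2 le_add_diff_inverse2 add.commute add.left_commute add_diff_assoc2)
qed

end

section \<open>Projective zeros and the Nullstellensatz\<close>

lemma single_sum: "Poly_Mapping.single a (sum f S) = (\<Sum>i\<in>S. Poly_Mapping.single a (f i))"
  by (induction S rule: infinite_finite_induct) (auto simp: single_add)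

text \<open>A vector space over an infinite field is not a finite union of proper subspaces. The
  functionals are indexed by an arbitrary type, so that evaluations at points and expressions in
  pairs of points are both covered.\<close>

lemma subspace_avoid_kernels:
  fixes \<phi> :: "'k \<Rightarrow> (nat, complex) mpoly \<Rightarrow> complex"
  assumes L: "cmpoly.subspace L" and "finite K"
    and add: "\<And>k p q. \<phi> k (p + q) = \<phi> k p + \<phi> k q" and scl: "\<And>k c p. \<phi> k (mscale c p) = c * \<phi> k p"
    and "\<And>k. k \<in> K \<Longrightarrow> \<exists>p\<in>L. \<phi> k p \<noteq> 0"
  shows "\<exists>p\<in>L. \<forall>k\<in>K. \<phi> k p \<noteq> 0"
  using assms(2,5)
proof (induction K rule: finite_induct)
  case empty
  then show ?case using cmpoly.subspace_0[OF L] by blast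
next
  case (insert k K)
  then obtain p where p: "p \<in> L" "\<forall>k\<in>K. \<phi> k p \<noteq> 0" by auto
  obtain q where q: "q \<in> L" "\<phi> k q \<noteq> 0" using insert.prems[of k] by auto
  \<comment> \<open>Each functional excludes at most one value of \<open>c\<close>. Where it
    vanishes at \<open>q\<close>, the quotient is \<open>0\<close> by convention and its exclusion
    is harmless.\<close>
  have "finite ((\<lambda>k. - \<phi> k p / \<phi> k q) ` insert k K)" using insert.hyps by simp
  then obtain c where c: "c \<notin> (\<lambda>k. - \<phi> k p / \<phi> k q) ` insert k K"
    using ex_new_if_finite[OF infinite_UNIV_char_0] by blast
  have "\<phi> j (p + mscale c q) \<noteq> 0" if j: "j \<in> insert k K" for j
  proof
    assume *: "\<phi> j (p + mscale c q) = 0"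
    have "\<phi> j q \<noteq> 0"
    proof
      assume "\<phi> j q = 0"
      then have "\<phi> j p = 0" "j \<noteq> k" using * q(2) by (auto simp: add scl)
      then show False using p(2) j by auto
    qed
    moreover have "\<phi> j p + c * \<phi> j q = 0" using * by (simp add: add scl)
    ultimately have "c = - \<phi> j p / \<phi> j q" by (simp add: field_simps eq_neg_iff_add_eq_0)
    then show False using c j by blast
  qed
  moreover have "p + mscale c q \<in> L"
    using cmpoly.subspace_add[OF L p(1) cmpoly.subspace_scale[OF L q(1)]] .
  ultimately show ?case by blast
qed

context projective_space
begin

definition point :: "(nat \<Rightarrow> complex) \<Rightarrow> bool" where
  "point x \<longleftrightarrow> (\<forall>i>m. x i = 0) \<and> (\<exists>i. x i \<noteq> 0)"

definition zeros :: "(nat \<Rightarrow> (nat, complex) mpoly set) \<Rightarrow> (nat \<Rightarrow> complex) set" where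
  "zeros J = {x. point x \<and> (\<forall>n. \<forall>p\<in>J n. mpoly_eval x p = 0)}"

lemma point_coord: "point x \<Longrightarrow> \<exists>i\<le>m. x i \<noteq> 0"
  unfolding point_def using not_less by blast

lemma primary_imp_zeros_empty: "primary J \<Longrightarrow> zeros J = {}"
proof (rule ccontr)
  assume "primary J" "zeros J \<noteq> {}"
  then obtain n x where n: "J n = forms n" and x: "x \<in> zeros J" by (auto simp: primary_def)
  then have "point x" by (simp add: zeros_def)
  then obtain i where i: "i \<le> m" "x i \<noteq> 0" using point_coord by blast
  have "var i ^ n \<in> forms n" using forms_power[OF forms_var[OF i(1)], of n] by simp
  then have "mpoly_eval x (var i ^ n) = 0" using x n by (auto simp: zeros_def)
  then show False using i by (simp add: mpoly_eval_power)
qed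

lemma graded_one_imp_primary:
  assumes "graded J" "1 \<in> J 0"
  shows "primary J"
proof -
  have "p \<in> J 0" if "p \<in> forms 0" for p using graded_mult[OF assms(1) that assms(2)] by simp
  then show ?thesis using graded_subset[OF assms(1)] unfolding primary_def by blast
qed

text \<open>Zorn's lemma for graded ideals, encoded as sets of pairs of a degree and a form so that
  set inclusion orders them. The union of a chain stays non-primary because the space of forms of
  degree \<open>n\<close> has a finite basis: if the union contained it, so would a single
  member.\<close>

lemma maximal_nonprimary:
  assumes J: "graded J" "\<not> primary J"
  obtains M where "graded M" "\<not> primary M" "\<And>n. J n \<subseteq> M n"
    "\<forall>M'. graded M' \<longrightarrow> \<not> primary M' \<longrightarrow> (\<forall>n. M n \<subseteq> M' n) \<longrightarrow> M' = M"
proof -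
  define \<F> where "\<F> = {S :: (nat \<times> (nat, complex) mpoly) set. graded (\<lambda>n. S `` {n}) \<and>
    \<not> primary (\<lambda>n. S `` {n}) \<and> (\<forall>n. J n \<subseteq> S `` {n})}"
  have "Sigma UNIV J \<in> \<F>" using J by (simp add: \<F>_def Image_singleton)
  then have ne: "\<F> \<noteq> {}" by blast
  have "\<Union>\<C> \<in> \<F>" if C: "\<C> \<noteq> {}" "subset.chain \<F> \<C>" for \<C>
  proof -
    have CF: "\<And>S. S \<in> \<C> \<Longrightarrow> S \<in> \<F>" using C(2) by (auto simp: subset.chain_def)
    have lin: "S \<subseteq> S' \<or> S' \<subseteq> S" if "S \<in> \<C>" "S' \<in> \<C>" for S S'
      using C(2) that by (auto simp: subset_chain_def)
    have gr: "graded (\<lambda>n. S `` {n})" if "S \<in> \<C>" for S using CF[OF that] by (simp add: \<F>_def)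
    obtain S0 where S0: "S0 \<in> \<C>" using C(1) by blast
    have "graded (\<lambda>n. \<Union>\<C> `` {n})"
      unfolding graded_def
    proof (intro allI conjI ballI cmpoly.subspaceI)
      fix n
      show "0 \<in> \<Union>\<C> `` {n}" using graded_zero[OF gr[OF S0], of n] S0 by blast
      show "p + q \<in> \<Union>\<C> `` {n}" if "p \<in> \<Union>\<C> `` {n}" "q \<in> \<Union>\<C> `` {n}" for p q
      proof -
        from that obtain S S' where SS: "S \<in> \<C>" "S' \<in> \<C>" "p \<in> S `` {n}" "q \<in> S' `` {n}" by blast
        then obtain T where "T \<in> \<C>" "p \<in> T `` {n}" "q \<in> T `` {n}" using lin[OF SS(1,2)] by blast
        then show ?thesis using graded_add[OF gr, of T p n q] by blast
      qed
      show "mscale c p \<in> \<Union>\<C> `` {n}" if "p \<in> \<Union>\<C> `` {n}" for c p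
        using that graded_mscale[OF gr, of _ p n c] by blast
      show "\<Union>\<C> `` {n} \<subseteq> forms n" using graded_subset[OF gr] by blast
      show "p * q \<in> \<Union>\<C> `` {k + n}" if "p \<in> forms k" "q \<in> \<Union>\<C> `` {n}" for k p q
        using that graded_mult[OF gr, of _ p k q n] by blast
    qed
    moreover have "\<not> primary (\<lambda>n. \<Union>\<C> `` {n})"
    proof
      assume "primary (\<lambda>n. \<Union>\<C> `` {n})"
      then obtain n where n: "\<Union>\<C> `` {n} = forms n" by (auto simp: primary_def)
      have "{n} \<times> form_basis n \<subseteq> \<Union>\<C>" using n form_basis_subset[of n] by blast
      then obtain S where S: "S \<in> \<C>" "{n} \<times> form_basis n \<subseteq> S"
        using finite_subset_Union_chain[OF _ _ C(1,2)] by (metis finite_SigmaI finite_form_basis finite.emptyI finite_insert)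
      then have "cmpoly.span (form_basis n) \<subseteq> S `` {n}"
        by (intro cmpoly.span_minimal graded_subspace[OF gr]) auto
      then have "S `` {n} = forms n" using forms_subset_span graded_subset[OF gr[OF S(1)], of n] by blast
      then show False using CF[OF S(1)] by (auto simp: \<F>_def primary_def)
    qed
    moreover have "\<forall>n. J n \<subseteq> \<Union>\<C> `` {n}"
    proof
      fix n have "J n \<subseteq> S0 `` {n}" using CF[OF S0] by (simp add: \<F>_def)
      then show "J n \<subseteq> \<Union>\<C> `` {n}" using S0 by blast
    qed
    ultimately show ?thesis by (simp add: \<F>_def)
  qed
  from subset_Zorn_nonempty[OF ne this]
  obtain S where S: "S \<in> \<F>" "\<And>X. X \<in> \<F> \<Longrightarrow> S \<subseteq> X \<Longrightarrow> X = S" by metis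
  define M where "M = (\<lambda>n. S `` {n})"
  have M: "graded M" "\<not> primary M" "\<And>n. J n \<subseteq> M n" using S(1) by (auto simp: \<F>_def M_def)
  show ?thesis
  proof (rule that[OF M], intro allI impI)
    fix M' assume M': "graded M'" "\<not> primary M'" "\<forall>n. M n \<subseteq> M' n"
    have "Sigma UNIV M' \<in> \<F>" using M' M(3) by (auto simp: \<F>_def Image_singleton dest: subsetD)
    moreover have "S \<subseteq> Sigma UNIV M'" using M'(3) by (auto simp: M_def)
    ultimately have "Sigma UNIV M' = S" using S(2) by blast
    then show "M' = M" by (auto simp: M_def)
  qed
qed

text \<open>If \<open>h\<close> and \<open>h'\<close> both lie outside \<open>M\<close>, then by
  maximality \<open>M + (h)\<close> and \<open>M + (h')\<close> contain all forms of large degree,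
  hence so does \<open>M + (h h')\<close>, which is \<open>M\<close> when \<open>h h'\<close> lies
  in \<open>M\<close>.\<close>

lemma maximal_nonprimary_prime:
  assumes M: "graded M" "\<not> primary M"
    and mx: "\<forall>M'. graded M' \<longrightarrow> \<not> primary M' \<longrightarrow> (\<forall>n. M n \<subseteq> M' n) \<longrightarrow> M' = M"
  shows "h \<in> forms d \<Longrightarrow> h \<notin> M d \<Longrightarrow> primary (add_gen d h M)"
    and "h \<in> forms d \<Longrightarrow> h' \<in> forms d' \<Longrightarrow> h * h' \<in> M (d + d') \<Longrightarrow> h \<in> M d \<or> h' \<in> M d'"
proof -
  show *: "primary (add_gen d h M)" if "h \<in> forms d" "h \<notin> M d" for d h
  proof (rule ccontr)
    assume "\<not> primary (add_gen d h M)"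
    then have "add_gen d h M = M"
      using mx graded_add_gen[OF M(1) that(1)] add_gen_supset by blast
    then show False using add_gen_mem[OF M(1), of h d] that by simp
  qed
  assume h: "h \<in> forms d" "h' \<in> forms d'" "h * h' \<in> M (d + d')"
  show "h \<in> M d \<or> h' \<in> M d'"
  proof (rule ccontr)
    assume "\<not> (h \<in> M d \<or> h' \<in> M d')"
    then obtain N N' where N: "add_gen d h M N = forms N" "add_gen d' h' M N' = forms N'"
      using *[OF h(1)] *[OF h(2)] by (auto simp: primary_def)
    let ?k = "N + N'"
    \<comment> \<open>The degree \<open>?k + d' + d\<close> leaves room for a division by
      \<open>h\<close> and then by \<open>h'\<close>, with both degrees still beyond the bounds
      \<open>N\<close> and \<open>N'\<close>.\<close>
    have 1: "add_gen d h M ((?k + d') + d) = forms ((?k + d') + d)"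
      using primary_mono[OF graded_add_gen[OF M(1) h(1)] N(1)] by simp
    have 2: "add_gen d' h' M (?k + d') = forms (?k + d')"
      using primary_mono[OF graded_add_gen[OF M(1) h(2)] N(2)] by simp
    have "p \<in> M (?k + d' + d)" if pk: "p \<in> forms (?k + d' + d)" for p
    proof -
      obtain u v where uv: "p = u + v * h" "u \<in> M (?k + d' + d)" "v \<in> forms (?k + d')"
        using pk 1 unfolding add_gen_alt by blast
      obtain u' v' where uv': "v = u' + v' * h'" "u' \<in> M (?k + d')" "v' \<in> forms ?k"
        using uv(3) 2 unfolding add_gen_alt by blast
      have "u' * h \<in> M (?k + d' + d)" using graded_mult'[OF M(1) h(1) uv'(2)] .
      moreover have "v' * (h * h') \<in> M (?k + d' + d)"
        using graded_mult[OF M(1) uv'(3) h(3)] by (simp add: ac_simps)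
      moreover have "p = u + (u' * h + v' * (h * h'))" using uv uv' by (simp add: algebra_simps)
      ultimately show ?thesis using uv(2) graded_add[OF M(1)] by simp
    qed
    then have "M (?k + d' + d) = forms (?k + d' + d)" using graded_subset[OF M(1)] by blast
    then show False using M(2) by (auto simp: primary_def)
  qed
qed

text \<open>The homogenization \<open>u^k p(x/u)\<close> of \<open>p\<close> in degree
  \<open>k\<close>, meaningful for \<open>degree p \<le> k\<close>; a root \<open>c\<close> of
  \<open>p\<close> splits off the linear factor \<open>x - c u\<close>.\<close>

definition binary_form :: "(nat, complex) mpoly \<Rightarrow> (nat, complex) mpoly \<Rightarrow> complex poly \<Rightarrow> nat \<Rightarrow> (nat, complex) mpoly" where
  "binary_form x u p k = (\<Sum>l\<le>k. mscale (coeff p l) (u ^ (k - l) * x ^ l))"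

lemma binary_form_shift: "binary_form x u (pCons 0 q) (Suc k) = x * binary_form x u q k"
  unfolding binary_form_def sum.atMost_Suc_shift by (simp add: sum_distrib_left mult_ac)

lemma binary_form_Suc:
  assumes "degree q \<le> k"
  shows "binary_form x u q (Suc k) = u * binary_form x u q k"
proof -
  have "coeff q (Suc k) = 0" using assms by (simp add: coeff_eq_0)
  then have "binary_form x u q (Suc k) = (\<Sum>l\<le>k. mscale (coeff q l) (u ^ (Suc k - l) * x ^ l))"
    by (simp add: binary_form_def)
  also have "\<dots> = (\<Sum>l\<le>k. u * mscale (coeff q l) (u ^ (k - l) * x ^ l))"
    by (intro sum.cong) (auto simp: Suc_diff_le mult_ac)
  finally show ?thesis by (simp add: binary_form_def sum_distrib_left)
qed

lemma binary_form_diff_smult: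
  "binary_form x u (p - Polynomial.smult c q) k = binary_form x u p k - mscale c (binary_form x u q k)"
proof -
  have "mscale (a - c * b) w = mscale a w - mscale c (mscale b w)" for a b w
  proof -
    have "Poly_Mapping.single 0 (a - c * b) = Poly_Mapping.single (0::nat \<Rightarrow>\<^sub>0 nat) a - Poly_Mapping.single 0 c * Poly_Mapping.single 0 b"
      by (simp add: single_diff mult_single)
    then show ?thesis by (simp only: left_diff_distrib mult.assoc)
  qed
  then show ?thesis by (simp add: binary_form_def sum_subtractf sum_distrib_left)
qed

lemma forms_binary_form:
  assumes "x \<in> forms (Suc 0)" "u \<in> forms (Suc 0)"
  shows "binary_form x u p k \<in> forms k"
  unfolding binary_form_def
proof (intro forms_sum forms_mscale)
  fix l assume "l \<in> {..k}"
  then show "u ^ (k - l) * x ^ l \<in> forms k"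
    using forms_mult[OF forms_power[OF assms(2), of "k - l"] forms_power[OF assms(1), of l]] by simp
qed

text \<open>In the quotient by a maximal non-primary
  homogeneous ideal the Hilbert function is bounded, so a binary form in two coordinates vanishes
  there; it splits into linear factors, and by primality one of them vanishes as well. Hence all
  coordinates are proportional modulo the ideal.\<close>

theorem nullstellensatz:
  assumes J: "graded J" "\<not> primary J"
  shows "zeros J \<noteq> {}"
proof -
  obtain M where M: "graded M" "\<not> primary M" and JM: "\<And>n. J n \<subseteq> M n"
    and mx: "\<forall>M'. graded M' \<longrightarrow> \<not> primary M' \<longrightarrow> (\<forall>n. M n \<subseteq> M' n) \<longrightarrow> M' = M"
    using maximal_nonprimary[OF J] by metis
  note primary_of_notin = maximal_nonprimary_prime(1)[OF M mx]
  note prime = maximal_nonprimary_prime(2)[OF M mx]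
  have "\<exists>i\<le>m. var i \<notin> M (Suc 0)"
  proof (rule ccontr)
    assume "\<not> ?thesis"
    then have v: "\<And>i. i \<le> m \<Longrightarrow> var i \<in> M (Suc 0)" by blast
    have "form_basis (Suc 0) \<subseteq> M (Suc 0)"
    proof
      fix p assume "p \<in> form_basis (Suc 0)"
      then obtain a where a: "a \<in> monomials (Suc 0)" "p = Poly_Mapping.single a 1"
        by (auto simp: form_basis_def)
      then obtain i b where ib: "i \<le> m" "b \<in> monomials 0" "a = Poly_Mapping.single i 1 + b"
        using monomials_Suc by blast
      have "p = var i * Poly_Mapping.single b 1" using a ib by (simp add: var_def mult_single)
      moreover have "var i * Poly_Mapping.single b 1 \<in> M (Suc 0 + 0)"
        using graded_mult'[OF M(1) forms_single[OF ib(2)] v[OF ib(1)]] by simp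
      ultimately show "p \<in> M (Suc 0)" by simp
    qed
    then have "cmpoly.span (form_basis (Suc 0)) \<subseteq> M (Suc 0)"
      by (rule cmpoly.span_minimal) (rule graded_subspace[OF M(1)])
    then have "M (Suc 0) = forms (Suc 0)"
      using forms_subset_span graded_subset[OF M(1), of "Suc 0"] by blast
    then show False using M(2) by (auto simp: primary_def)
  qed
  then obtain i where i: "i \<le> m" "var i \<notin> M (Suc 0)" by blast
  define u where "u = var i"
  have u: "u \<in> forms (Suc 0)" "u \<notin> M (Suc 0)" using i by (auto simp: u_def forms_var)
  have uk: "u ^ k \<notin> M k" for k
  proof (induction k)
    case 0
    then show ?case using graded_one_imp_primary M by auto
  next
    case (Suc k)
    then show ?case using prime[of u "Suc 0" "u ^ k" k] u forms_power[OF u(1), of k] by auto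
  qed
  have nz: "nonzerodivisor (Suc 0) u M"
    unfolding nonzerodivisor_def using prime[of _ _ u "Suc 0"] u by blast
  obtain N where N: "add_gen (Suc 0) u M N = forms N"
    using primary_of_notin[OF u] by (auto simp: primary_def)
  have gu: "graded (add_gen (Suc 0) u M)" using graded_add_gen[OF M(1) u(1)] .
  \<comment> \<open>\<open>M + (u)\<close> is everything from degree \<open>N\<close> on, so the
    injective multiplication by \<open>u\<close> is also surjective modulo \<open>M\<close>
    there.\<close>
  have const: "codim M (N + k) = codim M N" for k
  proof (induction k)
    case (Suc k)
    have "codim (add_gen (Suc 0) u M) (N + k + Suc 0) = 0"
      using primary_mono[OF gu N, of "N + k + Suc 0"] graded_eq_forms_iff[OF gu] by simp
    then show ?case using codim_add_gen(2)[OF M(1) u(1) nz, of "N + k"] Suc by simp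
  qed simp
  have linear_factor: "\<exists>c. x - mscale c u \<in> M (Suc 0)"
    if x: "x \<in> forms (Suc 0)" and "p \<noteq> 0" "degree p \<le> k" "binary_form x u p k \<in> M k" for x p k
    using that(2-)
  proof (induction "degree p" arbitrary: p k)
    case 0
    then obtain a where a: "p = [:a:]" using degree_eq_zeroE by metis
    then have "a \<noteq> 0" using 0 by simp
    have "binary_form x u p k = (\<Sum>l\<in>{..k}. if l = 0 then mscale a (u ^ k) else 0)"
      unfolding binary_form_def a by (intro sum.cong) (auto simp: coeff_pCons split: nat.splits)
    also have "\<dots> = mscale a (u ^ k)" by simp
    finally have "mscale a (u ^ k) \<in> M k" using 0(4) by simp
    then have "mscale (inverse a) (mscale a (u ^ k)) \<in> M k" by (rule graded_mscale[OF M(1)])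
    then have "u ^ k \<in> M k" using \<open>a \<noteq> 0\<close> by simp
    then show ?case using uk by blast
  next
    case (Suc n)
    then have "\<not> constant (poly p)" by (simp add: constant_degree)
    then obtain c where "poly p c = 0" using fundamental_theorem_of_algebra by blast
    then obtain q where q: "p = [:- c, 1:] * q" by (metis dvd_def poly_eq_0_iff_dvd)
    then have q0: "q \<noteq> 0" using Suc.prems by auto
    have dq: "degree q = n" using Suc.hyps(2) q0 by (simp add: q degree_mult_eq del: mult_pCons_left)
    obtain k' where k: "k = Suc k'" using Suc by (cases k) auto
    then have dk: "degree q \<le> k'" using Suc.prems(2) Suc.hyps(2) dq by simp
    have "p = pCons 0 q - Polynomial.smult c q" by (simp add: q)
    then have "binary_form x u p k = x * binary_form x u q k' - mscale c (u * binary_form x u q k')"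
      by (simp only: k binary_form_diff_smult binary_form_shift binary_form_Suc[OF dk])
    also have "\<dots> = (x - mscale c u) * binary_form x u q k'" by (simp only: left_diff_distrib mult.assoc)
    finally have "binary_form x u p k = (x - mscale c u) * binary_form x u q k'" .
    then have "(x - mscale c u) * binary_form x u q k' \<in> M (Suc 0 + k')" using Suc.prems k by simp
    then have "x - mscale c u \<in> M (Suc 0) \<or> binary_form x u q k' \<in> M k'"
      using prime forms_binary_form[OF x u(1)] forms_diff[OF x forms_mscale[OF u(1)]] by blast
    then show ?case using Suc.hyps(1)[of q k'] dq q0 dk by blast
  qed
  have "\<exists>c. var j - mscale c u \<in> M (Suc 0)" if j: "j \<le> m" for j
  proof -
    \<comment> \<open>In degree \<open>?k\<close> there are \<open>?k + 1\<close> binary monomials,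
      more than the codimension \<open>codim M N\<close>, so they are dependent modulo
      \<open>M\<close>.\<close>
    let ?x = "var j" and ?k = "N + codim M N"
    have x: "?x \<in> forms (Suc 0)" using forms_var[OF j] .
    have "\<not> (\<forall>a. (\<Sum>l\<in>{..?k}. mscale (a l) (u ^ (?k - l) * ?x ^ l)) \<in> M ?k \<longrightarrow> (\<forall>l\<in>{..?k}. a l = 0))"
    proof
      assume *: "\<forall>a. (\<Sum>l\<in>{..?k}. mscale (a l) (u ^ (?k - l) * ?x ^ l)) \<in> M ?k \<longrightarrow> (\<forall>l\<in>{..?k}. a l = 0)"
      have "cmpoly_dim (M ?k) + card {..?k} \<le> cmpoly_dim (forms ?k)"
      proof (rule cmpoly.independent_mod_card_le[OF graded_subset[OF M(1)] finite_form_basis forms_subset_span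
            graded_subspace[OF M(1)]])
        fix l assume "l \<in> {..?k}"
        then show "u ^ (?k - l) * ?x ^ l \<in> forms ?k"
          using forms_mult[OF forms_power[OF u(1), of "?k - l"] forms_power[OF x, of l]] by simp
      qed (use * in auto)
      then have "Suc ?k \<le> codim M ?k" by (simp add: codim_def)
      then show False using const by simp
    qed
    then obtain a where a: "(\<Sum>l\<in>{..?k}. mscale (a l) (u ^ (?k - l) * ?x ^ l)) \<in> M ?k" "\<exists>l\<le>?k. a l \<noteq> 0"
      by auto
    define p where "p = (\<Sum>l\<le>?k. monom (a l) l)"
    have cp: "coeff p l = a l" if "l \<le> ?k" for l
      using that by (simp add: p_def coeff_sum coeff_monom)
    have "p \<noteq> 0" using a(2) cp by (metis coeff_0)
    moreover have "degree p \<le> ?k" unfolding p_def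
      by (rule degree_sum_le) (auto intro: order_trans[OF degree_monom_le])
    moreover have "binary_form ?x u p ?k \<in> M ?k"
    proof -
      have "binary_form ?x u p ?k = (\<Sum>l\<in>{..?k}. mscale (a l) (u ^ (?k - l) * ?x ^ l))"
        unfolding binary_form_def by (intro sum.cong) (auto simp: cp)
      then show ?thesis using a(1) by simp
    qed
    ultimately show ?thesis using linear_factor[OF x] by blast
  qed
  then obtain c where c: "\<And>j. j \<le> m \<Longrightarrow> var j - mscale (c j) u \<in> M (Suc 0)" by metis
  \<comment> \<open>Modulo \<open>M\<close> the coordinate \<open>var j\<close> is
    \<open>c j\<close> times \<open>u = var i\<close>; \<open>c i = 1\<close> makes \<open>x\<close>
    a nonzero vector.\<close>
  define x where "x = (\<lambda>j. if j \<le> m then c j else 0)"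
  have "c i = 1"
  proof (rule ccontr)
    assume "c i \<noteq> 1"
    have "mscale (1 - c i) u \<in> M (Suc 0)" using c[OF i(1)]
      by (simp add: u_def algebra_simps single_diff)
    then have "mscale (inverse (1 - c i)) (mscale (1 - c i) u) \<in> M (Suc 0)"
      using graded_mscale[OF M(1)] by blast
    then show False using u(2) \<open>c i \<noteq> 1\<close> by (simp add: mult_single flip: mult.assoc)
  qed
  then have px: "point x" using i by (auto simp: point_def x_def intro!: exI[of _ i])
  \<comment> \<open>Modulo \<open>M\<close> a form of degree \<open>n\<close> is its value at
    \<open>x\<close> times \<open>u ^ n\<close>. As no power of \<open>u\<close> lies in
    \<open>M\<close>, all members of \<open>M\<close> vanish at \<open>x\<close>.\<close>
  have mono: "Poly_Mapping.single a 1 - mscale (monomial_value x a) (u ^ n) \<in> M n" if "a \<in> monomials n" for n a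
    using that
  proof (induction n arbitrary: a)
    case 0
    then have "a = 0" by (auto simp: monomials_def mon_degree_def in_keys_iff intro!: poly_mapping_eqI)
    then show ?case using graded_zero[OF M(1)] by simp
  next
    case (Suc n)
    then obtain j b where jb: "j \<le> m" "b \<in> monomials n" "a = Poly_Mapping.single j 1 + b"
      using monomials_Suc by blast
    let ?b = "Poly_Mapping.single b (1::complex)"
    have "(var j - mscale (x j) u) * ?b \<in> M (Suc 0 + n)"
      using graded_mult'[OF M(1) forms_single[OF jb(2)] c[OF jb(1)]] jb(1) by (simp add: x_def)
    moreover have "mscale (x j) u * (?b - mscale (monomial_value x b) (u ^ n)) \<in> M (Suc 0 + n)"
      using graded_mult[OF M(1) forms_mscale[OF u(1)] Suc.IH[OF jb(2)]] .
    ultimately have "(var j - mscale (x j) u) * ?b + mscale (x j) u * (?b - mscale (monomial_value x b) (u ^ n)) \<in> M (Suc n)"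
      using graded_add[OF M(1)] by simp
    moreover have "X * B - (c * d) * (u * U) = (X - c * u) * B + (c * u) * (B - d * U)"
      for X B c d U :: "(nat, complex) mpoly" by (simp add: algebra_simps)
    moreover have "Poly_Mapping.single a 1 = var j * ?b" using jb(3) by (simp add: var_def mult_single)
    moreover have "Poly_Mapping.single 0 (monomial_value x a) =
        Poly_Mapping.single (0::nat \<Rightarrow>\<^sub>0 nat) (x j) * Poly_Mapping.single 0 (monomial_value x b)"
      using jb(3) by (simp add: monomial_value_add mult_single)
    ultimately have "Poly_Mapping.single a 1 - mscale (monomial_value x a) (u ^ Suc n) \<in> M (Suc n)"
      by (simp only: power_Suc)
    then show ?case by simp
  qed
  have "mpoly_eval x p = 0" if p: "p \<in> M n" for n p
  proof -
    let ?K = "Poly_Mapping.keys p" and ?c = "Poly_Mapping.lookup p"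
    have "(\<Sum>a\<in>?K. mscale (?c a) (Poly_Mapping.single a 1 - mscale (monomial_value x a) (u ^ n))) \<in> M n"
      using p graded_subset[OF M(1)] mono
      by (intro graded_sum[OF M(1)] graded_mscale[OF M(1)]) (auto simp: forms_iff subset_iff)
    also have "(\<Sum>a\<in>?K. mscale (?c a) (Poly_Mapping.single a 1 - mscale (monomial_value x a) (u ^ n))) =
      (\<Sum>a\<in>?K. Poly_Mapping.single a (?c a)) - (\<Sum>a\<in>?K. Poly_Mapping.single 0 (?c a * monomial_value x a)) * u ^ n"
      by (simp add: sum_subtractf right_diff_distrib mult_single sum_distrib_right flip: mult.assoc)
    also have "(\<Sum>a\<in>?K. Poly_Mapping.single 0 (?c a * monomial_value x a)) = Poly_Mapping.single 0 (mpoly_eval x p)"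
      by (simp add: mpoly_eval_eq_hom mpoly_hom_def single_sum)
    finally have "p - mscale (mpoly_eval x p) (u ^ n) \<in> M n" by (simp add: poly_mapping_sum_singles)
    then have "mscale (mpoly_eval x p) (u ^ n) \<in> M n" using graded_diff[OF M(1) p] by fastforce
    then have "mscale (inverse (mpoly_eval x p)) (mscale (mpoly_eval x p) (u ^ n)) \<in> M n"
      using graded_mscale[OF M(1)] by blast
    then show ?thesis using uk[of n] by (cases "mpoly_eval x p = 0") (auto simp: mult_single simp flip: mult.assoc)
  qed
  then have "x \<in> zeros J" using px JM by (auto simp: zeros_def)
  then show ?thesis by blast
qed

corollary primary_iff: "graded J \<Longrightarrow> primary J \<longleftrightarrow> zeros J = {}"
  using nullstellensatz primary_imp_zeros_empty by blast

section \<open>Projectively distinct points and forms that separate them\<close>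

text \<open>Equality in projective space when both arguments are points: \<open>c = 0\<close> is
  excluded as soon as \<open>y\<close> is nonzero.\<close>

definition proportional :: "(nat \<Rightarrow> complex) \<Rightarrow> (nat \<Rightarrow> complex) \<Rightarrow> bool" where
  "proportional x y \<longleftrightarrow> (\<exists>c. y = (\<lambda>i. c * x i))"

lemma proportional_sym: "point y \<Longrightarrow> proportional x y \<Longrightarrow> proportional y x"
proof -
  assume "point y" "proportional x y"
  then obtain c i where "y = (\<lambda>i. c * x i)" "y i \<noteq> 0" by (auto simp: proportional_def point_def)
  then have "x = (\<lambda>j. inverse c * y j)" by auto
  then show ?thesis unfolding proportional_def by blast
qed

text \<open>Some minor \<open>x_i y_j - x_j y_i\<close> is nonzero, and then
  \<open>x_i Z_j - x_j Z_i\<close> vanishes at \<open>x\<close> but not at \<open>y\<close>.\<close>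

lemma separating_linear_form:
  assumes "point x" "point y" "\<not> proportional x y"
  shows "\<exists>p\<in>forms (Suc 0). mpoly_eval x p = 0 \<and> mpoly_eval y p \<noteq> 0"
proof -
  obtain i where i: "i \<le> m" "x i \<noteq> 0" using point_coord[OF assms(1)] by blast
  have "\<exists>j\<le>m. x i * y j \<noteq> x j * y i"
  proof (rule ccontr)
    assume *: "\<not> ?thesis"
    have "y j = (y i / x i) * x j" for j
    proof (cases "j \<le> m")
      case True
      then show ?thesis using * i by (auto simp: field_simps)
    next
      case False
      then show ?thesis using assms by (simp add: point_def)
    qed
    then have "y = (\<lambda>j. (y i / x i) * x j)" by blast
    then show False using assms(3) unfolding proportional_def by blast
  qed
  then obtain j where j: "j \<le> m" "x i * y j \<noteq> x j * y i" by blast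
  have "mscale (x i) (var j) - mscale (x j) (var i) \<in> forms (Suc 0)"
    using i j by (intro forms_diff forms_mscale forms_var)
  moreover have "mpoly_eval z (mscale (x i) (var j) - mscale (x j) (var i)) = x i * z j - x j * z i" for z
    by (simp add: mpoly_eval_diff mpoly_eval_mscale)
  ultimately show ?thesis using j by (intro bexI[of _ "mscale (x i) (var j) - mscale (x j) (var i)"]) auto
qed

text \<open>A product of separating linear forms, raised to degree \<open>n\<close> by a power of a
  variable that is nonzero at \<open>y\<close>.\<close>

lemma separating_form:
  assumes "finite X" "\<And>x. x \<in> X \<Longrightarrow> point x \<and> \<not> proportional x y" "point y" "card X \<le> n"
  shows "\<exists>p\<in>forms n. mpoly_eval y p \<noteq> 0 \<and> (\<forall>x\<in>X. mpoly_eval x p = 0)"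
proof -
  have "\<exists>p\<in>forms (card X). mpoly_eval y p \<noteq> 0 \<and> (\<forall>x\<in>X. mpoly_eval x p = 0)"
    using assms(1,2)
  proof (induction X rule: finite_induct)
    case empty
    then show ?case by (intro bexI[of _ 1]) auto
  next
    case (insert x X)
    then obtain p where p: "p \<in> forms (card X)" "mpoly_eval y p \<noteq> 0" "\<forall>x\<in>X. mpoly_eval x p = 0" by auto
    obtain q where q: "q \<in> forms (Suc 0)" "mpoly_eval x q = 0" "mpoly_eval y q \<noteq> 0"
      using separating_linear_form[of x y] insert.prems assms(3) by auto
    have "q * p \<in> forms (card (insert x X))" using forms_mult[OF q(1) p(1)] insert.hyps by simp
    then show ?case using p q by (intro bexI[of _ "q * p"]) (auto simp: mpoly_eval_mult)
  qed
  then obtain p where p: "p \<in> forms (card X)" "mpoly_eval y p \<noteq> 0" "\<forall>x\<in>X. mpoly_eval x p = 0" by blast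
  obtain i where i: "i \<le> m" "y i \<noteq> 0" using point_coord assms(3) by blast
  have "var i ^ (n - card X) * p \<in> forms n"
    using forms_mult[OF forms_power[OF forms_var[OF i(1)], of "n - card X"] p(1)] assms(4) by simp
  then show ?thesis using p i
    by (intro bexI[of _ "var i ^ (n - card X) * p"]) (auto simp: mpoly_eval_mult mpoly_eval_power)
qed

text \<open>The separating forms of the points are independent modulo \<open>J\<close>, because
  evaluation at one point kills \<open>J\<close> and all of them but one. The condition
  \<open>card X \<le> n\<close> provides the degree that these forms require.\<close>

lemma card_le_codim:
  assumes J: "graded J" and X: "finite X" "X \<subseteq> zeros J" "pairwise (\<lambda>x y. \<not> proportional x y) X"
    and n: "card X \<le> n"
  shows "card X \<le> codim J n"
proof -
  have "\<exists>p\<in>forms n. mpoly_eval y p \<noteq> 0 \<and> (\<forall>x\<in>X - {y}. mpoly_eval x p = 0)" if "y \<in> X" for y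
    using that X n by (intro separating_form) (auto simp: zeros_def pairwise_def card_Diff1_le order_trans[OF card_Diff1_le])
  then obtain p where p: "\<And>y. y \<in> X \<Longrightarrow> p y \<in> forms n" "\<And>y. y \<in> X \<Longrightarrow> mpoly_eval y (p y) \<noteq> 0"
    "\<And>x y. y \<in> X \<Longrightarrow> x \<in> X \<Longrightarrow> x \<noteq> y \<Longrightarrow> mpoly_eval x (p y) = 0"
    by (metis Diff_iff empty_iff insert_iff)
  have "cmpoly_dim (J n) + card X \<le> cmpoly_dim (forms n)"
  proof (rule cmpoly.independent_mod_card_le[OF graded_subset[OF J] finite_form_basis forms_subset_span
            graded_subspace[OF J] X(1) p(1)])
    fix a assume *: "(\<Sum>i\<in>X. mscale (a i) (p i)) \<in> J n"
    show "\<forall>i\<in>X. a i = 0"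
    proof
      fix x assume x: "x \<in> X"
      have "0 = mpoly_eval x (\<Sum>i\<in>X. mscale (a i) (p i))" using * x X(2) by (auto simp: zeros_def)
      also have "\<dots> = (\<Sum>i\<in>X. if i = x then a x * mpoly_eval x (p x) else 0)"
        unfolding mpoly_eval_sum mpoly_eval_mscale using p(3)[OF _ x] by (intro sum.cong) auto
      finally show "a x = 0" using x p(2)[OF x] X(1) by simp
    qed
  qed
  then show ?thesis by (simp add: codim_def)
qed

text \<open>Once \<open>J + (g)\<close> is full, \<open>codim_add_gen\<close> bounds the codimension
  of \<open>J\<close> by its value \<open>d\<close> degrees earlier. So it is bounded, and by
  \<open>card_le_codim\<close> there cannot be arbitrarily many pairwise non-proportional
  zeros.\<close>

lemma finitely_many_zeros:
  assumes J: "graded J" and g: "g \<in> forms d" "0 < d" and prim: "primary (add_gen d g J)"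
  obtains X where "finite X" "X \<subseteq> zeros J" "\<And>z. z \<in> zeros J \<Longrightarrow> \<exists>x\<in>X. proportional x z"
proof -
  obtain N where N: "add_gen d g J N = forms N" using prim by (auto simp: primary_def)
  \<comment> \<open>A crude bound: each value beyond the range of summation is at most one inside
    it.\<close>
  define B where "B = (\<Sum>n<N + d. codim J n)"
  note ga = graded_add_gen[OF J g(1)]
  have bound: "codim J n \<le> B" for n
  proof (induction n rule: less_induct)
    case (less n)
    show ?case
    proof (cases "n < N + d")
      case True
      then show ?thesis unfolding B_def by (intro member_le_sum) auto
    next
      case False
      then have "codim (add_gen d g J) (n - d + d) = 0"
        using primary_mono[OF ga N, of n] graded_eq_forms_iff[OF ga, of n] by simp
      then have "codim J n \<le> codim J (n - d)" using codim_add_gen(1)[OF J g(1), of "n - d"] False by simp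
      then show ?thesis using less[of "n - d"] False g(2) by simp
    qed
  qed
  note concl = that
  show ?thesis
  proof (rule ccontr)
    assume no: "\<not> thesis"
    have *: "\<exists>z\<in>zeros J. \<forall>x\<in>X. \<not> proportional x z" if X: "finite X" "X \<subseteq> zeros J" for X
    proof (rule ccontr)
      assume "\<not> ?thesis"
      then have "\<And>z. z \<in> zeros J \<Longrightarrow> \<exists>x\<in>X. proportional x z" by blast
      from concl[OF X this] no show False by blast
    qed
    have "\<exists>X. finite X \<and> X \<subseteq> zeros J \<and> pairwise (\<lambda>x y. \<not> proportional x y) X \<and> card X = k" for k
    proof (induction k)
      case 0
      then show ?case by (intro exI[of _ "{}"]) auto
    next
      case (Suc k)
      then obtain X where X: "finite X" "X \<subseteq> zeros J" "pairwise (\<lambda>x y. \<not> proportional x y) X" "card X = k"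
        by blast
      obtain z where z: "z \<in> zeros J" "\<forall>x\<in>X. \<not> proportional x z" using *[OF X(1,2)] by blast
      have "proportional z z" unfolding proportional_def by (intro exI[of _ 1]) auto
      then have "z \<notin> X" using z by blast
      moreover have "\<forall>x\<in>X. \<not> proportional z x"
      proof
        fix x assume "x \<in> X"
        then have "point x" "\<not> proportional x z" using X(2) z(2) by (auto simp: zeros_def)
        then show "\<not> proportional z x" using proportional_sym by blast
      qed
      ultimately show ?case using X z
        by (intro exI[of _ "insert z X"]) (auto simp: pairwise_insert)
    qed
    then obtain X where X: "finite X" "X \<subseteq> zeros J" "pairwise (\<lambda>x y. \<not> proportional x y) X" "card X = Suc B"
      by blast
    show False using card_le_codim[OF J X(1-3) order_refl] bound[of "card X"] X(4) by simp
  qed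
qed

lemma mpoly_eval_proportional:
  assumes "p \<in> forms n"
  shows "mpoly_eval (\<lambda>i. c * x i) p = c ^ n * mpoly_eval x p"
proof -
  have "monomial_value (\<lambda>i. c * x i) a = c ^ mon_degree a * monomial_value x a" for a
    by (simp add: monomial_value_def mon_degree_def power_mult_distrib prod.distrib power_sum)
  then have "mpoly_eval (\<lambda>i. c * x i) p = (\<Sum>a\<in>Poly_Mapping.keys p. c ^ n * (Poly_Mapping.lookup p a * monomial_value x a))"
    unfolding mpoly_eval_eq_hom mpoly_hom_def using assms
    by (intro sum.cong) (auto simp: forms_iff monomials_def)
  then show ?thesis by (simp add: mpoly_eval_eq_hom mpoly_hom_def sum_distrib_left)
qed

lemma proportional_nonzero:
  assumes "p \<in> forms n" "proportional x z" "point z" "mpoly_eval x p \<noteq> 0"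
  shows "mpoly_eval z p \<noteq> 0"
proof -
  obtain c where c: "z = (\<lambda>i. c * x i)" using assms(2) by (auto simp: proportional_def)
  then have "c \<noteq> 0" using assms(3) by (auto simp: point_def)
  then show ?thesis using mpoly_eval_proportional[OF assms(1), of c x] assms(4) c by simp
qed

lemma form_avoiding_points:
  assumes L: "cmpoly.subspace L" and X: "finite X" "\<And>x. x \<in> X \<Longrightarrow> \<exists>p\<in>L. mpoly_eval x p \<noteq> 0"
  shows "\<exists>p\<in>L. \<forall>x\<in>X. mpoly_eval x p \<noteq> 0"
  by (rule subspace_avoid_kernels[OF L X(1)]) (auto simp: mpoly_eval_add mpoly_eval_mscale X(2))

lemma linear_form_avoiding_points:
  assumes X: "finite X" "\<And>x. x \<in> X \<Longrightarrow> point x"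
  shows "\<exists>p\<in>forms (Suc 0). \<forall>x\<in>X. mpoly_eval x p \<noteq> 0"
proof (rule form_avoiding_points[OF subspace_forms X(1)])
  fix x assume "x \<in> X"
  then obtain i where "i \<le> m" "x i \<noteq> 0" using X(2) point_coord by blast
  then show "\<exists>p\<in>forms (Suc 0). mpoly_eval x p \<noteq> 0" using forms_var by (intro bexI[of _ "var i"]) auto
qed

lemma zeros_add_gen:
  assumes J: "graded J" and g: "g \<in> forms d"
  shows "zeros (add_gen d g J) = {x \<in> zeros J. mpoly_eval x g = 0}"
proof (intro equalityI subsetI)
  fix x assume x: "x \<in> zeros (add_gen d g J)"
  then have "mpoly_eval x g = 0" using add_gen_mem[OF J] by (auto simp: zeros_def)
  moreover have "mpoly_eval x p = 0" if "p \<in> J n" for p n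
    using x add_gen_supset[of J n d g] that by (auto simp: zeros_def)
  ultimately show "x \<in> {x \<in> zeros J. mpoly_eval x g = 0}" using x by (auto simp: zeros_def)
next
  fix x assume "x \<in> {x \<in> zeros J. mpoly_eval x g = 0}"
  then show "x \<in> zeros (add_gen d g J)"
    by (auto simp: zeros_def add_gen_def mpoly_eval_add mpoly_eval_mult)
qed

end

section \<open>Regular sequences\<close>

context projective_space
begin

primrec gen :: "(nat \<times> (nat, complex) mpoly) list \<Rightarrow> nat \<Rightarrow> (nat, complex) mpoly set" where
  "gen [] = (\<lambda>n. {0})"
| "gen (x # L) = add_gen (fst x) (snd x) (gen L)"

definition form_list :: "(nat \<times> (nat, complex) mpoly) list \<Rightarrow> bool" where
  "form_list L \<longleftrightarrow> (\<forall>(d, g)\<in>set L. 0 < d \<and> g \<in> forms d)"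

text \<open>The head of the list comes last in the regular sequence.\<close>

primrec regular :: "(nat \<times> (nat, complex) mpoly) list \<Rightarrow> bool" where
  "regular [] \<longleftrightarrow> True"
| "regular (x # L) \<longleftrightarrow> regular L \<and> nonzerodivisor (fst x) (snd x) (gen L)"

lemma form_list_Cons [simp]: "form_list ((d, g) # L) \<longleftrightarrow> 0 < d \<and> g \<in> forms d \<and> form_list L"
  and form_list_Nil [simp]: "form_list []"
  and form_list_append [simp]: "form_list (L @ L') \<longleftrightarrow> form_list L \<and> form_list L'"
  by (auto simp: form_list_def)

lemma graded_gen: "form_list L \<Longrightarrow> graded (gen L)"
  by (induction L) (auto simp: graded_zero_ideal graded_add_gen)

lemma zeros_gen: "form_list L \<Longrightarrow> zeros (gen L) = {x. point x \<and> (\<forall>(d, g)\<in>set L. mpoly_eval x g = 0)}"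
proof (induction L)
  case Nil
  then show ?case by (auto simp: zeros_def)
next
  case (Cons a L)
  obtain d g where a: "a = (d, g)" by (cases a)
  then show ?case using Cons by (auto simp: zeros_add_gen graded_gen)
qed

lemma add_gen_commute_subset: "add_gen d g (add_gen d' g' J) n \<subseteq> add_gen d' g' (add_gen d g J) n"
proof
  fix p assume "p \<in> add_gen d g (add_gen d' g' J) n"
  then obtain u v v' where u: "p = (u + v' * g') + v * g" "u \<in> J n"
    "v' \<in> (if d' \<le> n then forms (n - d') else {0})" "v \<in> (if d \<le> n then forms (n - d) else {0})"
    unfolding add_gen_def by blast
  have "p = (u + v * g) + v' * g'" using u(1) by simp
  then show "p \<in> add_gen d' g' (add_gen d g J) n" using u(2-4) unfolding add_gen_def by blast
qed

lemma add_gen_commute: "add_gen d g (add_gen d' g' J) = add_gen d' g' (add_gen d g J)"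
  using add_gen_commute_subset by (intro ext) blast

lemma gen_move: "gen (xs @ a # ys) = gen (a # xs @ ys)"
  by (induction xs) (simp_all add: add_gen_commute[of "fst a"])

text \<open>Regular sequences in a graded ring may be reordered. If \<open>h b\<close> lies in
  \<open>J\<close>, then \<open>h\<close> lies in \<open>J + (a)\<close>, and the cofactor of
  \<open>a\<close> again multiplies \<open>b\<close> into \<open>J\<close>; its degree is smaller by
  \<open>d\<close>, so \<open>0 < d\<close> makes this a descent. The second conclusion follows by
  reducing the relation \<open>h a = u + v b\<close> modulo \<open>J + (a)\<close>.\<close>

lemma nonzerodivisor_swap:
  assumes J: "graded J" and a: "a \<in> forms d" "0 < d" and b: "b \<in> forms e"
    and nz: "nonzerodivisor d a J" "nonzerodivisor e b (add_gen d a J)"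
  shows "nonzerodivisor e b J" "nonzerodivisor d a (add_gen e b J)"
proof -
  have *: "h \<in> J n" if "h \<in> forms n" "h * b \<in> J (n + e)" for n h
    using that
  proof (induction n arbitrary: h rule: less_induct)
    case (less n)
    then have h: "h \<in> add_gen d a J n"
      using nz(2) add_gen_supset[of J "n + e" d a] unfolding nonzerodivisor_def by blast
    show ?case
    proof (cases "d \<le> n")
      case False
      then show ?thesis using h by (simp add: add_gen_less)
    next
      case True
      then obtain u v where uv: "h = u + v * a" "u \<in> J n" "v \<in> forms (n - d)"
        using h by (auto simp: add_gen_def)
      have "h * b - u * b \<in> J (n + e)"
        using graded_diff[OF J less.prems(2) graded_mult'[OF J b uv(2)]] .
      moreover have "h * b - u * b = (v * b) * a" "n + e = (n - d + e) + d"
        using uv True by (simp_all add: algebra_simps)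
      ultimately have "(v * b) * a \<in> J ((n - d + e) + d)" by (simp only:)
      then have "v * b \<in> J (n - d + e)"
        using nz(1) forms_mult[OF uv(3) b] unfolding nonzerodivisor_def by blast
      then have "v \<in> J (n - d)" using less.IH[of "n - d" v] uv(3) True a(2) by simp
      then have "v * a \<in> J n" using graded_mult'[OF J a(1), of v "n - d"] True by simp
      then show ?thesis using uv graded_add[OF J] by simp
    qed
  qed
  then show "nonzerodivisor e b J" by (auto simp: nonzerodivisor_def)
  show "nonzerodivisor d a (add_gen e b J)"
    unfolding nonzerodivisor_def
  proof (intro allI ballI impI)
    fix n h assume h: "h \<in> forms n" "h * a \<in> add_gen e b J (n + d)"
    have J_case: "h \<in> add_gen e b J n" if "h * a \<in> J (n + d)"
      using that h nz(1) add_gen_supset[of J n e b] unfolding nonzerodivisor_def by blast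
    show "h \<in> add_gen e b J n"
    proof (cases "e \<le> n + d")
      case False
      then show ?thesis using h J_case by (simp add: add_gen_less)
    next
      case True
      then obtain u v where uv: "h * a = u + v * b" "u \<in> J (n + d)" "v \<in> forms (n + d - e)"
        using h by (auto simp: add_gen_def)
      have "v * b = - u + h * a" using uv by simp
      then have "v * b \<in> add_gen d a J (n + d)"
        using h(1) graded_uminus[OF J uv(2)] unfolding add_gen_alt by blast
      then have "v \<in> add_gen d a J (n + d - e)"
        using nz(2) uv(3) True unfolding nonzerodivisor_def by (metis le_add_diff_inverse2)
      show ?thesis
      proof (cases "d \<le> n + d - e")
        case False
        then have "v \<in> J (n + d - e)" using \<open>v \<in> add_gen d a J (n + d - e)\<close> by (simp add: add_gen_less)
        then have "v * b \<in> J (n + d)" using graded_mult'[OF J b, of v "n + d - e"] True by simp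
        then show ?thesis using J_case uv graded_add[OF J] by simp
      next
        case d: True
        then obtain u' v' where uv': "v = u' + v' * a" "u' \<in> J (n + d - e)" "v' \<in> forms (n + d - e - d)"
          using \<open>v \<in> add_gen d a J (n + d - e)\<close> by (auto simp: add_gen_def)
        have en: "e \<le> n" "n + d - e - d = n - e" using d True by auto
        have v'b: "v' * b \<in> forms n" using forms_mult[OF uv'(3) b] en by simp
        have "u' * b \<in> J (n + d)" using graded_mult'[OF J b uv'(2)] True by simp
        moreover have "(h - v' * b) * a = u + u' * b" using uv uv' by (simp add: algebra_simps)
        ultimately have "(h - v' * b) * a \<in> J (n + d)" using uv graded_add[OF J] by simp
        then have "h - v' * b \<in> J n"
          using nz(1) forms_diff[OF h(1) v'b] unfolding nonzerodivisor_def by blast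
        moreover have "h = (h - v' * b) + v' * b" by simp
        moreover have "v' \<in> (if e \<le> n then forms (n - e) else {0})" using uv'(3) en by simp
        ultimately show ?thesis unfolding add_gen_def by blast
      qed
    qed
  qed
qed

lemma regular_swap:
  assumes "form_list (a # b # L)"
  shows "regular (a # b # L) \<longleftrightarrow> regular (b # a # L)"
proof -
  obtain d f where a: "a = (d, f)" by (cases a)
  obtain e g where b: "b = (e, g)" by (cases b)
  have J: "graded (gen L)" and f: "f \<in> forms d" "0 < d" and g: "g \<in> forms e" "0 < e"
    using assms a b by (simp_all add: graded_gen)
  show ?thesis
    using nonzerodivisor_swap[OF J f g(1)] nonzerodivisor_swap[OF J g f(1)]
    unfolding a b regular.simps gen.simps fst_conv snd_conv by blast
qed

lemma regular_move:
  "form_list (xs @ a # ys) \<Longrightarrow> regular (xs @ a # ys) \<longleftrightarrow> regular (a # xs @ ys)"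
proof (induction xs)
  case (Cons x xs)
  have fl: "form_list (xs @ a # ys)" "form_list (x # a # xs @ ys)"
    using Cons.prems by (cases x; cases a; simp)+
  have "regular ((x # xs) @ a # ys) \<longleftrightarrow> regular (x # a # xs @ ys)"
    using Cons.IH[OF fl(1)] gen_move[of xs a ys] by simp
  also have "\<dots> \<longleftrightarrow> regular (a # x # xs @ ys)" by (rule regular_swap[OF fl(2)])
  finally show ?case by simp
qed simp

text \<open>\<open>J + (f)\<close> is primary and so contains a power of \<open>g\<close>. Therefore
  \<open>h f \<in> J\<close> implies \<open>h g^k \<in> J\<close>, and the factors \<open>g\<close>
  cancel one at a time.\<close>

lemma nonzerodivisor_exchange:
  assumes J: "graded J" and g: "g \<in> forms d" "0 < d" "nonzerodivisor d g J"
    and f: "f \<in> forms e" "primary (add_gen e f J)"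
  shows "nonzerodivisor e f J"
proof -
  obtain N where N: "add_gen e f J N = forms N" using f(2) by (auto simp: primary_def)
  \<comment> \<open>As \<open>d \<ge> 1\<close>, the degree \<open>k * d\<close> of
    \<open>g ^ k\<close> is at least \<open>N + e\<close>: large enough for
    \<open>add_gen e f J\<close> to be full, and for the cofactor degree \<open>k * d - e\<close>
    not to be truncated.\<close>
  define k where "k = N + e"
  have kd: "N + e \<le> k * d" using g(2) by (simp add: k_def)
  have "add_gen e f J (k * d) = forms (k * d)"
    using primary_mono[OF graded_add_gen[OF J f(1)] N, of "k * d"] kd by simp
  then have "g ^ k \<in> add_gen e f J (k * d)" using forms_power[OF g(1)] by simp
  then obtain j v where jv: "g ^ k = j + v * f" "j \<in> J (k * d)" "v \<in> forms (k * d - e)"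
    using kd by (auto simp: add_gen_def)
  have power: "h \<in> J n" if "h \<in> forms n" "h * g ^ i \<in> J (n + i * d)" for h n i
    using that
  proof (induction i)
    case (Suc i)
    have "(h * g ^ i) * g \<in> J ((n + i * d) + d)" using Suc.prems(2) by (simp add: ac_simps)
    then have "h * g ^ i \<in> J (n + i * d)"
      using g(3) forms_mult[OF Suc.prems(1) forms_power[OF g(1), of i]] unfolding nonzerodivisor_def by blast
    then show ?case using Suc by blast
  qed simp
  show ?thesis
    unfolding nonzerodivisor_def
  proof (intro allI ballI impI)
    fix n h assume h: "h \<in> forms n" "h * f \<in> J (n + e)"
    have "v * (h * f) \<in> J (n + k * d)"
      using graded_mult[OF J jv(3) h(2)] kd by (simp add: ac_simps)
    moreover have "h * j \<in> J (n + k * d)" using graded_mult[OF J h(1) jv(2)] .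
    moreover have "h * g ^ k = h * j + v * (h * f)" using jv(1) by (simp add: algebra_simps)
    ultimately have "h * g ^ k \<in> J (n + k * d)" using graded_add[OF J] by simp
    then show "h \<in> J n" using power h(1) by blast
  qed
qed

lemma regular_exchange:
  assumes "form_list ((d, g) # L)" "form_list ((e, f) # L)" "regular ((d, g) # L)" "primary (gen ((e, f) # L))"
  shows "regular ((e, f) # L)"
  using assms nonzerodivisor_exchange[of "gen L" g d f e] by (simp add: graded_gen)

lemma primary_avoiding:
  assumes L: "form_list L" "graded (gen L)" and h: "h \<in> forms d"
    and X: "\<And>z. z \<in> zeros (gen L) \<Longrightarrow> \<exists>x\<in>X. proportional x z" "\<And>x. x \<in> X \<Longrightarrow> mpoly_eval x h \<noteq> 0"
  shows "primary (gen ((d, h) # L))"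
proof -
  have "mpoly_eval z h \<noteq> 0" if "z \<in> zeros (gen L)" for z
    using X that proportional_nonzero[OF h, of _ z] by (fastforce simp: zeros_def)
  then show ?thesis
    using primary_iff[OF graded_add_gen[OF L(2) h]] zeros_add_gen[OF L(2) h] by auto
qed

text \<open>Any two primary sequences of the same length are linked by exchanging one element at a time:
  a common linear form is inserted at the last position where they differ.\<close>

lemma regular_of_primary_linked:
  assumes "length ps = length qs" "form_list (ps @ hs)" "form_list (qs @ hs)"
    "primary (gen (ps @ hs))" "primary (gen (qs @ hs))" "regular (ps @ hs)"
  shows "regular (qs @ hs)"
  using assms
proof (induction ps arbitrary: qs hs rule: rev_induct)
  case (snoc p ps qs' hs)
  obtain qs q where qs: "qs' = qs @ [q]" "length qs = length ps"
    using snoc.prems(1) by (cases qs' rule: rev_cases) auto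
  obtain d f where p: "p = (d, f)" by (cases p)
  obtain e g where q: "q = (e, g)" by (cases q)
  let ?T = "ps @ hs" and ?U = "qs @ hs"
  have fl: "form_list ?T" "form_list ?U" "0 < d" "f \<in> forms d" "0 < e" "g \<in> forms e"
    using snoc.prems qs p q by auto
  have gr: "graded (gen ?T)" "graded (gen ?U)" using fl graded_gen by auto
  have prim: "primary (gen (p # ?T))" "primary (gen (q # ?U))"
    using snoc.prems(4,5) gen_move[of ps p hs] gen_move[of qs q hs] qs by auto
  obtain X where X: "finite X" "X \<subseteq> zeros (gen ?T)" "\<And>z. z \<in> zeros (gen ?T) \<Longrightarrow> \<exists>x\<in>X. proportional x z"
    using finitely_many_zeros[OF gr(1) fl(4,3)] prim p by auto
  obtain Y where Y: "finite Y" "Y \<subseteq> zeros (gen ?U)" "\<And>z. z \<in> zeros (gen ?U) \<Longrightarrow> \<exists>x\<in>Y. proportional x z"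
    using finitely_many_zeros[OF gr(2) fl(6,5)] prim q by auto
  \<comment> \<open>Both \<open>?T\<close> and \<open>?U\<close> have finitely many zeros, so a
    single linear form completes both to primary sequences.\<close>
  obtain l where l: "l \<in> forms (Suc 0)" "\<And>x. x \<in> X \<union> Y \<Longrightarrow> mpoly_eval x l \<noteq> 0"
  proof -
    have "finite (X \<union> Y)" "\<And>x. x \<in> X \<union> Y \<Longrightarrow> point x" using X(1,2) Y(1,2) by (auto simp: zeros_def)
    from linear_form_avoiding_points[OF this] show ?thesis using that by blast
  qed
  let ?l = "(Suc 0, l)"
  have primT: "primary (gen (?l # ?T))" using primary_avoiding[OF fl(1) gr(1) l(1) X(3)] l(2) by blast
  have primU: "primary (gen (?l # ?U))" using primary_avoiding[OF fl(2) gr(2) l(1) Y(3)] l(2) by blast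
  have "regular (p # ?T)" using snoc.prems(2,6) regular_move[of ps p hs] by simp
  then have "regular (?l # ?T)" using regular_exchange[of d f ?T "Suc 0" l] fl l(1) primT p by simp
  then have "regular (ps @ ?l # hs)" using regular_move[of ps ?l hs] fl l(1) by simp
  \<comment> \<open>The induction hypothesis is applied with the longer common tail
    \<open>?l # hs\<close>; this is why \<open>hs\<close> is generalised.\<close>
  then have "regular (qs @ ?l # hs)"
    using snoc.IH[of qs "?l # hs"] qs(2) fl l(1) primT primU gen_move[of ps ?l hs] gen_move[of qs ?l hs] by simp
  then have "regular (?l # ?U)" using regular_move[of qs ?l hs] fl l(1) by simp
  then have "regular (q # ?U)" using regular_exchange[of "Suc 0" l ?U e g] fl l(1) prim(2) q by simp
  then show ?case using regular_move[of qs q hs] snoc.prems(3) qs by simp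
qed simp

section \<open>The coordinates as a model regular sequence\<close>

definition vars :: "nat \<Rightarrow> (nat \<times> (nat, complex) mpoly) list" where
  "vars k = rev (map (\<lambda>i. (Suc 0, var i)) [0..<k])"

lemma vars_Suc: "vars (Suc k) = (Suc 0, var k) # vars k"
  by (simp add: vars_def)

lemma form_list_vars: "k \<le> Suc m \<Longrightarrow> form_list (vars k)"
  by (auto simp: vars_def form_list_def intro!: forms_var)

text \<open>The ideal of the first \<open>k\<close> coordinates is a monomial ideal; in terms of
  exponents it is evident that the next coordinate is a nonzerodivisor modulo it.\<close>

lemma gen_vars:
  "k \<le> Suc m \<Longrightarrow> gen (vars k) n = {p \<in> forms n. \<forall>a\<in>Poly_Mapping.keys p. \<exists>i<k. Poly_Mapping.lookup a i \<noteq> 0}"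
proof (induction k arbitrary: n)
  case 0
  then show ?case by (auto simp: vars_def)
next
  case (Suc k)
  note gr = graded_gen[OF form_list_vars[of "Suc k"]]
  show ?case
  proof (intro equalityI subsetI)
    fix p assume p: "p \<in> gen (vars (Suc k)) n"
    then obtain u v where uv: "p = u + var k * v" "u \<in> gen (vars k) n"
      by (auto simp: vars_Suc add_gen_def mult.commute)
    have "\<exists>i<Suc k. Poly_Mapping.lookup a i \<noteq> 0" if "a \<in> Poly_Mapping.keys p" for a
    proof -
      from that uv(1) consider "a \<in> Poly_Mapping.keys u" | "a \<in> Poly_Mapping.keys (var k * v)"
        using keys_add[of u "var k * v"] by blast
      then show ?thesis
      proof cases
        case 1
        then show ?thesis using uv(2) Suc.IH[of n] Suc.prems less_Suc_eq by auto
      next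
        case 2
        then obtain b where "a = Poly_Mapping.single k 1 + b"
          using keys_single_mult[of "Poly_Mapping.single k 1" 1 v] by (auto simp: var_def)
        then show ?thesis by (intro exI[of _ k]) (simp add: lookup_add)
      qed
    qed
    then show "p \<in> {p \<in> forms n. \<forall>a\<in>Poly_Mapping.keys p. \<exists>i<Suc k. Poly_Mapping.lookup a i \<noteq> 0}"
      using p graded_subset[OF gr, of n] Suc.prems by auto
  next
    fix p assume p: "p \<in> {p \<in> forms n. \<forall>a\<in>Poly_Mapping.keys p. \<exists>i<Suc k. Poly_Mapping.lookup a i \<noteq> 0}"
    have "Poly_Mapping.single a c \<in> gen (vars (Suc k)) n" if a: "a \<in> Poly_Mapping.keys p" for a c
    proof -
      have am: "a \<in> monomials n" using p a by (auto simp: forms_iff)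
      obtain i where i: "i < Suc k" "Poly_Mapping.lookup a i \<noteq> 0" using p a by auto
      show ?thesis
      proof (cases "i = k")
        case False
        then have "Poly_Mapping.single a c \<in> gen (vars k) n"
          using Suc i forms_single[OF am] by (auto intro!: exI[of _ i])
        then show ?thesis using add_gen_supset[of "gen (vars k)" n] by (auto simp: vars_Suc)
      next
        case True
        define b where "b = a - Poly_Mapping.single k 1"
        have ab: "a = b + Poly_Mapping.single k 1"
          using i True by (intro poly_mapping_eqI) (auto simp: b_def lookup_add lookup_minus lookup_single when_def)
        have bk: "Poly_Mapping.keys b \<subseteq> Poly_Mapping.keys a" by (auto simp: b_def in_keys_iff lookup_minus)
        have "n = mon_degree b + Suc 0" using am ab by (auto simp: monomials_def mon_degree_add)
        moreover have "b \<in> monomials (mon_degree b)" using am bk by (auto simp: monomials_def)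
        moreover have "Poly_Mapping.single a c = Poly_Mapping.single b c * var k"
          by (simp add: ab var_def mult_single)
        ultimately show ?thesis
          using add_gen_mult_mem[OF graded_gen[OF form_list_vars[of k]] forms_single[of b "mon_degree b" c], of "var k" "Suc 0"]
            Suc.prems by (simp add: vars_Suc)
      qed
    qed
    then have "(\<Sum>a\<in>Poly_Mapping.keys p. Poly_Mapping.single a (Poly_Mapping.lookup p a)) \<in> gen (vars (Suc k)) n"
      using Suc.prems by (intro graded_sum[OF gr]) auto
    then show "p \<in> gen (vars (Suc k)) n" by (simp add: poly_mapping_sum_singles)
  qed
qed

lemma regular_vars: "k \<le> Suc m \<Longrightarrow> regular (vars k)"
proof (induction k)
  case 0
  then show ?case by (simp add: vars_def)
next
  case (Suc k)
  have "nonzerodivisor (Suc 0) (var k) (gen (vars k))"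
    unfolding nonzerodivisor_def
  proof (intro allI ballI impI)
    fix n h assume h: "h \<in> forms n" "h * var k \<in> gen (vars k) (n + Suc 0)"
    have "\<exists>i<k. Poly_Mapping.lookup a i \<noteq> 0" if "a \<in> Poly_Mapping.keys h" for a
    proof -
      have "Poly_Mapping.single k 1 + a \<in> Poly_Mapping.keys (h * var k)"
        using that lookup_single_mult[of "Poly_Mapping.single k 1" 1 h a]
        by (simp add: in_keys_iff var_def mult.commute)
      then obtain i where "i < k" "Poly_Mapping.lookup (Poly_Mapping.single k 1 + a) i \<noteq> 0"
        using h(2) Suc.prems by (auto simp: gen_vars)
      then show ?thesis by (intro exI[of _ i]) (auto simp: lookup_add lookup_single)
    qed
    then show "h \<in> gen (vars k) n" using h(1) Suc.prems by (simp add: gen_vars)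
  qed
  then show ?case using Suc by (simp add: vars_Suc)
qed

lemma primary_vars: "primary (gen (vars (Suc m)))"
proof -
  have fl: "form_list (vars (Suc m))" by (rule form_list_vars) simp
  have "zeros (gen (vars (Suc m))) = {}"
    unfolding zeros_gen[OF fl] using point_coord by (fastforce simp: vars_def)
  then show ?thesis using primary_iff[OF graded_gen[OF fl]] by simp
qed

text \<open>The Cohen--Macaulay property of the polynomial ring.\<close>

theorem regular_of_primary:
  assumes "length L = Suc m" "form_list L" "primary (gen L)"
  shows "regular L"
  using regular_of_primary_linked[of "vars (Suc m)" L "[]"] assms
    form_list_vars[of "Suc m"] primary_vars regular_vars[of "Suc m"] by (simp add: vars_def)

text \<open>By \<open>codim_add_gen\<close> each step of a regular sequence determines the new
  Hilbert function from the old one and the degree of the added form.\<close>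

lemma codim_gen_cong:
  assumes "regular L" "regular L'" "form_list L" "form_list L'" "map fst L = map fst L'"
  shows "codim (gen L) n = codim (gen L') n"
  using assms
proof (induction L arbitrary: L' n)
  case (Cons x L)
  obtain d g where x: "x = (d, g)" by (cases x)
  obtain g' K where L': "L' = (d, g') # K" "map fst L = map fst K" using Cons.prems(5) x by (cases L') auto
  have IH: "codim (gen L) n = codim (gen K) n" for n using Cons L' x by auto
  note gr = graded_gen[of L] graded_gen[of K]
  show ?case
  proof (cases "n < d")
    case True
    then show ?thesis using IH by (simp add: x L' add_gen_less codim_def)
  next
    case False
    then show ?thesis
      using codim_add_gen(2)[OF gr(1), of g d "n - d"] codim_add_gen(2)[OF gr(2), of g' d "n - d"]
        IH[of n] IH[of "n - d"] Cons.prems x L' by simp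
  qed
qed simp

end

section \<open>Complete intersections\<close>

context projective_space
begin

text \<open>Only the members \<open>0, ..., m - 1\<close>: the last one is kept apart because it is
  the one perturbed by multiples of \<open>q\<close>.\<close>

definition tuple_list :: "nat \<Rightarrow> (nat \<Rightarrow> (nat, complex) mpoly) \<Rightarrow> (nat \<times> (nat, complex) mpoly) list" where
  "tuple_list D f = map (\<lambda>i. (D, f i)) [0..<m]"

lemma form_list_tuple: "0 < D \<Longrightarrow> (\<And>i. i < m \<Longrightarrow> f i \<in> forms D) \<Longrightarrow> form_list (tuple_list D f)"
  by (auto simp: form_list_def tuple_list_def)

lemma zeros_tuple:
  assumes "0 < D" "\<And>i. i < m \<Longrightarrow> f i \<in> forms D"
  shows "zeros (gen (tuple_list D f)) = {x. point x \<and> (\<forall>i<m. mpoly_eval x (f i) = 0)}"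
  using zeros_gen[OF form_list_tuple[of D f]] assms by (auto simp: tuple_list_def)

section \<open>The Fermat system\<close>

text \<open>The model complete intersection: up to scaling, its zeros have last coordinate
  \<open>1\<close> and \<open>D\<close>-th roots of unity as the other coordinates.\<close>

definition fermat :: "nat \<Rightarrow> nat \<Rightarrow> (nat, complex) mpoly" where
  "fermat D i = var i ^ D - var m ^ D"

lemma forms_fermat: "i < m \<Longrightarrow> fermat D i \<in> forms D"
  unfolding fermat_def using forms_power[OF forms_var[of i], of D] forms_power[OF forms_var[of m], of D]
  by (auto intro: forms_diff)

definition fermat_points :: "nat \<Rightarrow> (nat \<Rightarrow> complex) set" where
  "fermat_points D = (\<lambda>b i. if i < m then b i else if i = m then 1 else 0) ` ({..<m} \<rightarrow>\<^sub>E {z. z ^ D = 1})"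

lemma card_fermat_points:
  assumes "0 < D"
  shows "finite (fermat_points D)" "card (fermat_points D) = D ^ m"
proof -
  have fin: "finite {z::complex. z ^ D = 1}" using assms by (intro card_ge_0_finite) (simp add: card_roots_unity_eq)
  then show "finite (fermat_points D)" unfolding fermat_points_def by (intro finite_imageI finite_PiE) auto
  have "inj_on (\<lambda>b i. if i < m then b i else if i = m then (1::complex) else 0) ({..<m} \<rightarrow>\<^sub>E {z. z ^ D = 1})"
  proof (rule inj_onI)
    fix b b' :: "nat \<Rightarrow> complex"
    assume b: "b \<in> {..<m} \<rightarrow>\<^sub>E {z. z ^ D = 1}" "b' \<in> {..<m} \<rightarrow>\<^sub>E {z. z ^ D = 1}"
      and e: "(\<lambda>i. if i < m then b i else if i = m then 1 else 0) = (\<lambda>i. if i < m then b' i else if i = m then 1 else 0)"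
    show "b = b'"
    proof (rule PiE_ext[OF b])
      fix i assume "i \<in> {..<m}"
      then show "b i = b' i" using fun_cong[OF e, of i] by simp
    qed
  qed
  then show "card (fermat_points D) = D ^ m"
    unfolding fermat_points_def by (simp add: card_image card_PiE card_roots_unity_eq assms)
qed

lemma fermat_points_coord: "x \<in> fermat_points D \<Longrightarrow> x m = 1"
  unfolding fermat_points_def by (elim imageE) simp

lemma point_fermat_points:
  assumes "x \<in> fermat_points D"
  shows "point x"
proof -
  have "x m \<noteq> 0" using fermat_points_coord[OF assms] by simp
  moreover have "\<forall>i>m. x i = 0" using assms unfolding fermat_points_def by (elim imageE) simp
  ultimately show ?thesis unfolding point_def by blast
qed

lemma fermat_points_eqI:
  assumes "x \<in> fermat_points D" "y \<in> fermat_points D" "proportional x y"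
  shows "x = y"
proof -
  obtain c where c: "y = (\<lambda>i. c * x i)" using assms(3) by (auto simp: proportional_def)
  then have "c = 1"
    using fun_cong[OF c, of m] fermat_points_coord[OF assms(1)] fermat_points_coord[OF assms(2)] by simp
  then show ?thesis using c by simp
qed

lemma fermat_points_zero:
  assumes "x \<in> fermat_points D" "i < m"
  shows "mpoly_eval x (fermat D i) = 0"
proof -
  obtain b where b: "b \<in> {..<m} \<rightarrow>\<^sub>E {z. z ^ D = 1}" "x = (\<lambda>i. if i < m then b i else if i = m then 1 else 0)"
    using assms(1) unfolding fermat_points_def by blast
  have "b i ^ D = 1" using PiE_mem[OF b(1), of i] assms(2) by simp
  then show ?thesis using assms(2) by (simp add: b(2) fermat_def mpoly_eval_diff mpoly_eval_power)
qed

lemma fermat_points_zeros: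
  assumes "0 < D"
  shows "fermat_points D \<subseteq> zeros (gen (tuple_list D (fermat D)))"
  using zeros_tuple[of D "fermat D"] assms forms_fermat point_fermat_points fermat_points_zero by auto

lemma zero_of_fermat:
  assumes D: "0 < D" and x: "point x" "\<And>i. i < m \<Longrightarrow> mpoly_eval x (fermat D i) = 0"
  shows "\<exists>y\<in>fermat_points D. proportional y x"
proof -
  have e: "x i ^ D = x m ^ D" if "i < m" for i
    using x(2)[OF that] by (simp add: fermat_def mpoly_eval_diff mpoly_eval_power)
  have xm: "x m \<noteq> 0"
  proof
    assume 0: "x m = 0"
    obtain i where i: "i \<le> m" "x i \<noteq> 0" using point_coord[OF x(1)] by blast
    then have "i < m" using 0 by (cases "i = m") auto
    then show False using e[of i] 0 i(2) D by (simp add: power_0_left)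
  qed
  define b where "b = (\<lambda>i\<in>{..<m}. x i / x m)"
  have b: "b \<in> {..<m} \<rightarrow>\<^sub>E {z. z ^ D = 1}" using e xm by (auto simp: b_def power_divide)
  have "x = (\<lambda>i. x m * (if i < m then b i else if i = m then 1 else 0))"
    using xm x(1) by (auto simp: b_def point_def)
  then have "proportional (\<lambda>i. if i < m then b i else if i = m then 1 else 0) x"
    unfolding proportional_def by blast
  then show ?thesis using b unfolding fermat_points_def by blast
qed

lemma var_power: "var i ^ k = Poly_Mapping.single (Poly_Mapping.single i k) 1"
  by (induction k) (auto simp: var_def mult_single simp flip: single_add)

text \<open>Replacing \<open>X_i^D\<close> by \<open>X_m^D\<close> for some \<open>i < m\<close>
  keeps the residue class and lowers the sum of the first \<open>m\<close> exponents by
  \<open>D\<close>.\<close>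

lemma fermat_reduce:
  assumes D: "0 < D" and a: "a \<in> monomials n"
  shows "\<exists>b\<in>monomials n. (\<forall>i<m. Poly_Mapping.lookup b i < D) \<and>
    Poly_Mapping.single a 1 - Poly_Mapping.single b 1 \<in> gen (tuple_list D (fermat D)) n"
  using a
proof (induction "\<Sum>i<m. Poly_Mapping.lookup a i" arbitrary: a rule: less_induct)
  case less
  let ?J = "gen (tuple_list D (fermat D))"
  have fl: "form_list (tuple_list D (fermat D))" using form_list_tuple D forms_fermat by blast
  note J = graded_gen[OF fl]
  show ?case
  proof (cases "\<forall>i<m. Poly_Mapping.lookup a i < D")
    case True
    then show ?thesis using less.prems graded_zero[OF J] by (intro bexI[of _ a]) auto
  next
    case False
    then obtain i where i: "i < m" "D \<le> Poly_Mapping.lookup a i" by auto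
    define c where "c = a - Poly_Mapping.single i D"
    have ac: "a = c + Poly_Mapping.single i D"
      using i by (intro poly_mapping_eqI) (auto simp: c_def lookup_add lookup_minus lookup_single when_def)
    define a' where "a' = c + Poly_Mapping.single m D"
    have nc: "n = mon_degree c + D" using less.prems ac by (auto simp: monomials_def mon_degree_add)
    have "Poly_Mapping.keys c \<subseteq> Poly_Mapping.keys a" by (auto simp: c_def in_keys_iff lookup_minus)
    then have cm: "c \<in> monomials (mon_degree c)" using less.prems by (auto simp: monomials_def)
    have a': "a' \<in> monomials n" unfolding a'_def nc using monomials_add[OF cm monomials_single[of m D]] by simp
    have "(\<Sum>j<m. Poly_Mapping.lookup a j) = (\<Sum>j<m. Poly_Mapping.lookup c j) + (\<Sum>j<m. if j = i then D else 0)"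
      by (simp add: ac lookup_add sum.distrib lookup_single when_def eq_commute)
    moreover have "(\<Sum>j<m. Poly_Mapping.lookup a' j) = (\<Sum>j<m. Poly_Mapping.lookup c j)"
      by (intro sum.cong) (auto simp: a'_def lookup_add lookup_single when_def)
    ultimately have "(\<Sum>j<m. Poly_Mapping.lookup a' j) < (\<Sum>j<m. Poly_Mapping.lookup a j)"
      using i(1) D by simp
    from less.hyps[OF this a'] obtain b where b: "b \<in> monomials n" "\<forall>i<m. Poly_Mapping.lookup b i < D"
      "Poly_Mapping.single a' 1 - Poly_Mapping.single b 1 \<in> ?J n" by blast
    have "(D, fermat D i) \<in> set (tuple_list D (fermat D))" using i(1) by (simp add: tuple_list_def)
    then obtain xs ys where xy: "tuple_list D (fermat D) = xs @ (D, fermat D i) # ys" by (meson split_list)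
    have Jm: "?J = add_gen D (fermat D i) (gen (xs @ ys))" using xy gen_move[of xs "(D, fermat D i)" ys] by simp
    have "form_list (xs @ ys)" using fl xy by simp
    then have "Poly_Mapping.single c 1 * fermat D i \<in> ?J n"
      unfolding Jm nc using add_gen_mult_mem[OF graded_gen forms_single[OF cm]] by blast
    moreover have "Poly_Mapping.single c 1 * fermat D i = Poly_Mapping.single a 1 - Poly_Mapping.single a' 1"
      by (simp add: fermat_def var_power right_diff_distrib mult_single ac a'_def)
    ultimately have "Poly_Mapping.single a 1 - Poly_Mapping.single b 1 \<in> ?J n"
      using graded_add[OF J _ b(3), of "Poly_Mapping.single c 1 * fermat D i"] by simp
    then show ?thesis using b by blast
  qed
qed

text \<open>From above: the reduced monomials span modulo the ideal, and their first
  \<open>m\<close> exponents, all below \<open>D\<close>, determine the last one through the degree.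
  From below: there are \<open>D^m\<close> pairwise non-proportional zeros, and
  \<open>card_le_codim\<close> applies because \<open>D^m \<le> n\<close>.\<close>

lemma codim_fermat:
  assumes D: "0 < D" and n: "D ^ m \<le> n"
  shows "codim (gen (tuple_list D (fermat D))) n = D ^ m"
proof -
  let ?J = "gen (tuple_list D (fermat D))"
  define K where "K = {b \<in> monomials n. \<forall>i<m. Poly_Mapping.lookup b i < D}"
  have fl: "form_list (tuple_list D (fermat D))" using form_list_tuple D forms_fermat by blast
  note J = graded_gen[OF fl]
  have fK: "finite K" by (rule finite_subset[OF _ finite_monomials[of n]]) (auto simp: K_def)
  have cK: "card K \<le> D ^ m"
  proof -
    have inj: "inj_on (\<lambda>b. restrict (Poly_Mapping.lookup b) {..<m}) K"
    proof (rule inj_onI, rule poly_mapping_eqI)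
      fix b b' i assume b: "b \<in> K" "b' \<in> K" and e: "restrict (Poly_Mapping.lookup b) {..<m} = restrict (Poly_Mapping.lookup b') {..<m}"
      have e': "Poly_Mapping.lookup b j = Poly_Mapping.lookup b' j" if "j < m" for j
        using fun_cong[OF e, of j] that by simp
      have "n = (\<Sum>j<m. Poly_Mapping.lookup c j) + Poly_Mapping.lookup c m" if "c \<in> K" for c
      proof -
        have "n = (\<Sum>j\<in>{..m}. Poly_Mapping.lookup c j)"
          using that mon_degree_superset[of "{..m}" c] by (auto simp: K_def monomials_def)
        then show ?thesis by (simp add: lessThan_Suc_atMost[symmetric])
      qed
      from this[OF b(1)] this[OF b(2)] have "Poly_Mapping.lookup b m = Poly_Mapping.lookup b' m"
        using e' by simp
      moreover have "Poly_Mapping.lookup c j = 0" if "c \<in> K" "m < j" for c j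
        using that by (fastforce simp: K_def monomials_def in_keys_iff)
      ultimately show "Poly_Mapping.lookup b i = Poly_Mapping.lookup b' i"
        using e' b by (cases i m rule: linorder_cases) auto
    qed
    have "(\<lambda>b. restrict (Poly_Mapping.lookup b) {..<m}) ` K \<subseteq> {..<m} \<rightarrow>\<^sub>E {..<D}"
      by (rule image_subsetI) (auto simp: K_def restrict_PiE_iff)
    then have "card K \<le> card ({..<m} \<rightarrow>\<^sub>E {..<D})"
      using card_inj_on_le[OF inj] by (simp add: finite_PiE)
    then show ?thesis by (simp add: card_PiE)
  qed
  have sp: "forms n \<subseteq> cmpoly.span (?J n \<union> (\<lambda>b. Poly_Mapping.single b 1) ` K)" (is "_ \<subseteq> cmpoly.span ?S")
  proof -
    have "form_basis n \<subseteq> cmpoly.span ?S"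
    proof
      fix p assume "p \<in> form_basis n"
      then obtain a where a: "a \<in> monomials n" "p = Poly_Mapping.single a 1" by (auto simp: form_basis_def)
      obtain b where b: "b \<in> K" "Poly_Mapping.single a 1 - Poly_Mapping.single b 1 \<in> ?J n"
        using fermat_reduce[OF D a(1)] by (auto simp: K_def)
      then have "Poly_Mapping.single a 1 - Poly_Mapping.single b 1 \<in> cmpoly.span ?S"
        "Poly_Mapping.single b 1 \<in> cmpoly.span ?S"
        by (auto intro: cmpoly.span_base)
      from cmpoly.span_add[OF this] show "p \<in> cmpoly.span ?S" using a by simp
    qed
    then have "cmpoly.span (form_basis n) \<subseteq> cmpoly.span ?S"
      by (rule cmpoly.span_minimal) (rule cmpoly.subspace_span)
    then show ?thesis using forms_subset_span by blast
  qed
  have Jsp: "?J n \<subseteq> cmpoly.span (form_basis n)" using graded_subset[OF J] forms_subset_span by blast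
  have "cmpoly_dim (forms n) \<le> cmpoly_dim (?J n) + card K"
  proof (rule cmpoly.dim_le_add_card[OF finite_form_basis Jsp fK, where v = "\<lambda>b. Poly_Mapping.single b 1"])
    fix x assume "x \<in> forms n"
    then have "x \<in> cmpoly.span ?S" using sp by blast
    moreover have "cmpoly.span (?J n) = ?J n" unfolding cmpoly.span_eq_iff by (rule graded_subspace[OF J])
    ultimately show "\<exists>u\<in>?J n. \<exists>a. x = u + (\<Sum>i\<in>K. mscale (a i) (Poly_Mapping.single i 1))"
      using cmpoly.span_Un_image_expand[OF fK, of x "?J n" "\<lambda>b. Poly_Mapping.single b 1"] by argo
  qed
  then have "codim ?J n \<le> D ^ m" using cK by (simp add: codim_def)
  moreover have "D ^ m \<le> codim ?J n"
    using card_le_codim[OF J card_fermat_points(1)[OF D] fermat_points_zeros[OF D], of n] n card_fermat_points(2)[OF D]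
      fermat_points_eqI by (fastforce simp: pairwise_def)
  ultimately show ?thesis by simp
qed

lemma primary_fermat:
  assumes D: "0 < D" and q: "q \<in> forms e" "\<And>x. x \<in> fermat_points D \<Longrightarrow> mpoly_eval x q \<noteq> 0"
  shows "primary (add_gen e q (gen (tuple_list D (fermat D))))"
proof -
  have fl: "form_list (tuple_list D (fermat D))" using form_list_tuple D forms_fermat by blast
  have "\<exists>x\<in>fermat_points D. proportional x z" if "z \<in> zeros (gen (tuple_list D (fermat D)))" for z
    using that zero_of_fermat[OF D] zeros_tuple[of D "fermat D"] D forms_fermat by auto
  from primary_avoiding[OF fl graded_gen[OF fl] q(1) this q(2)] show ?thesis by simp
qed

text \<open>Together with \<open>q\<close> the tuple is a primary sequence of length
  \<open>m + 1\<close>, hence regular. So its first \<open>m\<close> members have the Hilbert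
  function of any regular sequence of the same degrees, and this is known for the Fermat system,
  which \<open>l ^ D\<close> completes to a primary sequence.\<close>

theorem complete_intersection:
  assumes D: "0 < D" and f: "\<And>i. i < m \<Longrightarrow> f i \<in> forms D" and q: "q \<in> forms D"
    and prim: "primary (add_gen D q (gen (tuple_list D f)))"
  shows "nonzerodivisor D q (gen (tuple_list D f))"
    and "D ^ m \<le> n \<Longrightarrow> codim (gen (tuple_list D f)) n = D ^ m"
proof -
  have *: "regular (tuple_list D f) \<and> nonzerodivisor D q (gen (tuple_list D f))"
    if "\<And>i. i < m \<Longrightarrow> f i \<in> forms D" "q \<in> forms D" "primary (add_gen D q (gen (tuple_list D f)))" for f q
    using regular_of_primary[of "(D, q) # tuple_list D f"] form_list_tuple[OF D, of f] that D
    by (simp add: tuple_list_def)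
  then show "nonzerodivisor D q (gen (tuple_list D f))" using assms by blast
  assume n: "D ^ m \<le> n"
  obtain l where l: "l \<in> forms (Suc 0)" "\<And>x. x \<in> fermat_points D \<Longrightarrow> mpoly_eval x l \<noteq> 0"
    using linear_form_avoiding_points[of "fermat_points D"] card_fermat_points(1)[OF D] point_fermat_points by blast
  have lD: "l ^ D \<in> forms D" using forms_power[OF l(1), of D] by simp
  have "primary (add_gen D (l ^ D) (gen (tuple_list D (fermat D))))"
    by (rule primary_fermat[OF D lD]) (simp add: mpoly_eval_power l(2))
  then have "regular (tuple_list D (fermat D))" using *[of "fermat D", OF forms_fermat lD] by blast
  moreover have "regular (tuple_list D f)" using * assms by blast
  ultimately have "codim (gen (tuple_list D f)) n = codim (gen (tuple_list D (fermat D))) n"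
    using form_list_tuple[OF D, of f] form_list_tuple[OF D, of "fermat D"] f forms_fermat
    by (intro codim_gen_cong) (auto simp: tuple_list_def)
  then show "codim (gen (tuple_list D f)) n = D ^ m" using codim_fermat[OF D n] by simp
qed

text \<open>The start is \<open>X_0, ..., X_(m-1), q\<close>, whose only possible zero is the last
  coordinate point, excluded by \<open>qm\<close>. Then the variables are exchanged for members of
  \<open>L\<close> one at a time: omitting one variable leaves finitely many zeros, \<open>q\<close>
  vanishes at each of them, so \<open>L\<close> does not vanish identically there, and a single
  member of \<open>L\<close> avoids them all.\<close>

lemma primary_replace_vars:
  assumes L: "cmpoly.subspace L" "L \<subseteq> forms D" and D: "0 < D" and q: "q \<in> forms D"
    and z: "\<And>x. point x \<Longrightarrow> mpoly_eval x q = 0 \<Longrightarrow> \<exists>p\<in>L. mpoly_eval x p \<noteq> 0"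
    and qm: "mpoly_eval (\<lambda>i. if i = m then 1 else 0) q \<noteq> 0"
  shows "\<exists>f. (\<forall>i<m. f i \<in> L) \<and> primary (add_gen D q (gen (tuple_list D f)))"
proof -
  have "\<exists>ps ys. length ps = k \<and> length ys = m - k \<and> set ps \<subseteq> {D} \<times> L \<and> form_list ys \<and>
      primary (gen (ps @ ys @ [(D, q)]))" if "k \<le> m" for k
    using that
  proof (induction k)
    case 0
    have fl: "form_list (vars m)" by (rule form_list_vars) simp
    have "zeros (gen (vars m @ [(D, q)])) = {}"
    proof (rule ccontr)
      assume "zeros (gen (vars m @ [(D, q)])) \<noteq> {}"
      then obtain x where x: "point x" "\<And>i. i < m \<Longrightarrow> x i = 0" "mpoly_eval x q = 0"
        using zeros_gen[of "vars m @ [(D, q)]"] fl q D by (auto simp: vars_def)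
      have "x = (\<lambda>i. x m * (if i = m then 1 else 0))"
      proof
        fix i show "x i = x m * (if i = m then 1 else 0)"
          using x(1,2) by (cases i m rule: linorder_cases) (auto simp: point_def)
      qed
      then have "proportional (\<lambda>i. if i = m then 1 else 0) x" unfolding proportional_def by blast
      from proportional_nonzero[OF q this x(1) qm] x(3) show False by simp
    qed
    then have "primary (gen (vars m @ [(D, q)]))"
      using primary_iff[OF graded_gen] fl q D by simp
    then show ?case using fl by (intro exI[of _ "[]"] exI[of _ "vars m"]) (simp add: vars_def)
  next
    case (Suc k)
    then obtain ps ys where ps: "length ps = k" "length ys = m - k" "set ps \<subseteq> {D} \<times> L" "form_list ys"
      "primary (gen (ps @ ys @ [(D, q)]))" by auto
    then obtain d g zs where ys: "ys = (d, g) # zs" "length zs = m - Suc k"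
      using Suc.prems by (cases ys) auto
    let ?T = "ps @ zs @ [(D, q)]"
    have "form_list ps" using ps(3) L(2) D by (auto simp: form_list_def)
    then have fl: "form_list ?T" "g \<in> forms d" "0 < d" using ps(4) ys q D by auto
    have "primary (add_gen d g (gen ?T))" using ps(5) ys gen_move[of ps "(d, g)" "zs @ [(D, q)]"] by simp
    then obtain X where X: "finite X" "X \<subseteq> zeros (gen ?T)" "\<And>z. z \<in> zeros (gen ?T) \<Longrightarrow> \<exists>x\<in>X. proportional x z"
      using finitely_many_zeros[OF graded_gen[OF fl(1)] fl(2,3)] by blast
    have "\<exists>p\<in>L. mpoly_eval x p \<noteq> 0" if "x \<in> X" for x
      using X(2) that z[of x] unfolding zeros_gen[OF fl(1)] by auto
    then obtain h where h: "h \<in> L" "\<And>x. x \<in> X \<Longrightarrow> mpoly_eval x h \<noteq> 0"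
      using form_avoiding_points[OF L(1) X(1)] by blast
    have "h \<in> forms D" using h L(2) by blast
    then have "primary (gen ((D, h) # ?T))" using primary_avoiding[OF fl(1) graded_gen[OF fl(1)] _ X(3) h(2)] by blast
    then show ?case using ps ys h(1)
      by (intro exI[of _ "(D, h) # ps"] exI[of _ zs]) auto
  qed
  from this[of m] obtain ps where ps: "length ps = m" "set ps \<subseteq> {D} \<times> L" "primary (gen (ps @ [(D, q)]))" by auto
  have nth: "fst (ps ! i) = D \<and> snd (ps ! i) \<in> L" if "i < m" for i
    using ps(1,2) that nth_mem[of i ps] by fastforce
  have "ps = tuple_list D (\<lambda>i. snd (ps ! i))"
    unfolding tuple_list_def using ps(1) nth by (intro nth_equalityI) (auto simp: prod_eq_iff)
  moreover have "primary (add_gen D q (gen ps))" using ps(3) gen_move[of ps "(D, q)" "[]"] by simp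
  ultimately show ?thesis using nth by (intro exI[of _ "\<lambda>i. snd (ps ! i)"]) auto
qed

section \<open>Hilbert function and degree of the ideal\<close>

lemma graded_ideal_part:
  assumes "homogeneous_ideal m I"
  shows "graded (ideal_part m I)"
proof -
  have I: "0 \<in> I" "\<And>p q. p \<in> I \<Longrightarrow> q \<in> I \<Longrightarrow> p + q \<in> I" "\<And>r p. r \<in> poly_ring m \<Longrightarrow> p \<in> I \<Longrightarrow> r * p \<in> I"
    using assms by (auto simp: homogeneous_ideal_def)
  have pr: "p \<in> forms k \<Longrightarrow> p \<in> poly_ring m" for p k by (simp add: homog_polys_def)
  show ?thesis
    unfolding graded_def ideal_part_def
    using I(1,2) I(3)[OF pr] I(3)[OF pr[OF forms_const]] forms_mult forms_mscale forms_add
    by (auto simp: cmpoly.subspace_def)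
qed

lemma hilbert_function_eq_codim:
  "homogeneous_ideal m I \<Longrightarrow> hilbert_function m I n = int (codim (ideal_part m I) n)"
  using graded_dim_le[OF graded_ideal_part, of I n] by (simp add: hilbert_function_def codim_def)

text \<open>Where \<open>J + (l)\<close> is full, the codimension of \<open>J\<close> does not
  increase, so it becomes constant at its minimum over these degrees.\<close>

lemma eventually_constant_codim:
  assumes J: "graded J" and l: "l \<in> forms (Suc 0)" "primary (add_gen (Suc 0) l J)"
  shows "\<exists>d n0. \<forall>n\<ge>n0. codim J n = d"
proof -
  obtain N where N: "add_gen (Suc 0) l J N = forms N" using l(2) by (auto simp: primary_def)
  note ga = graded_add_gen[OF J l(1)]
  have step: "codim J (Suc n) \<le> codim J n" if "N \<le> n" for n
    using codim_add_gen(1)[OF J l(1), of n] primary_mono[OF ga N, of "Suc n"] graded_eq_forms_iff[OF ga, of "Suc n"] that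
    by simp
  define k where "k = (LEAST k. \<exists>n\<ge>N. codim J n = k)"
  have "\<exists>n\<ge>N. codim J n = k" unfolding k_def by (rule LeastI_ex) auto
  then obtain n0 where n0: "N \<le> n0" "codim J n0 = k" by blast
  have "codim J n = k" if "n0 \<le> n" for n
  proof (rule antisym)
    show "codim J n \<le> k" using that
    proof (induction n rule: dec_induct)
      case (step n)
      then show ?case using \<open>\<And>n. N \<le> n \<Longrightarrow> codim J (Suc n) \<le> codim J n\<close>[of n] n0(1) by simp
    qed (use n0 in simp)
    have "\<exists>n'\<ge>N. codim J n' = codim J n" using that n0(1) by (intro exI[of _ n]) simp
    then show "k \<le> codim J n" unfolding k_def by (rule Least_le)
  qed
  then show ?thesis by blast
qed

text \<open>Polynomials that agree at all large integers coincide, so the definite description in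
  \<open>hilbert_polynomial\<close> yields the constant \<open>d\<close>. Its degree is
  \<open>0\<close>, and the factorial is \<open>1\<close>.\<close>

lemma ideal_degree_eq:
  assumes I: "homogeneous_ideal m I" and d: "\<And>n. n0 \<le> n \<Longrightarrow> codim (ideal_part m I) n = d"
  shows "ideal_degree m I = of_nat d"
proof -
  let ?P = "\<lambda>h. eventually (\<lambda>n. poly h (of_nat n) = (of_int (hilbert_function m I n) :: rat)) sequentially"
  have ev: "eventually (\<lambda>n. of_int (hilbert_function m I n) = (of_nat d :: rat)) sequentially"
    using eventually_ge_at_top[of n0] by eventually_elim (simp add: hilbert_function_eq_codim[OF I] d)
  have "hilbert_polynomial m I = [:of_nat d:]"
    unfolding hilbert_polynomial_def
  proof (rule the_equality)
    show "?P [:of_nat d:]" using ev by eventually_elim simp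
  next
    fix h assume "?P h"
    then have "eventually (\<lambda>n. poly (h - [:of_nat d:]) (of_nat n) = 0) sequentially"
      using ev by eventually_elim simp
    then obtain N where N: "\<And>n. N \<le> n \<Longrightarrow> poly (h - [:of_nat d:]) (of_nat n) = 0"
      by (auto simp: eventually_sequentially)
    have "infinite (of_nat ` {N..} :: rat set)"
      using finite_imageD[of of_nat "{N..}"] infinite_Ici[of N] by (auto simp: inj_on_def)
    then have "infinite {x. poly (h - [:of_nat d:]) x = 0}"
      by (rule infinite_super[rotated]) (use N in auto)
    then have "h - [:of_nat d:] = 0" using poly_roots_finite by blast
    then show "h = [:of_nat d:]" by simp
  qed
  then show ?thesis by (simp add: ideal_degree_def)
qed

section \<open>Representatives of projective zeros\<close>

lemma proj_zeros_nonempty: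
  assumes S: "\<And>p. p \<in> S \<Longrightarrow> p \<in> forms D" and x: "point x" "\<And>p. p \<in> S \<Longrightarrow> mpoly_eval x p = 0"
  shows "{(x, y). \<exists>c. c \<noteq> 0 \<and> y = (\<lambda>i. c * x i)} `` {x} \<in> proj_zeros m S"
proof -
  let ?C = "{(x, y). \<exists>c. c \<noteq> (0::complex) \<and> y = (\<lambda>i::nat. c * x i)} `` {x}"
  have "?C \<in> proj_space m" unfolding proj_space_def using x(1) by (intro quotientI) (auto simp: point_def)
  moreover have "mpoly_eval y p = 0" if "y \<in> ?C" "p \<in> S" for y p
    using that mpoly_eval_proportional[OF S[OF that(2)]] x(2)[OF that(2)] by auto
  ultimately show ?thesis by (auto simp: proj_zeros_def)
qed

lemma finite_representatives:
  assumes S: "\<And>p. p \<in> S \<Longrightarrow> p \<in> forms D" and fin: "finite (proj_zeros m S)"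
  obtains X where "finite X" "\<And>x. x \<in> X \<Longrightarrow> point x"
    "\<And>x. point x \<Longrightarrow> (\<And>p. p \<in> S \<Longrightarrow> mpoly_eval x p = 0) \<Longrightarrow> \<exists>y\<in>X. proportional y x"
proof -
  define rep where "rep = (\<lambda>z :: (nat \<Rightarrow> complex) set. SOME y. y \<in> z)"
  define X where "X = {y \<in> rep ` proj_zeros m S. point y}"
  show ?thesis
  proof (rule that[of X])
    show "finite X" using fin by (simp add: X_def)
    show "point x" if "x \<in> X" for x using that by (simp add: X_def)
    fix x assume x: "point x" "\<And>p. p \<in> S \<Longrightarrow> mpoly_eval x p = 0"
    let ?C = "{(x, y). \<exists>c. c \<noteq> (0::complex) \<and> y = (\<lambda>i::nat. c * x i)} `` {x}"
    have C: "?C \<in> proj_zeros m S" using proj_zeros_nonempty[of S D x] S x by simp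
    have "x \<in> ?C" by (auto intro!: exI[of _ 1])
    then have "rep ?C \<in> ?C" unfolding rep_def by (rule someI[of "\<lambda>y. y \<in> ?C"])
    then obtain c where c: "c \<noteq> 0" "rep ?C = (\<lambda>i. c * x i)" by auto
    then have "point (rep ?C)" using x(1) by (auto simp: point_def)
    moreover have "proportional x (rep ?C)" using c unfolding proportional_def by blast
    ultimately have "proportional (rep ?C) x" "rep ?C \<in> X"
      using proportional_sym C by (auto simp: X_def)
    then show "\<exists>y\<in>X. proportional y x" by blast
  qed
qed

end

section \<open>Polynomials in two parameters\<close>

text \<open>Convention for two parameters: the inner variable is \<open>t\<close>, along the pencil,
  and the outer variable is \<open>s\<close>, the multiple of \<open>q\<close>. This abbreviation
  specialises \<open>t\<close>, while \<open>poly p [:s:]\<close> specialises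
  \<open>s\<close>.\<close>

abbreviation eval_coeffs :: "complex \<Rightarrow> complex poly poly \<Rightarrow> complex poly" where
  "eval_coeffs t \<equiv> map_poly (\<lambda>p. poly p t)"

lemma idom_hom_poly: "idom_hom (\<lambda>p. poly p (t::'a::idom))"
  by unfold_locales simp_all

lemma poly_eval_coeffs: "poly (eval_coeffs t q) s = poly (poly q [:s:]) t"
proof (induction q)
  case (pCons a q)
  then show ?case by (cases "a = 0 \<and> q = 0") (auto simp: map_poly_pCons)
qed simp

lemma card_roots_eq_degree_iff:
  fixes p :: "complex poly"
  assumes "p \<noteq> 0"
  shows "card {s. poly p s = 0} = degree p \<longleftrightarrow> (\<forall>a. \<not> (poly p a = 0 \<and> poly (pderiv p) a = 0))"
proof
  assume c: "card {s. poly p s = 0} = degree p"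
  show "\<forall>a. \<not> (poly p a = 0 \<and> poly (pderiv p) a = 0)"
  proof (intro allI notI)
    fix a assume a: "poly p a = 0 \<and> poly (pderiv p) a = 0"
    then obtain q where q: "p = [:- a, 1:] * q" by (metis dvd_def poly_eq_0_iff_dvd)
    then have q0: "q \<noteq> 0" using assms by auto
    have "poly q a = 0" using a by (simp add: q pderiv_mult pderiv_pCons del: mult_pCons_left)
    then have "{s. poly p s = 0} = {s. poly q s = 0}" by (auto simp: q)
    then have "degree p \<le> degree q" using card_poly_roots_bound[OF q0] c by simp
    moreover have "degree p = Suc (degree q)" using q0 by (simp add: q degree_mult_eq del: mult_pCons_left)
    ultimately show False by simp
  qed
next
  assume "\<forall>a. \<not> (poly p a = 0 \<and> poly (pderiv p) a = 0)"
  then have "Polynomial.smult (lead_coeff p) (\<Prod>z | poly p z = 0. [:- z, 1:]) = p"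
    using complex_poly_decompose_rsquarefree rsquarefree_roots by blast
  then have "degree p = degree (\<Prod>z | poly p z = 0. [:- z, 1::complex:])"
    using assms by (metis degree_smult_eq leading_coeff_0_iff)
  also have "\<dots> = card {s. poly p s = 0}"
    by (subst degree_prod_eq_sum_degree) auto
  finally show "card {s. poly p s = 0} = degree p" by simp
qed

text \<open>Over the complex numbers a nonconstant gcd of \<open>p\<close> and its derivative means
  a multiple root.\<close>

lemma resultant_pderiv_eq_0_iff:
  fixes p :: "complex poly"
  assumes "p \<noteq> 0"
  shows "resultant p (pderiv p) = 0 \<longleftrightarrow> card {s. poly p s = 0} \<noteq> degree p"
proof -
  have "degree (gcd p (pderiv p)) \<noteq> 0 \<longleftrightarrow> (\<exists>a. poly p a = 0 \<and> poly (pderiv p) a = 0)"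
  proof
    assume "degree (gcd p (pderiv p)) \<noteq> 0"
    then obtain a where "poly (gcd p (pderiv p)) a = 0"
      using fundamental_theorem_of_algebra[of "gcd p (pderiv p)"] by (auto simp: constant_degree)
    then have "[:- a, 1:] dvd gcd p (pderiv p)" by (simp add: poly_eq_0_iff_dvd)
    then show "\<exists>a. poly p a = 0 \<and> poly (pderiv p) a = 0"
      by (auto simp: poly_eq_0_iff_dvd)
  next
    assume "\<exists>a. poly p a = 0 \<and> poly (pderiv p) a = 0"
    then obtain a where "[:- a, 1:] dvd gcd p (pderiv p)" by (auto simp: poly_eq_0_iff_dvd)
    then have "degree [:- a, 1:] \<le> degree (gcd p (pderiv p))"
      using assms by (intro dvd_imp_degree_le) auto
    then show "degree (gcd p (pderiv p)) \<noteq> 0" by simp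
  qed
  then show ?thesis using card_roots_eq_degree_iff[OF assms] by (simp add: resultant_0_gcd)
qed

text \<open>The non-vanishing of the discriminant is an open condition on the parameter.\<close>

lemma distinct_roots_cofinite:
  fixes q :: "complex poly poly"
  assumes deg: "degree q \<le> e" and c0: "poly (coeff q e) t0 \<noteq> 0"
    and roots: "e \<le> card {s. poly (eval_coeffs t0 q) s = 0}"
  shows "finite {t. \<not> (poly (coeff q e) t \<noteq> 0 \<and> card {s. poly (eval_coeffs t q) s = 0} = e)}"
proof -
  have ce: "coeff q e \<noteq> 0" using c0 by auto
  then have dq: "degree q = e" using deg le_degree[OF ce] by simp
  define R where "R = resultant q (pderiv q)"
  \<comment> \<open>Where the coefficient of \<open>s ^ e\<close> survives, specialisation preserves
    the degrees of \<open>q\<close> and of its derivative, so it commutes with the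
    resultant.\<close>
  have deg_ev: "degree (eval_coeffs t q) = e" if "poly (coeff q e) t \<noteq> 0" for t
    using that dq by (intro antisym order_trans[OF degree_map_poly_le] le_degree) (auto simp: coeff_map_poly)
  have R: "poly R t = 0 \<longleftrightarrow> card {s. poly (eval_coeffs t q) s = 0} \<noteq> e" if t: "poly (coeff q e) t \<noteq> 0" for t
  proof -
    have hom: "comm_ring_hom (\<lambda>p::complex poly. poly p t)" by unfold_locales simp_all
    note pd = idom_hom.map_poly_pderiv[OF idom_hom_poly, of t q]
    have n0: "eval_coeffs t q \<noteq> 0" using t by (metis coeff_0 coeff_map_poly poly_0)
    have "degree (eval_coeffs t (pderiv q)) = degree (pderiv q)"
      by (simp add: pd degree_pderiv deg_ev[OF t] dq)
    then have "poly R t = resultant (eval_coeffs t q) (pderiv (eval_coeffs t q))"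
      using comm_ring_hom.resultant_map_poly[OF hom, of q "pderiv q"] deg_ev[OF t] dq by (simp add: R_def pd)
    then show ?thesis using resultant_pderiv_eq_0_iff[OF n0] deg_ev[OF t] by simp
  qed
  have "card {s. poly (eval_coeffs t0 q) s = 0} \<le> e"
    using card_poly_roots_bound[of "eval_coeffs t0 q"] deg_ev[OF c0] c0 by (metis coeff_0 coeff_map_poly poly_0)
  then have "R \<noteq> 0" using R[OF c0] roots by auto
  then have "finite ({t. poly (coeff q e) t = 0} \<union> {t. poly R t = 0})"
    using ce by (simp add: poly_roots_finite)
  then show ?thesis by (rule finite_subset[rotated]) (use R in auto)
qed

text \<open>Pseudo-division by \<open>\<delta>\<close> costs only a power of the leading
  coefficient, which is nonzero at \<open>t = 0\<close>. For \<open>t \<in> T\<close> the remainder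
  has \<open>e\<close> roots in \<open>s\<close> but degree below \<open>e\<close>, so it vanishes;
  its coefficients then vanish for infinitely many \<open>t\<close> and are zero. At
  \<open>s = 0\<close> the order of \<open>\<delta>\<close> in \<open>t\<close> passes to
  \<open>r\<close>.\<close>

lemma pseudo_division_vanishing:
  fixes r \<delta> :: "complex poly poly"
  assumes deg: "degree \<delta> \<le> e" and c0: "poly (coeff \<delta> e) 0 \<noteq> 0"
    and T: "infinite T" "\<And>t. t \<in> T \<Longrightarrow> \<exists>S. finite S \<and> card S = e \<and>
      (\<forall>s\<in>S. poly (eval_coeffs t r) s = 0 \<and> poly (eval_coeffs t \<delta>) s = 0)"
    and \<delta>0: "monom 1 d dvd poly \<delta> 0"
  shows "monom 1 d dvd poly r 0"
proof -
  have ce: "coeff \<delta> e \<noteq> 0" using c0 by auto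
  then have dd: "degree \<delta> = e" using deg le_degree[OF ce] by simp
  have \<delta>n: "\<delta> \<noteq> 0" using ce by auto
  obtain Q R where QR: "pseudo_divmod r \<delta> = (Q, R)" by force
  define c where "c = coeff \<delta> e ^ (Suc (degree r) - e)"
  have id: "Polynomial.smult c r = \<delta> * Q + R" and dR: "R = 0 \<or> degree R < e"
    using pseudo_divmod[OF \<delta>n QR] dd by (auto simp: c_def)
  have evR: "eval_coeffs t R = 0" if tT: "t \<in> T" for t
  proof (rule ccontr)
    assume n: "eval_coeffs t R \<noteq> 0"
    obtain S where S: "finite S" "card S = e" "\<And>s. s \<in> S \<Longrightarrow> poly (eval_coeffs t r) s = 0"
      "\<And>s. s \<in> S \<Longrightarrow> poly (eval_coeffs t \<delta>) s = 0" using T(2)[OF tT] by blast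
    have "poly (eval_coeffs t R) s = 0" if "s \<in> S" for s
    proof -
      have "poly (poly (Polynomial.smult c r) [:s:]) t = poly (poly (\<delta> * Q + R) [:s:]) t" by (simp add: id)
      then show ?thesis using S(3,4)[OF that] by (simp add: poly_eval_coeffs)
    qed
    then have "S \<subseteq> {s. poly (eval_coeffs t R) s = 0}" by blast
    then have "e \<le> card {s. poly (eval_coeffs t R) s = 0}"
      using S(2) card_mono[OF poly_roots_finite[OF n]] by blast
    also have "\<dots> \<le> degree (eval_coeffs t R)" by (rule card_poly_roots_bound[OF n])
    also have "\<dots> \<le> degree R" by (rule degree_map_poly_le)
    finally show False using dR n by auto
  qed
  have "R = 0"
  proof (rule poly_eqI)
    fix n
    have "T \<subseteq> {t. poly (coeff R n) t = 0}"
    proof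
      fix t assume "t \<in> T"
      then have "coeff (eval_coeffs t R) n = 0" using evR by simp
      then show "t \<in> {t. poly (coeff R n) t = 0}" by (simp add: coeff_map_poly)
    qed
    then have "infinite {t. poly (coeff R n) t = 0}" using T(1) infinite_super by blast
    then show "coeff R n = coeff 0 n" using poly_roots_finite by auto
  qed
  then have "poly (Polynomial.smult c r) 0 = poly (\<delta> * Q) 0" using id by simp
  then have e: "c * poly r 0 = poly \<delta> 0 * poly Q 0" by simp
  show ?thesis
  proof (cases "poly r 0 = 0")
    case False
    have cn: "c \<noteq> 0" using ce by (simp add: c_def)
    have "poly c 0 \<noteq> 0" using c0 by (simp add: c_def)
    then have "order 0 c = 0" by (simp add: order_0I)
    have "monom 1 d dvd c * poly r 0" using \<delta>0 e by simp
    then have "d \<le> order 0 (c * poly r 0)" using cn False by (simp add: monom_1_dvd_iff)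
    also have "\<dots> = order 0 (poly r 0)" using \<open>order 0 c = 0\<close> cn False by (simp add: order_mult)
    finally show ?thesis using False by (simp add: monom_1_dvd_iff)
  qed simp
qed

section \<open>Determinants that depend on two parameters\<close>

lemma prod_linear_top_coeff:
  fixes a c :: "'i \<Rightarrow> 'a::comm_ring_1"
  assumes "finite S"
  shows "degree (\<Prod>k\<in>S. [:a k, c k:]) \<le> card S" "coeff (\<Prod>k\<in>S. [:a k, c k:]) (card S) = (\<Prod>k\<in>S. c k)"
  using assms
proof (induction S rule: finite_induct)
  case (insert k S)
  let ?P = "\<Prod>k\<in>S. [:a k, c k:]"
  have e: "(\<Prod>k\<in>insert k S. [:a k, c k:]) = Polynomial.smult (a k) ?P + pCons 0 (Polynomial.smult (c k) ?P)"
    using insert.hyps by simp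
  { case 1
    have "degree (Polynomial.smult (a k) ?P) \<le> Suc (card S)"
      using insert.IH(1) degree_smult_le[of "a k" ?P] by simp
    moreover have "degree (pCons 0 (Polynomial.smult (c k) ?P)) \<le> Suc (card S)"
      using insert.IH(1) degree_smult_le[of "c k" ?P] degree_pCons_le[of 0 "Polynomial.smult (c k) ?P"] by simp
    ultimately show ?case unfolding e using insert.hyps by (simp add: degree_add_le) }
  { case 2
    have "coeff ?P (Suc (card S)) = 0" using insert.IH(1) by (simp add: coeff_eq_0)
    then show ?case unfolding e using insert by simp }
qed auto

text \<open>The last \<open>e\<close> rows depend linearly on a second parameter.\<close>

context
  fixes N e :: nat and \<alpha> \<beta> \<gamma> :: "nat \<Rightarrow> nat \<Rightarrow> complex"
begin

definition family_entry :: "nat \<Rightarrow> nat \<Rightarrow> complex poly poly" where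
  "family_entry k j = (if k < N - e then [:[:\<alpha> k j, \<beta> k j:]:] else [:[:\<alpha> k j, \<beta> k j:], [:\<gamma> k j:]:])"

definition family_det :: "complex poly poly" where
  "family_det = det (mat N N (\<lambda>(k, j). family_entry k j))"

lemma poly_family_det:
  "poly (eval_coeffs t family_det) s =
    det (mat N N (\<lambda>(k, j). \<alpha> k j + t * \<beta> k j + (if k < N - e then 0 else s * \<gamma> k j)))"
proof -
  interpret h: comm_ring_hom "\<lambda>p::complex poly poly. poly (poly p [:s:]) t"
    by unfold_locales simp_all
  have "poly (eval_coeffs t family_det) s =
      det (map_mat (\<lambda>p. poly (poly p [:s:]) t) (mat N N (\<lambda>(k, j). family_entry k j)))"
    by (simp only: poly_eval_coeffs family_det_def h.hom_det)
  also have "map_mat (\<lambda>p. poly (poly p [:s:]) t) (mat N N (\<lambda>(k, j). family_entry k j)) =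
      mat N N (\<lambda>(k, j). \<alpha> k j + t * \<beta> k j + (if k < N - e then 0 else s * \<gamma> k j))"
    by (intro eq_matI) (auto simp: family_entry_def)
  finally show ?thesis .
qed

text \<open>Each product of the Leibniz expansion has one factor from each of the last
  \<open>e\<close> rows, and only these can involve \<open>s\<close>. The top coefficient takes
  \<open>\<gamma>\<close> from all of them.\<close>

lemma family_det_top:
  assumes "e \<le> N"
  shows "degree family_det \<le> e"
    and "poly (coeff family_det e) t =
      det (mat N N (\<lambda>(k, j). if k < N - e then \<alpha> k j + t * \<beta> k j else \<gamma> k j))"
proof -
  let ?S = "{p. p permutes {0..<N}}" and ?A = "{0..<N - e}" and ?B = "{N - e..<N}"
  have dis: "{0..<N} = ?A \<union> ?B" "?A \<inter> ?B = {}" using assms by auto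
  have cB: "card ?B = e" using assms by simp
  define a where "a = (\<lambda>p. \<Prod>k\<in>?A. [:\<alpha> k (p k), \<beta> k (p k):])"
  define b where "b = (\<lambda>p. \<Prod>k\<in>?B. [:[:\<alpha> k (p k), \<beta> k (p k):], [:\<gamma> k (p k):]:])"
  have prod: "(\<Prod>k = 0..<N. family_entry k (p k)) = Polynomial.smult (a p) (b p)" for p
  proof -
    have "(\<Prod>k = 0..<N. family_entry k (p k)) = (\<Prod>k\<in>?A. family_entry k (p k)) * (\<Prod>k\<in>?B. family_entry k (p k))"
      unfolding dis(1) by (rule prod.union_disjoint) (use dis in auto)
    also have "(\<Prod>k\<in>?A. family_entry k (p k)) = (\<Prod>k\<in>?A. [:[:\<alpha> k (p k), \<beta> k (p k):]:])"
      by (intro prod.cong) (auto simp: family_entry_def)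
    also have "\<dots> = [:a p:]"
    proof -
      have "(\<Prod>k\<in>X. [:f k:]) = [:\<Prod>k\<in>X. f k:]" for X and f :: "nat \<Rightarrow> complex poly"
        by (induction X rule: infinite_finite_induct) auto
      then show ?thesis by (simp add: a_def)
    qed
    also have "(\<Prod>k\<in>?B. family_entry k (p k)) = b p"
      unfolding b_def by (intro prod.cong) (auto simp: family_entry_def)
    finally show ?thesis by simp
  qed
  have sgn: "signof p = [:signof p :: complex poly:]" for p :: "nat \<Rightarrow> nat"
    by (rule of_int_poly)
  have det: "family_det = (\<Sum>p\<in>?S. Polynomial.smult (signof p * a p) (b p))"
  proof -
    have "family_det = (\<Sum>p\<in>?S. signof p * (\<Prod>k = 0..<N. mat N N (\<lambda>(k, j). family_entry k j) $$ (k, p k)))"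
      unfolding family_det_def by (rule det_def') simp
    also have "\<dots> = (\<Sum>p\<in>?S. Polynomial.smult (signof p * a p) (b p))"
    proof (intro sum.cong refl)
      fix p assume "p \<in> ?S"
      then have "p k < N" if "k < N" for k using permutes_in_image[of p "{0..<N}" k] that by auto
      then have "(\<Prod>k = 0..<N. mat N N (\<lambda>(k, j). family_entry k j) $$ (k, p k)) = Polynomial.smult (a p) (b p)"
        unfolding prod[symmetric] by (intro prod.cong) auto
      moreover have "signof p * Polynomial.smult (a p) (b p) = Polynomial.smult (signof p * a p) (b p)"
      proof -
        have "[:x:] * Polynomial.smult y z = Polynomial.smult (x * y) z" for x y :: "complex poly" and z by (simp add: mult.commute)
        then show ?thesis by (subst sgn)
      qed
      ultimately show "signof p * (\<Prod>k = 0..<N. mat N N (\<lambda>(k, j). family_entry k j) $$ (k, p k)) = Polynomial.smult (signof p * a p) (b p)"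
        by simp
    qed
    finally show ?thesis .
  qed
  have b: "degree (b p) \<le> e" "coeff (b p) e = (\<Prod>k\<in>?B. [:\<gamma> k (p k):])" for p
    using prod_linear_top_coeff[of ?B "\<lambda>k. [:\<alpha> k (p k), \<beta> k (p k):]" "\<lambda>k. [:\<gamma> k (p k):]"]
    unfolding b_def cB by auto
  show "degree family_det \<le> e"
    unfolding det by (rule degree_sum_le) (auto intro: order_trans[OF degree_smult_le] b simp: finite_permutations)
  have "poly (coeff family_det e) t = (\<Sum>p\<in>?S. signof p * (poly (a p) t * (\<Prod>k\<in>?B. \<gamma> k (p k))))"
    unfolding det by (simp add: coeff_sum poly_sum poly_prod b sign_def mult.assoc)
  also have "\<dots> = (\<Sum>p\<in>?S. signof p *
      (\<Prod>k = 0..<N. mat N N (\<lambda>(k, j). if k < N - e then \<alpha> k j + t * \<beta> k j else \<gamma> k j) $$ (k, p k)))"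
  proof (intro sum.cong refl)
    fix p assume "p \<in> ?S"
    then have pk: "p k < N" if "k < N" for k using that permutes_in_image[of p "{0..<N}" k] by simp
    have "(\<Prod>k = 0..<N. mat N N (\<lambda>(k, j). if k < N - e then \<alpha> k j + t * \<beta> k j else \<gamma> k j) $$ (k, p k))
      = (\<Prod>k\<in>?A \<union> ?B. if k < N - e then \<alpha> k (p k) + t * \<beta> k (p k) else \<gamma> k (p k))"
      unfolding dis(1)[symmetric] using pk by (intro prod.cong) auto
    also have "\<dots> = (\<Prod>k\<in>?A. if k < N - e then \<alpha> k (p k) + t * \<beta> k (p k) else \<gamma> k (p k)) *
        (\<Prod>k\<in>?B. if k < N - e then \<alpha> k (p k) + t * \<beta> k (p k) else \<gamma> k (p k))"
      by (rule prod.union_disjoint) (use dis in auto)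
    also have "\<dots> = poly (a p) t * (\<Prod>k\<in>?B. \<gamma> k (p k))"
      unfolding a_def poly_prod by (intro arg_cong2[of _ _ _ _ "(*)"] prod.cong) auto
    finally show "signof p * (poly (a p) t * (\<Prod>k\<in>?B. \<gamma> k (p k))) = signof p *
      (\<Prod>k = 0..<N. mat N N (\<lambda>(k, j). if k < N - e then \<alpha> k j + t * \<beta> k j else \<gamma> k j) $$ (k, p k))" by simp
  qed
  also have "\<dots> = det (mat N N (\<lambda>(k, j). if k < N - e then \<alpha> k j + t * \<beta> k j else \<gamma> k j))"
    by (rule det_def'[symmetric]) simp
  finally show "poly (coeff family_det e) t = det (mat N N (\<lambda>(k, j). if k < N - e then \<alpha> k j + t * \<beta> k j else \<gamma> k j))" .
qed

text \<open>At \<open>s = 0\<close> the entries of the first \<open>d\<close> columns are multiples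
  of \<open>t\<close>, and every term of the determinant takes one entry from each column.\<close>

lemma family_det_order:
  assumes d: "d \<le> N" and \<alpha>: "\<And>k j. k < N \<Longrightarrow> j < d \<Longrightarrow> \<alpha> k j = 0"
  shows "monom 1 d dvd poly family_det 0"
proof -
  have hom: "comm_ring_hom (\<lambda>p::complex poly poly. poly p 0)"
    by unfold_locales simp_all
  let ?M = "mat N N (\<lambda>(k, j). [:\<alpha> k j, \<beta> k j:])"
  have "poly family_det 0 = det (map_mat (\<lambda>p. poly p 0) (mat N N (\<lambda>(k, j). family_entry k j)))"
    unfolding family_det_def by (rule comm_ring_hom.hom_det[OF hom, symmetric])
  also have "map_mat (\<lambda>p. poly p 0) (mat N N (\<lambda>(k, j). family_entry k j)) = ?M"
    by (intro eq_matI) (auto simp: family_entry_def)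
  \<comment> \<open>The Leibniz formula runs over the rows; transposing lets it run over the columns
    \<open>j\<close>.\<close>
  also have "det ?M = det (transpose_mat ?M)" by (rule det_transpose[of _ N, symmetric]) simp
  also have "\<dots> = (\<Sum>p\<in>{p. p permutes {0..<N}}. signof p * (\<Prod>j = 0..<N. transpose_mat ?M $$ (j, p j)))"
    by (rule det_def') simp
  also have "monom 1 d dvd \<dots>"
  proof (intro dvd_sum dvd_mult)
    fix p assume "p \<in> {p. p permutes {0..<N}}"
    then have pk: "p k < N" if "k < N" for k using that permutes_in_image[of p "{0..<N}" k] by simp
    have "monom 1 d = (\<Prod>j = 0..<d. monom (1::complex) 1)" by (simp add: monom_power)
    also have "\<dots> dvd (\<Prod>j = 0..<d. transpose_mat ?M $$ (j, p j))"
    proof (rule prod_dvd_prod)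
      fix j assume "j \<in> {0..<d}"
      then have "transpose_mat ?M $$ (j, p j) = [:0, \<beta> (p j) j:]" using pk[of j] d \<alpha>[of "p j" j] by simp
      then show "monom 1 1 dvd transpose_mat ?M $$ (j, p j)" by (simp add: monom_1_dvd_iff')
    qed
    also have "\<dots> dvd (\<Prod>j = 0..<N. transpose_mat ?M $$ (j, p j))"
      by (rule prod_dvd_prod_subset) (use d in auto)
    finally show "monom 1 d dvd (\<Prod>j = 0..<N. transpose_mat ?M $$ (j, p j))" .
  qed
  finally show ?thesis .
qed

end

section \<open>Orders of vanishing and lines\<close>

lemma mpoly_pderiv_superset:
  assumes "finite S" "Poly_Mapping.keys p \<subseteq> S"
  shows "mpoly_pderiv v p = (\<Sum>a\<in>S. Poly_Mapping.single (a - Poly_Mapping.single v 1)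
      (of_nat (Poly_Mapping.lookup a v) * Poly_Mapping.lookup p a))"
  unfolding mpoly_pderiv_def using assms
  by (intro sum.mono_neutral_left) (auto simp: in_keys_iff)

lemma mpoly_pderiv_zero [simp]: "mpoly_pderiv v 0 = 0"
  by (simp add: mpoly_pderiv_def)

lemma mpoly_pderiv_single:
  "mpoly_pderiv v (Poly_Mapping.single a c) =
    Poly_Mapping.single (a - Poly_Mapping.single v 1) (of_nat (Poly_Mapping.lookup a v) * c)"
  by (subst mpoly_pderiv_superset[of "{a}"]) auto

lemma mpoly_pderiv_add: "mpoly_pderiv v (p + q) = mpoly_pderiv v p + mpoly_pderiv v q"
proof -
  let ?S = "Poly_Mapping.keys p \<union> Poly_Mapping.keys q"
  have "Poly_Mapping.keys (p + q) \<subseteq> ?S" by (rule keys_add)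
  then show ?thesis
    by (simp add: mpoly_pderiv_superset[of ?S] lookup_add distrib_left single_add sum.distrib)
qed

lemma power_add_first_order:
  fixes x w :: "'b::comm_ring_1"
  shows "\<exists>q. (x + w) ^ n = x ^ n + of_nat n * w * x ^ (n - 1) + w\<^sup>2 * q"
proof (induction n)
  case (Suc n)
  then obtain q where q: "(x + w) ^ n = x ^ n + of_nat n * w * x ^ (n - 1) + w\<^sup>2 * q" by blast
  have x: "of_nat n * w * x ^ (n - 1) * x = of_nat n * w * x ^ n" by (cases n) (auto simp: mult_ac)
  have "(x + w) ^ Suc n = (x ^ n + of_nat n * w * x ^ (n - 1) + w\<^sup>2 * q) * (x + w)" by (simp add: q mult.commute)
  also have "\<dots> = x ^ n * x + x ^ n * w + of_nat n * w * x ^ (n - 1) * x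
      + w\<^sup>2 * (of_nat n * x ^ (n - 1) + q * (x + w))"
    by (simp add: algebra_simps power2_eq_square)
  also have "\<dots> = x ^ Suc n + of_nat (Suc n) * w * x ^ (Suc n - 1) + w\<^sup>2 * (of_nat n * x ^ (n - 1) + q * (x + w))"
    unfolding x by (simp add: algebra_simps)
  finally show ?case by blast
qed (intro exI[of _ 0], simp)

text \<open>Taylor expansion in one variable, linking the formal \<open>mpoly_pderiv\<close> with
  substitution. The increment \<open>w\<close> is an arbitrary ring element, so that it can later be
  a product of two parameters.\<close>

lemma mpoly_hom_first_order:
  fixes h :: "'a::comm_ring_1 \<Rightarrow> 'b::comm_ring_1"
  assumes h: "h 0 = 0" "h 1 = 1" "\<And>a b. h (a + b) = h a + h b" "\<And>a b. h (a * b) = h a * h b"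
  shows "\<exists>q. mpoly_hom h (X(v := X v + w)) p = mpoly_hom h X p + w * mpoly_hom h X (mpoly_pderiv v p) + w\<^sup>2 * q"
proof (induction p rule: poly_mapping_single_induct)
  case zero
  show ?case by (intro exI[of _ 0]) (simp add: mpoly_hom_zero[of h] h)
next
  case (single a c)
  let ?n = "Poly_Mapping.lookup a v"
  define b where "b = a - Poly_Mapping.single v ?n"
  have ab: "a = Poly_Mapping.single v ?n + b"
    by (intro poly_mapping_eqI) (auto simp: b_def lookup_add lookup_minus lookup_single when_def)
  have bv: "v \<notin> Poly_Mapping.keys b" by (auto simp: b_def lookup_minus in_keys_iff)
  have mb: "monomial_value (X(v := y)) b = monomial_value X b" for y
    unfolding monomial_value_def using bv by (intro prod.cong) auto
  \<comment> \<open>The truncated exponent in \<open>mpoly_pderiv\<close> is exact when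
    \<open>v\<close> occurs in \<open>a\<close>; otherwise the coefficient is zero.\<close>
  have a1: "a - Poly_Mapping.single v 1 = Poly_Mapping.single v (?n - 1) + b" if "?n \<noteq> 0"
    using that by (intro poly_mapping_eqI) (auto simp: b_def lookup_add lookup_minus lookup_single when_def)
  have hn: "h (of_nat n) = of_nat n" for n by (induction n) (auto simp: h)
  obtain q where q: "(X v + w) ^ ?n = X v ^ ?n + of_nat ?n * w * X v ^ (?n - 1) + w\<^sup>2 * q"
    using power_add_first_order by blast
  have ma: "monomial_value Y a = Y v ^ ?n * monomial_value Y b" for Y :: "'c \<Rightarrow> 'b"
    using arg_cong[OF ab, of "monomial_value Y"] by (simp add: monomial_value_add)
  have d: "mpoly_hom h X (mpoly_pderiv v (Poly_Mapping.single a c)) = h c * (of_nat ?n * X v ^ (?n - 1) * monomial_value X b)"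
  proof (cases "?n = 0")
    case True
    then show ?thesis by (simp add: mpoly_pderiv_single mpoly_hom_zero[of h] h)
  next
    case False
    then show ?thesis
      by (simp add: mpoly_pderiv_single mpoly_hom_single[of h] h hn a1[simplified] monomial_value_add mult_ac)
  qed
  have "mpoly_hom h (X(v := X v + w)) (Poly_Mapping.single a c) = h c * ((X v + w) ^ ?n * monomial_value X b)"
    by (simp add: mpoly_hom_single[of h] h ma mb)
  also have "\<dots> = h c * (X v ^ ?n * monomial_value X b) + w * (h c * (of_nat ?n * X v ^ (?n - 1) * monomial_value X b))
      + w\<^sup>2 * (h c * q * monomial_value X b)"
    unfolding q by (simp add: algebra_simps)
  also have "h c * (X v ^ ?n * monomial_value X b) = mpoly_hom h X (Poly_Mapping.single a c)"
    by (simp add: mpoly_hom_single[of h] h ma)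
  finally show ?case unfolding d by blast
next
  case (add p q)
  then obtain a b where e: "mpoly_hom h (X(v := X v + w)) p = mpoly_hom h X p + w * mpoly_hom h X (mpoly_pderiv v p) + w\<^sup>2 * a"
    "mpoly_hom h (X(v := X v + w)) q = mpoly_hom h X q + w * mpoly_hom h X (mpoly_pderiv v q) + w\<^sup>2 * b" by blast
  have "mpoly_hom h (X(v := X v + w)) (p + q) = mpoly_hom h (X(v := X v + w)) p + mpoly_hom h (X(v := X v + w)) q"
    by (rule mpoly_hom_add[OF h])
  also have "\<dots> = mpoly_hom h X (p + q) + w * mpoly_hom h X (mpoly_pderiv v (p + q)) + w\<^sup>2 * (a + b)"
    unfolding e by (simp add: mpoly_hom_add[of h] h mpoly_pderiv_add algebra_simps)
  finally show ?case by blast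
qed

lemma mpoly_hom_comp:
  fixes g :: "'b::comm_semiring_1 \<Rightarrow> 'c::comm_semiring_1" and h :: "'a::zero \<Rightarrow> 'b" and X :: "'v \<Rightarrow> 'b"
  assumes "g 0 = 0" "g 1 = 1" "\<And>a b. g (a + b) = g a + g b" "\<And>a b. g (a * b) = g a * g b"
  shows "g (mpoly_hom h X p) = mpoly_hom (\<lambda>c. g (h c)) (\<lambda>v. g (X v)) p"
proof -
  have s: "g (sum f S) = (\<Sum>i\<in>S. g (f i))" for f :: "('v \<Rightarrow>\<^sub>0 nat) \<Rightarrow> 'b" and S
    by (induction S rule: infinite_finite_induct) (auto simp: assms)
  have p: "g (prod f S) = (\<Prod>i\<in>S. g (f i))" for f :: "'v \<Rightarrow> 'b" and S
    by (induction S rule: infinite_finite_induct) (auto simp: assms)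
  have w: "g (x ^ n) = g x ^ n" for x n by (induction n) (auto simp: assms)
  show ?thesis by (simp add: mpoly_hom_def monomial_value_def s p w assms)
qed

section \<open>Restriction to lines and surfaces\<close>

text \<open>The polynomial \<open>p(x + t y)\<close> in \<open>t\<close>.\<close>

definition on_line :: "('v, complex) mpoly \<Rightarrow> ('v \<Rightarrow> complex) \<Rightarrow> ('v \<Rightarrow> complex) \<Rightarrow> complex poly" where
  "on_line p x y = mpoly_hom (\<lambda>c. [:c:]) (\<lambda>v. [:x v, y v:]) p"

lemma poly_on_line: "poly (on_line p x y) t = mpoly_eval (\<lambda>v. x v + t * y v) p"
proof -
  have "poly (on_line p x y) t = mpoly_hom (\<lambda>c. poly [:c:] t) (\<lambda>v. poly [:x v, y v:] t) p"
    unfolding on_line_def by (rule mpoly_hom_comp) auto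
  then show ?thesis by (simp add: mpoly_eval_eq_hom)
qed

text \<open>The polynomial \<open>p(x + t y + s (z + t w))\<close>, with \<open>s\<close> as the
  outer variable.\<close>

definition on_surface :: "('v, complex) mpoly \<Rightarrow> ('v \<Rightarrow> complex) \<Rightarrow> ('v \<Rightarrow> complex) \<Rightarrow> ('v \<Rightarrow> complex) \<Rightarrow>
    ('v \<Rightarrow> complex) \<Rightarrow> complex poly poly" where
  "on_surface p x y z w = mpoly_hom (\<lambda>c. [:[:c:]:]) (\<lambda>v. [:[:x v, y v:], [:z v, w v:]:]) p"

lemma poly_on_surface:
  "poly (on_surface p x y z w) [:s:] = on_line p (\<lambda>v. x v + s * z v) (\<lambda>v. y v + s * w v)"
proof -
  have "poly (on_surface p x y z w) [:s:] =
      mpoly_hom (\<lambda>c. poly [:[:c:]:] [:s:]) (\<lambda>v. poly [:[:x v, y v:], [:z v, w v:]:] [:s:]) p"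
    unfolding on_surface_def by (rule mpoly_hom_comp) auto
  then show ?thesis by (simp add: on_line_def mult.commute)
qed

lemma coeff_poly_const:
  fixes q :: "complex poly poly"
  shows "\<exists>g. \<forall>s. coeff (poly q [:s:]) j = poly g s"
proof (induction q)
  case 0
  then show ?case by (intro exI[of _ 0]) simp
next
  case (pCons a q)
  then obtain g where "\<forall>s. coeff (poly q [:s:]) j = poly g s" by blast
  then show ?case by (intro exI[of _ "pCons (coeff a j) g"]) simp
qed

text \<open>Vanishing of a coefficient for almost all directions of a pencil extends to all of them,
  because it depends polynomially on the direction.\<close>

lemma coeff_on_line_direction:
  "\<exists>g. \<forall>s. coeff (on_line p x (\<lambda>v. y v + s * w v)) j = poly g s"
  using coeff_poly_const[of "on_surface p x y (\<lambda>v. 0) w" j] by (simp add: poly_on_surface)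

lemma poly_zero_of_cofinite:
  fixes g :: "complex poly"
  assumes "finite {s. poly g s \<noteq> 0}"
  shows "g = 0"
proof (rule ccontr)
  assume "g \<noteq> 0"
  then have "finite ({s. poly g s = 0} \<union> {s. poly g s \<noteq> 0})" using assms by (simp add: poly_roots_finite)
  moreover have "{s. poly g s = 0} \<union> {s. poly g s \<noteq> 0} = UNIV" by auto
  ultimately show False using infinite_UNIV_char_0[where ?'a = complex] by simp
qed

text \<open>Let \<open>e_v\<close> be the direction of \<open>v\<close>. Up to a multiple of
  \<open>(t s)^2\<close>, \<open>p(x + t y + t s e_v)\<close> is \<open>p(x + t y)\<close> plus
  \<open>t s\<close> times the derivative of \<open>p\<close> by \<open>v\<close> at
  \<open>x + t y\<close>. For \<open>s \<noteq> 0\<close> the factor \<open>t s\<close> can be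
  divided out at the cost of one order in \<open>t\<close>. The quotient is polynomial in
  \<open>s\<close>, and at \<open>s = 0\<close> it is the derivative.\<close>

lemma on_line_pderiv:
  assumes "\<And>u. \<forall>j<Suc k. coeff (on_line p x (y(v := y v + u))) j = 0"
  shows "\<forall>j<k. coeff (on_line (mpoly_pderiv v p) x y) j = 0"
proof (intro allI impI)
  fix j assume j: "j < k"
  define X where "X = (\<lambda>v. [:[:x v, y v:]:] :: complex poly poly)"
  \<comment> \<open>This is the product \<open>s t\<close>.\<close>
  define w where "w = ([:0, [:0, 1:]:] :: complex poly poly)"
  define h where "h = (\<lambda>c::complex. [:[:c:]:])"
  have h: "h 0 = 0" "h 1 = 1" "\<And>a b. h (a + b) = h a + h b" "\<And>a b. h (a * b) = h a * h b"
    by (simp_all add: h_def pCons_one)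
  obtain q where q: "mpoly_hom h (X(v := X v + w)) p = mpoly_hom h X p + w * mpoly_hom h X (mpoly_pderiv v p) + w\<^sup>2 * q"
    using mpoly_hom_first_order[OF h, of X v w p] by blast
  have e1: "poly (mpoly_hom h (X(v := X v + w)) p) [:u:] = on_line p x (y(v := y v + u))" for u
  proof -
    have "poly (mpoly_hom h (X(v := X v + w)) p) [:u:] =
        mpoly_hom (\<lambda>c. poly (h c) [:u:]) (\<lambda>v'. poly ((X(v := X v + w)) v') [:u:]) p"
      by (rule mpoly_hom_comp) auto
    also have "(\<lambda>v'. poly ((X(v := X v + w)) v') [:u:]) = (\<lambda>v'. [:x v', (y(v := y v + u)) v':])"
      by (auto simp: X_def w_def)
    also have "(\<lambda>c. poly (h c) [:u:]) = (\<lambda>c. [:c:])" by (simp add: h_def)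
    finally show ?thesis by (simp only: on_line_def)
  qed
  have e2: "poly (mpoly_hom h X p') [:u:] = on_line p' x y" for u p'
  proof -
    have "poly (mpoly_hom h X p') [:u:] = mpoly_hom (\<lambda>c. poly (h c) [:u:]) (\<lambda>v'. poly (X v') [:u:]) p'"
      by (rule mpoly_hom_comp) auto
    then show ?thesis by (simp add: on_line_def h_def X_def)
  qed
  define r where "r = mpoly_hom h X (mpoly_pderiv v p) + w * q"
  have c0: "coeff (on_line p x y) i = 0" if "i < Suc k" for i using assms[of 0] that by simp
  have r: "coeff (poly r [:u:]) j = 0" if "u \<noteq> 0" for u
  proof -
    have "on_line p x (y(v := y v + u)) =
        poly (mpoly_hom h X p + w * mpoly_hom h X (mpoly_pderiv v p) + w\<^sup>2 * q) [:u:]"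
      by (simp only: e1[symmetric] q)
    also have "\<dots> = on_line p x y + [:0, u:] * poly r [:u:]"
      by (simp add: e2 r_def w_def power2_eq_square algebra_simps)
    finally have "on_line p x (y(v := y v + u)) = on_line p x y + [:0, u:] * poly r [:u:]" .
    then have "coeff ([:0, u:] * poly r [:u:]) (Suc j) = 0"
      using assms[of u] c0[of "Suc j"] j by (metis Suc_less_eq add_0 coeff_add)
    then show ?thesis using that by simp
  qed
  obtain g where g: "\<forall>s. coeff (poly r [:s:]) j = poly g s" using coeff_poly_const by blast
  have "finite {s. poly g s \<noteq> 0}" by (rule finite_subset[of _ "{0}"]) (use r g in auto)
  then have "g = 0" by (rule poly_zero_of_cofinite)
  moreover have "coeff (poly r [:0:]) j = poly g 0" using g by blast
  ultimately have "coeff (poly r [:0:]) j = 0" by simp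
  then show "coeff (on_line (mpoly_pderiv v p) x y) j = 0"
    using e2[of "mpoly_pderiv v p" 0] by (simp add: r_def w_def)
qed

text \<open>Closure of \<open>W\<close> under moves in the coordinates of \<open>V\<close> allows
  \<open>on_line_pderiv\<close> to be iterated; each derivative lowers \<open>k\<close> by
  one.\<close>

lemma vanishes_on_lines_imp:
  assumes W: "W \<noteq> {}" "\<And>y v u. y \<in> W \<Longrightarrow> v \<in> V \<Longrightarrow> y(v := y v + u) \<in> W"
    and "\<And>y. y \<in> W \<Longrightarrow> \<forall>j<k. coeff (on_line p x y) j = 0" "vs \<in> lists V" "length vs < k"
  shows "mpoly_eval x (fold mpoly_pderiv vs p) = 0"
  using assms(3-)
proof (induction vs arbitrary: k p)
  case Nil
  obtain y where "y \<in> W" using W(1) by blast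
  then have "coeff (on_line p x y) 0 = 0" using Nil by simp
  then show ?case using poly_on_line[of p x y 0] by (simp add: poly_0_coeff_0)
next
  case (Cons v vs)
  obtain k' where k: "k = Suc k'" using Cons.prems(3) by (cases k) auto
  have "\<forall>j<k'. coeff (on_line (mpoly_pderiv v p) x y) j = 0" if "y \<in> W" for y
    using Cons.prems(1,2) W(2)[OF that] k by (intro on_line_pderiv) auto
  then show ?case using Cons.IH[of k' "mpoly_pderiv v p"] Cons.prems k by simp
qed

section \<open>The determinant on a pencil\<close>

text \<open>A basis of \<open>U\<close> is extended to one of \<open>V\<close>, and the added
  vectors are numbered first: there are at least \<open>d\<close> of them, and their coordinates
  vanish on \<open>U\<close>. Linearity is claimed on \<open>V\<close> only.\<close>

lemma (in vector_space) adapted_coordinates: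
  assumes V: "U \<subseteq> V" "finite S" "V \<subseteq> span S" "subspace V" and d: "dim U + d \<le> dim V"
  obtains \<xi> :: "nat \<Rightarrow> 'b \<Rightarrow> 'a" where
    "\<And>j x y. x \<in> V \<Longrightarrow> y \<in> V \<Longrightarrow> \<xi> j (x + y) = \<xi> j x + \<xi> j y"
    "\<And>j c x. x \<in> V \<Longrightarrow> \<xi> j (scale c x) = c * \<xi> j x"
    "\<And>j x. j < d \<Longrightarrow> x \<in> U \<Longrightarrow> \<xi> j x = 0"
    "\<And>x. x \<in> V \<Longrightarrow> (\<And>j. j < dim V \<Longrightarrow> \<xi> j x = 0) \<Longrightarrow> x = 0"
proof -
  obtain B C where BC: "B \<subseteq> C" "C \<subseteq> V" "independent C" "finite C" "B \<subseteq> U" "U \<subseteq> span B"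
    "V \<subseteq> span C" "card B = dim U" "card C = dim V"
    using basis_extension_exists[OF V(1-3)] by metis
  have fB: "finite B" "finite (C - B)" using BC finite_subset by auto
  have c: "card (C - B) + card B = dim V" using BC
    by (metis card_Diff_subset card_mono fB(1) le_add_diff_inverse2)
  obtain g where g: "bij_betw g {0..<card (C - B)} (C - B)" using ex_bij_betw_nat_finite[OF fB(2)] by blast
  obtain h where h: "bij_betw h {0..<card B} B" using ex_bij_betw_nat_finite[OF fB(1)] by blast
  define b where "b = (\<lambda>j. if j < card (C - B) then g j else h (j - card (C - B)))"
  have bC: "C \<subseteq> b ` {..<dim V}"
  proof
    fix x assume x: "x \<in> C"
    show "x \<in> b ` {..<dim V}"
    proof (cases "x \<in> B")
      case True
      then obtain i where "i < card B" "x = h i" using h unfolding bij_betw_def by (metis atLeastLessThan_iff imageE)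
      then show ?thesis using c by (intro image_eqI[of _ _ "card (C - B) + i"]) (auto simp: b_def)
    next
      case False
      then obtain i where "i < card (C - B)" "x = g i" using g x unfolding bij_betw_def by (metis DiffI atLeastLessThan_iff imageE)
      then show ?thesis using c by (intro image_eqI[of _ _ i]) (auto simp: b_def)
    qed
  qed
  show ?thesis
  proof (rule that[of "\<lambda>j x. representation C x (b j)"])
    fix j x y assume "x \<in> V" "y \<in> V"
    then have "x \<in> span C" "y \<in> span C" using BC(7) by auto
    then show "representation C (x + y) (b j) = representation C x (b j) + representation C y (b j)"
      by (simp add: representation_add[OF BC(3)])
  next
    fix j c x assume "x \<in> V"
    then show "representation C (scale c x) (b j) = c * representation C x (b j)"
      using representation_scale[OF BC(3), of x c] BC(7) by auto
  next
    fix j x assume j: "j < d" and x: "x \<in> U"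
    have "j < card (C - B)" using j c d BC(8) by simp
    then have "b j \<notin> B" using g by (auto simp: b_def bij_betw_def)
    moreover have "representation C x = representation B x"
      using representation_extend[OF BC(3), of x B] x BC(1,6) by blast
    ultimately show "representation C x (b j) = 0" using representation_ne_zero by metis
  next
    fix x assume x: "x \<in> V" and z: "\<And>j. j < dim V \<Longrightarrow> representation C x (b j) = 0"
    have "representation C x y = 0" for y
    proof (cases "y \<in> C")
      case True
      then obtain j where "j < dim V" "y = b j" using bC by auto
      then show ?thesis using z by simp
    next
      case False
      then show ?thesis using representation_ne_zero by metis
    qed
    then show "x = 0" using sum_nonzero_representation_eq[OF BC(3), of x] x BC(7) by (simp add: subset_iff)
  qed
qed

context projective_space
begin

definition common_zero :: "(nat \<Rightarrow> (nat, complex) mpoly) \<Rightarrow> bool" where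
  "common_zero f \<longleftrightarrow> (\<exists>x. point x \<and> (\<forall>i\<le>m. mpoly_eval x (f i) = 0))"

definition form_tuple :: "nat \<Rightarrow> (nat \<Rightarrow> (nat, complex) mpoly) \<Rightarrow> bool" where
  "form_tuple n f \<longleftrightarrow> (\<forall>i\<le>m. f i \<in> forms n)"

lemma form_tupleI: "(\<And>i. i \<le> m \<Longrightarrow> f i \<in> forms n) \<Longrightarrow> form_tuple n f"
  and form_tupleD: "form_tuple n f \<Longrightarrow> i \<le> m \<Longrightarrow> f i \<in> forms n"
  by (auto simp: form_tuple_def)

lemma form_tuple_upd: "form_tuple n f \<Longrightarrow> g \<in> forms n \<Longrightarrow> form_tuple n (f(i := g))"
  by (simp add: form_tuple_def)

definition shift :: "(nat \<Rightarrow> (nat, complex) mpoly) \<Rightarrow> complex \<Rightarrow> (nat \<Rightarrow> (nat, complex) mpoly) \<Rightarrow> nat \<Rightarrow> (nat, complex) mpoly" where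
  "shift f t g = (\<lambda>i. f i + mscale t (g i))"

lemma form_tuple_shift: "form_tuple n f \<Longrightarrow> form_tuple n g \<Longrightarrow> form_tuple n (shift f t g)"
  by (simp add: form_tuple_def shift_def forms_add forms_mscale)

lemma shift_zero [simp]: "shift f 0 g = f"
  by (simp add: shift_def)

lemma shift_shift: "shift (shift f s g) t g = shift f (s + t) g"
  by (auto simp: shift_def single_add algebra_simps)

lemma coeff_point_shift: "coeff_point (shift F t G) = (\<lambda>v. coeff_point F v + t * coeff_point G v)"
  by (auto simp: coeff_point_def shift_def lookup_add lookup_const_mult)

lemma gen_tuple_mem:
  assumes D: "0 < D" and f: "\<And>i. i < m \<Longrightarrow> f i \<in> forms D" and i: "i < m" and a: "a \<in> forms n"
  shows "a * f i \<in> gen (tuple_list D f) (n + D)"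
proof -
  have fl: "form_list (tuple_list D f)" using form_list_tuple[OF D] f by blast
  have "(D, f i) \<in> set (tuple_list D f)" using i by (simp add: tuple_list_def)
  then obtain xs ys where xy: "tuple_list D f = xs @ (D, f i) # ys" by (meson split_list)
  have "gen (tuple_list D f) = add_gen D (f i) (gen (xs @ ys))" using xy gen_move[of xs "(D, f i)" ys] by simp
  moreover have "form_list (xs @ ys)" using fl xy by simp
  ultimately show ?thesis using add_gen_mult_mem[OF graded_gen a] by simp
qed

lemma gen_subset_span:
  "form_list L \<Longrightarrow> gen L n \<subseteq> cmpoly.span {a * g | a g d. (d, g) \<in> set L \<and> d \<le> n \<and> a \<in> forms (n - d)}"
proof (induction L)
  case Nil
  then show ?case by (simp add: cmpoly.span_zero)
next
  case (Cons x L)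
  obtain e h where x: "x = (e, h)" by (cases x)
  let ?G = "\<lambda>L. {a * g | a g d. (d, g) \<in> set L \<and> d \<le> n \<and> a \<in> forms (n - d)}"
  show ?case
  proof
    fix p assume "p \<in> gen (x # L) n"
    then obtain u v where uv: "p = u + v * h" "u \<in> gen L n" "v \<in> (if e \<le> n then forms (n - e) else {0})"
      by (auto simp: x add_gen_def)
    have "?G L \<subseteq> ?G (x # L)" by auto
    then have u: "u \<in> cmpoly.span (?G (x # L))"
      using Cons x uv(2) cmpoly.span_mono[of "?G L" "?G (x # L)"] by auto
    have "v * h \<in> cmpoly.span (?G (x # L))"
    proof (cases "e \<le> n")
      case True
      then have "v * h \<in> ?G (x # L)" using uv(3) x by auto
      then show ?thesis by (rule cmpoly.span_base)
    next
      case False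
      then show ?thesis using uv(3) by (simp add: cmpoly.span_zero)
    qed
    then show "p \<in> cmpoly.span (?G (x # L))" using u uv(1) cmpoly.span_add by simp
  qed
qed

context
  fixes D \<nu> :: nat and q :: "(nat, complex) mpoly"
  assumes D: "0 < D" and q: "q \<in> forms D" and \<nu>: "D ^ m \<le> \<nu>" "D \<le> \<nu>"
begin

section \<open>The matrix of a pencil in a fixed degree\<close>

text \<open>An effective form of the absence of common zeros of the first \<open>m\<close> members
  and \<open>q\<close>: degree \<open>\<nu>\<close> is already filled. With the degree fixed, the
  condition can be tested by a determinant and is open.\<close>

definition full :: "(nat \<Rightarrow> (nat, complex) mpoly) \<Rightarrow> bool" where
  "full f \<longleftrightarrow> add_gen D q (gen (tuple_list D f)) \<nu> = forms \<nu>"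

text \<open>Each such \<open>s\<close> is a value of the ratio \<open>- f m / q\<close> at a common
  zero of the first \<open>m\<close> members; there are \<open>D ^ m\<close> different ones, so all
  roots of the determinant in \<open>s\<close> are simple.\<close>

definition separated :: "(nat \<Rightarrow> (nat, complex) mpoly) \<Rightarrow> bool" where
  "separated f \<longleftrightarrow> full f \<and> (\<exists>S. finite S \<and> card S = D ^ m \<and> (\<forall>s\<in>S. common_zero (f(m := f m + mscale s q))))"

definition rank :: nat where
  "rank = cmpoly_dim (forms \<nu>)"

text \<open>For forms of degree \<open>\<nu>\<close>, \<open>rank\<close> independent products are a
  basis. In coordinates they become the rows \<open>k\<close> of the matrix.\<close>

definition independent_columns :: "(nat \<Rightarrow> nat) \<Rightarrow> (nat \<Rightarrow> (nat, complex) mpoly) \<Rightarrow> (nat \<Rightarrow> (nat, complex) mpoly) \<Rightarrow> bool" where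
  "independent_columns \<iota> a g \<longleftrightarrow>
    (\<forall>c. (\<Sum>k<rank. mscale (c k) (a k * g (\<iota> k))) = 0 \<longrightarrow> (\<forall>k<rank. c k = 0))"

lemma full_cong: "(\<And>i. i < m \<Longrightarrow> f i = g i) \<Longrightarrow> full f \<longleftrightarrow> full g"
proof -
  assume "\<And>i. i < m \<Longrightarrow> f i = g i"
  then have "tuple_list D f = tuple_list D g" by (simp add: tuple_list_def)
  then show ?thesis by (simp add: full_def)
qed

lemma graded_tuple: "(\<And>i. i < m \<Longrightarrow> f i \<in> forms D) \<Longrightarrow> graded (gen (tuple_list D f))"
  by (rule graded_gen[OF form_list_tuple[OF D]])

lemma full_imp:
  assumes f: "\<And>i. i < m \<Longrightarrow> f i \<in> forms D" and full: "full f"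
  shows "cmpoly_dim (gen (tuple_list D f) \<nu>) + D ^ m = rank"
proof -
  have prim: "primary (add_gen D q (gen (tuple_list D f)))" using full by (auto simp: full_def primary_def)
  have "codim (gen (tuple_list D f)) \<nu> = D ^ m" using complete_intersection(2)[of D f q \<nu>] D f q prim \<nu>(1) by blast
  then show ?thesis using graded_dim_le[OF graded_tuple[of f], of \<nu>] f D
    by (simp add: codim_def rank_def)
qed

text \<open>A basis of the degree \<open>\<nu>\<close> part of the ideal of the first
  \<open>m\<close> members is chosen among their multiples and completed to a basis of all forms by
  multiples of \<open>q\<close>. By \<open>complete_intersection\<close> exactly
  \<open>D ^ m\<close> of the latter occur, which fixes the degree of the determinant in
  \<open>s\<close>.\<close>

lemma columns_exist:
  assumes f: "\<And>i. i < m \<Longrightarrow> f i \<in> forms D" and full: "full f"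
  obtains \<iota> a where "\<And>k. a k \<in> forms (\<nu> - D)" "\<And>k. k < rank - D ^ m \<Longrightarrow> \<iota> k < m"
    "\<And>k. \<not> k < rank - D ^ m \<Longrightarrow> \<iota> k = m" "independent_columns \<iota> a (f(m := q))"
proof -
  let ?J = "gen (tuple_list D f)" and ?n = "\<nu> - D"
  have fl: "form_list (tuple_list D f)" using form_list_tuple[of D f] D f by blast
  note J = graded_gen[OF fl]
  define G1 where "G1 = {a * f i | a i. i < m \<and> a \<in> forms ?n}"
  define G2 where "G2 = {a * q | a. a \<in> forms ?n}"
  have "G1 \<subseteq> ?J \<nu>" using gen_tuple_mem[of D f _ _ ?n] D f \<nu>(2) by (auto simp: G1_def)
  then have "cmpoly.span G1 \<subseteq> ?J \<nu>" by (rule cmpoly.span_minimal) (rule graded_subspace[OF J])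
  moreover have "?J \<nu> \<subseteq> cmpoly.span G1"
  proof -
    have "{a * g | a g d. (d, g) \<in> set (tuple_list D f) \<and> d \<le> \<nu> \<and> a \<in> forms (\<nu> - d)} \<subseteq> G1"
    proof clarify
      fix a g d assume "(d, g) \<in> set (tuple_list D f)" "a \<in> forms (\<nu> - d)"
      then obtain i where "i < m" "d = D" "g = f i" "a \<in> forms ?n" by (auto simp: tuple_list_def)
      then show "a * g \<in> G1" unfolding G1_def by blast
    qed
    then show ?thesis using gen_subset_span[OF fl, of \<nu>] cmpoly.span_mono by blast
  qed
  ultimately have spJ: "cmpoly.span G1 = ?J \<nu>" by blast
  obtain B1 where B1: "B1 \<subseteq> G1" "cmpoly.independent B1" "G1 \<subseteq> cmpoly.span B1"
    using cmpoly.maximal_independent_subset[of G1] by blast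
  obtain B where B: "B1 \<subseteq> B" "B \<subseteq> B1 \<union> G2" "cmpoly.independent B" "B1 \<union> G2 \<subseteq> cmpoly.span B"
    using cmpoly.maximal_independent_subset_extend[of B1 "B1 \<union> G2"] B1(2) by blast
  have J_sp: "?J \<nu> \<subseteq> cmpoly.span B1"
    unfolding spJ[symmetric] using B1(3) by (intro cmpoly.span_minimal) (auto simp: cmpoly.subspace_span)
  have "B \<subseteq> forms \<nu>"
  proof -
    have "G1 \<subseteq> forms \<nu>" using \<open>G1 \<subseteq> ?J \<nu>\<close> graded_subset[OF J] by blast
    moreover have "G2 \<subseteq> forms \<nu>" using forms_mult[OF _ q, of _ ?n] \<nu>(2) by (auto simp: G2_def)
    ultimately show ?thesis using B(2) B1(1) by blast
  qed
  have "forms \<nu> \<subseteq> cmpoly.span B"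
  proof
    fix p assume "p \<in> forms \<nu>"
    then have "p \<in> add_gen D q ?J \<nu>" using full by (simp add: full_def)
    then obtain u v where uv: "p = u + v * q" "u \<in> ?J \<nu>" "v \<in> forms ?n"
      using \<nu>(2) by (auto simp: add_gen_def)
    have "u \<in> cmpoly.span B" using uv(2) J_sp cmpoly.span_mono[OF B(1)] by blast
    moreover have "v * q \<in> cmpoly.span B" using uv(3) B(4) by (auto simp: G2_def)
    ultimately show "p \<in> cmpoly.span B" using uv(1) cmpoly.span_add by simp
  qed
  then have cB: "card B = rank" unfolding rank_def
    using cmpoly.basis_card_eq_dim[OF \<open>B \<subseteq> forms \<nu>\<close> _ B(3)] by simp
  have fB: "finite B"
    using cmpoly.independent_span_bound[OF finite_form_basis B(3)] \<open>B \<subseteq> forms \<nu>\<close> forms_subset_span by blast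
  have fB1: "finite B1" using finite_subset[OF B(1) fB] .
  have "card B1 = cmpoly_dim (?J \<nu>)"
    using cmpoly.basis_card_eq_dim[OF _ J_sp B1(2)] B1(1) \<open>G1 \<subseteq> ?J \<nu>\<close> by blast
  then have cB1: "card B1 + D ^ m = rank" using full_imp[of f] f full by simp
  obtain g where g: "bij_betw g {0..<card B1} B1" using ex_bij_betw_nat_finite[OF fB1] by blast
  have cBB: "card (B - B1) = D ^ m" using cB cB1 B(1) fB1 by (simp add: card_Diff_subset)
  obtain h where h: "bij_betw h {0..<D ^ m} (B - B1)"
    using ex_bij_betw_nat_finite[of "B - B1"] fB cBB by auto
  define b where "b = (\<lambda>k. if k < card B1 then g k else h (k - card B1))"
  have b1: "b k \<in> B1" if "k < card B1" for k using g that by (auto simp: b_def bij_betw_def)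
  have b2: "b k \<in> B - B1" if "\<not> k < card B1" "k < rank" for k
  proof -
    have "k - card B1 < D ^ m" using that cB1 by simp
    then show ?thesis using h that by (auto simp: b_def bij_betw_def)
  qed
  have inj: "inj_on b {..<rank}"
  proof (rule inj_onI)
    fix k l assume kl: "k \<in> {..<rank}" "l \<in> {..<rank}" "b k = b l"
    consider "k < card B1" "l < card B1" | "\<not> k < card B1" "\<not> l < card B1"
      using b1[of k] b2[of l] b1[of l] b2[of k] kl by fastforce
    then show "k = l"
    proof cases
      case 1
      then show ?thesis using kl(3) inj_onD[OF bij_betw_imp_inj_on[OF g], of k l] by (simp add: b_def)
    next
      case 2
      then have "h (k - card B1) = h (l - card B1)" "k - card B1 < D ^ m" "l - card B1 < D ^ m"
        using kl cB1 by (auto simp: b_def)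
      then have "k - card B1 = l - card B1" using inj_onD[OF bij_betw_imp_inj_on[OF h], of "k - card B1" "l - card B1"] by simp
      then show ?thesis using 2 by simp
    qed
  qed
  have bB: "b ` {..<rank} \<subseteq> B" 
  proof (rule image_subsetI)
    fix k assume "k \<in> {..<rank}"
    then show "b k \<in> B" using b1[of k] b2[of k] B(1) by (cases "k < card B1") auto
  qed
  have "\<exists>i a. a \<in> forms ?n \<and> (k < card B1 \<longrightarrow> i < m) \<and> (\<not> k < card B1 \<longrightarrow> i = m) \<and>
      (k < rank \<longrightarrow> b k = a * (f(m := q)) i)" for k
  proof -
    consider "k < card B1" | "\<not> k < card B1" "k < rank" | "\<not> k < card B1" "\<not> k < rank" by blast
    then show ?thesis
    proof cases
      case 1
      then obtain a i where "b k = a * f i" "i < m" "a \<in> forms ?n" using b1[OF 1] B1(1) by (auto simp: G1_def)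
      then show ?thesis using 1 by (intro exI[of _ i] exI[of _ a]) auto
    next
      case 2
      then obtain a where "b k = a * q" "a \<in> forms ?n" using b2[OF 2] B(2) by (auto simp: G2_def)
      then show ?thesis using 2 by (intro exI[of _ m] exI[of _ a]) auto
    next
      case 3
      then show ?thesis by (intro exI[of _ m] exI[of _ 0]) auto
    qed
  qed
  then obtain \<iota> a where ia: "\<And>k. a k \<in> forms ?n" "\<And>k. k < card B1 \<Longrightarrow> \<iota> k < m"
    "\<And>k. \<not> k < card B1 \<Longrightarrow> \<iota> k = m" "\<And>k. k < rank \<Longrightarrow> b k = a k * (f(m := q)) (\<iota> k)" by metis
  have "independent_columns \<iota> a (f(m := q))"
    unfolding independent_columns_def
  proof (intro allI impI)
    fix c k assume z: "(\<Sum>k<rank. mscale (c k) (a k * (f(m := q)) (\<iota> k))) = 0" and k: "k < rank"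
    define u where "u = (\<lambda>x. c (the_inv_into {..<rank} b x))"
    have "(\<Sum>x\<in>b ` {..<rank}. mscale (u x) x) = (\<Sum>k<rank. mscale (u (b k)) (b k))"
      by (rule sum.reindex_cong[OF inj refl refl])
    also have "\<dots> = (\<Sum>k<rank. mscale (c k) (a k * (f(m := q)) (\<iota> k)))"
    proof (intro sum.cong refl)
      fix k assume "k \<in> {..<rank}"
      then have "u (b k) = c k" by (simp add: u_def the_inv_into_f_f[OF inj])
      moreover have "b k = a k * (f(m := q)) (\<iota> k)" using ia(4) \<open>k \<in> {..<rank}\<close> by blast
      ultimately show "mscale (u (b k)) (b k) = mscale (c k) (a k * (f(m := q)) (\<iota> k))" by (simp only:)
    qed
    finally have "(\<Sum>x\<in>b ` {..<rank}. mscale (u x) x) = 0" using z by simp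
    then have "u (b k) = 0"
      using cmpoly.independent_explicit_finite_subsets[THEN iffD1, OF B(3), rule_format, OF bB, of u "b k"] k by simp
    then show "c k = 0" using k by (simp add: u_def the_inv_into_f_f[OF inj])
  qed
  moreover have "card B1 = rank - D ^ m" using cB1 by simp
  ultimately show ?thesis using that[of a \<iota>] ia(1-3) by presburger
qed

text \<open>The data of the matrix: multipliers \<open>a\<close>, positions \<open>\<iota>\<close>
  and coordinates \<open>\<xi>\<close>. No tuple occurs, so one choice serves a whole
  pencil.\<close>

definition admissible :: "(nat \<Rightarrow> nat) \<Rightarrow> (nat \<Rightarrow> (nat, complex) mpoly) \<Rightarrow> (nat \<Rightarrow> (nat, complex) mpoly \<Rightarrow> complex) \<Rightarrow> bool" where
  "admissible \<iota> a \<xi> \<longleftrightarrow> (\<forall>k. a k \<in> forms (\<nu> - D)) \<and> (\<forall>k. if k < rank - D ^ m then \<iota> k < m else \<iota> k = m) \<and>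
    (\<forall>j. \<forall>x\<in>forms \<nu>. \<forall>y\<in>forms \<nu>. \<xi> j (x + y) = \<xi> j x + \<xi> j y) \<and>
    (\<forall>j c. \<forall>x\<in>forms \<nu>. \<xi> j (mscale c x) = c * \<xi> j x) \<and>
    (\<forall>x\<in>forms \<nu>. (\<forall>j<rank. \<xi> j x = 0) \<longrightarrow> x = 0)"

definition dets :: "(nat \<Rightarrow> nat) \<Rightarrow> (nat \<Rightarrow> (nat, complex) mpoly) \<Rightarrow> (nat \<Rightarrow> (nat, complex) mpoly \<Rightarrow> complex) \<Rightarrow>
    (nat \<Rightarrow> (nat, complex) mpoly) \<Rightarrow> (nat \<Rightarrow> (nat, complex) mpoly) \<Rightarrow> complex poly poly" where
  "dets \<iota> a \<xi> F G =
    family_det rank (D ^ m) (\<lambda>k j. \<xi> j (a k * F (\<iota> k))) (\<lambda>k j. \<xi> j (a k * G (\<iota> k))) (\<lambda>k j. \<xi> j (a k * q))"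

lemma admissible_exists:
  assumes f: "form_tuple D f" and full: "full f" and U: "U \<subseteq> forms \<nu>" "cmpoly_dim U + d \<le> rank"
  obtains \<iota> a \<xi> where "admissible \<iota> a \<xi>" "independent_columns \<iota> a (f(m := q))"
    "\<forall>j<d. \<forall>x\<in>U. \<xi> j x = 0"
proof -
  obtain \<iota> a where c: "\<And>k. a k \<in> forms (\<nu> - D)" "\<And>k. k < rank - D ^ m \<Longrightarrow> \<iota> k < m"
    "\<And>k. \<not> k < rank - D ^ m \<Longrightarrow> \<iota> k = m" "independent_columns \<iota> a (f(m := q))"
  proof -
    note result = that
    show ?thesis
    proof (rule columns_exist[of f])
      show "f i \<in> forms D" if "i < m" for i using form_tupleD[OF f, of i] that by simp
      show "full f" by (rule full)
    qed (rule result, assumption+)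
  qed
  obtain \<xi> where x: "\<And>j x y. x \<in> forms \<nu> \<Longrightarrow> y \<in> forms \<nu> \<Longrightarrow> \<xi> j (x + y) = \<xi> j x + \<xi> j y"
    "\<And>j c x. x \<in> forms \<nu> \<Longrightarrow> \<xi> j (mscale c x) = c * \<xi> j x"
    "\<And>j x. j < d \<Longrightarrow> x \<in> U \<Longrightarrow> \<xi> j x = 0"
    "\<And>x. x \<in> forms \<nu> \<Longrightarrow> (\<And>j. j < rank \<Longrightarrow> \<xi> j x = 0) \<Longrightarrow> x = 0"
    using cmpoly.adapted_coordinates[OF U(1) finite_form_basis forms_subset_span subspace_forms U(2)[unfolded rank_def]]
    unfolding rank_def by blast
  have "admissible \<iota> a \<xi>"
    unfolding admissible_def using c(1-3) x(1,2,4) by auto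
  then show ?thesis using that c(4) x(3) by blast
qed

context
  fixes \<iota> :: "nat \<Rightarrow> nat" and a :: "nat \<Rightarrow> (nat, complex) mpoly" and \<xi> :: "nat \<Rightarrow> (nat, complex) mpoly \<Rightarrow> complex"
  assumes adm: "admissible \<iota> a \<xi>"
begin

lemma
  shows multiplier_forms: "a k \<in> forms (\<nu> - D)"
    and index: "k < rank - D ^ m \<Longrightarrow> \<iota> k < m" "\<not> k < rank - D ^ m \<Longrightarrow> \<iota> k = m"
    and \<xi>_add: "x \<in> forms \<nu> \<Longrightarrow> y \<in> forms \<nu> \<Longrightarrow> \<xi> j (x + y) = \<xi> j x + \<xi> j y"
    and \<xi>_scale: "x \<in> forms \<nu> \<Longrightarrow> \<xi> j (mscale c x) = c * \<xi> j x"
    and \<xi>_sep: "x \<in> forms \<nu> \<Longrightarrow> (\<And>j. j < rank \<Longrightarrow> \<xi> j x = 0) \<Longrightarrow> x = 0"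
  using adm unfolding admissible_def by metis+

lemma column_forms: "g (\<iota> k) \<in> forms D \<Longrightarrow> a k * g (\<iota> k) \<in> forms \<nu>"
  using forms_mult[OF multiplier_forms[of k], of "g (\<iota> k)" D] \<nu>(2) by simp

lemma index_le: "\<iota> k \<le> m"
  using index[of k] by fastforce

lemma \<xi>_sum:
  assumes "finite K" "\<And>k. k \<in> K \<Longrightarrow> v k \<in> forms \<nu>"
  shows "\<xi> j (\<Sum>k\<in>K. mscale (c k) (v k)) = (\<Sum>k\<in>K. c k * \<xi> j (v k))"
  using assms
proof (induction K rule: finite_induct)
  case empty
  show ?case using \<xi>_scale[of 0 j 0] by simp
next
  case (insert k K)
  then show ?case by (simp add: \<xi>_add \<xi>_scale forms_mscale forms_sum)
qed

text \<open>The transposed matrix sends \<open>c\<close> to the coordinates of the combination of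
  the products with coefficients \<open>c\<close>, and these coordinates separate forms.\<close>

lemma det_eq_0_iff:
  assumes "form_tuple D g"
  shows "det (mat rank rank (\<lambda>(k, j). \<xi> j (a k * g (\<iota> k)))) = 0 \<longleftrightarrow> \<not> independent_columns \<iota> a g"
proof -
  note g = form_tupleD[OF assms]
  let ?M = "mat rank rank (\<lambda>(k, j). \<xi> j (a k * g (\<iota> k)))"
  have col: "a k * g (\<iota> k) \<in> forms \<nu>" for k using column_forms g index_le by blast
  have mv: "transpose_mat ?M *\<^sub>v v = 0\<^sub>v rank \<longleftrightarrow> (\<Sum>k<rank. mscale (vec_index v k) (a k * g (\<iota> k))) = 0"
    if v: "v \<in> carrier_vec rank" for v
  proof -
    have "vec_index (transpose_mat ?M *\<^sub>v v) j = \<xi> j (\<Sum>k<rank. mscale (vec_index v k) (a k * g (\<iota> k)))" if "j < rank" for j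
      using that v col by (simp add: \<xi>_sum scalar_prod_def mult.commute atLeast0LessThan)
    then have "transpose_mat ?M *\<^sub>v v = 0\<^sub>v rank \<longleftrightarrow>
        (\<forall>j<rank. \<xi> j (\<Sum>k<rank. mscale (vec_index v k) (a k * g (\<iota> k))) = 0)"
      by (auto simp: vec_eq_iff)
    also have "\<dots> \<longleftrightarrow> (\<Sum>k<rank. mscale (vec_index v k) (a k * g (\<iota> k))) = 0"
    proof
      assume "\<forall>j<rank. \<xi> j (\<Sum>k<rank. mscale (vec_index v k) (a k * g (\<iota> k))) = 0"
      then show "(\<Sum>k<rank. mscale (vec_index v k) (a k * g (\<iota> k))) = 0"
        using col by (intro \<xi>_sep forms_sum forms_mscale) auto
    qed (use \<xi>_scale[of 0 _ 0] in simp)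
    finally show ?thesis .
  qed
  have "det ?M = 0 \<longleftrightarrow> det (transpose_mat ?M) = 0" by (simp add: det_transpose[of _ rank])
  also have "\<dots> \<longleftrightarrow> (\<exists>v. v \<in> carrier_vec rank \<and> v \<noteq> 0\<^sub>v rank \<and> transpose_mat ?M *\<^sub>v v = 0\<^sub>v rank)"
    by (rule det_0_iff_vec_prod_zero_field) simp
  also have "\<dots> \<longleftrightarrow> \<not> independent_columns \<iota> a g"
  proof
    assume "\<exists>v. v \<in> carrier_vec rank \<and> v \<noteq> 0\<^sub>v rank \<and> transpose_mat ?M *\<^sub>v v = 0\<^sub>v rank"
    then obtain v where v: "v \<in> carrier_vec rank" "v \<noteq> 0\<^sub>v rank" "(\<Sum>k<rank. mscale (vec_index v k) (a k * g (\<iota> k))) = 0"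
      using mv by blast
    then have "\<exists>k<rank. vec_index v k \<noteq> 0" by (auto simp: vec_eq_iff)
    then show "\<not> independent_columns \<iota> a g"
      unfolding independent_columns_def using v(3) by (intro notI) (drule spec[of _ "\<lambda>k. vec_index v k"], auto)
  next
    assume "\<not> independent_columns \<iota> a g"
    then obtain c k where c: "(\<Sum>k<rank. mscale (c k) (a k * g (\<iota> k))) = 0" "k < rank" "c k \<noteq> 0"
      by (auto simp: independent_columns_def)
    have "(\<Sum>k<rank. mscale (vec_index (vec rank c) k) (a k * g (\<iota> k))) = 0" using c(1) by simp
    moreover have "vec rank c \<noteq> 0\<^sub>v rank" using c(2,3) by (auto simp: vec_eq_iff)
    ultimately show "\<exists>v. v \<in> carrier_vec rank \<and> v \<noteq> 0\<^sub>v rank \<and> transpose_mat ?M *\<^sub>v v = 0\<^sub>v rank"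
      using mv[of "vec rank c"] by (intro exI[of _ "vec rank c"]) auto
  qed
  finally show ?thesis .
qed

text \<open>All products lie in the space of forms of degree \<open>\<nu>\<close> that vanish at the
  common zero. It is proper, since some coordinate is nonzero there, and so has no room for
  \<open>rank\<close> independent elements.\<close>

lemma common_zero_imp_dependent:
  assumes "form_tuple D g" "common_zero g"
  shows "\<not> independent_columns \<iota> a g"
proof
  note g = form_tupleD[OF assms(1)]
  assume ind: "independent_columns \<iota> a g"
  obtain x where x: "point x" "\<And>i. i \<le> m \<Longrightarrow> mpoly_eval x (g i) = 0" using assms(2) by (auto simp: common_zero_def)
  define V where "V = {p \<in> forms \<nu>. mpoly_eval x p = 0}"
  have V: "cmpoly.subspace V" "V \<subseteq> forms \<nu>"
    by (auto simp: V_def cmpoly.subspace_def forms_add forms_mscale mpoly_eval_add mpoly_eval_mscale)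
  have Vsp: "V \<subseteq> cmpoly.span (form_basis \<nu>)" using V(2) forms_subset_span by blast
  have "cmpoly_dim {0} + card {..<rank} \<le> cmpoly_dim V"
  proof (rule cmpoly.independent_mod_card_le[OF _ finite_form_basis Vsp])
    fix k assume "k \<in> {..<rank}"
    show "a k * g (\<iota> k) \<in> V"
      using column_forms[of g k] g[OF index_le] x(2)[OF index_le] by (simp add: V_def mpoly_eval_mult)
  next
    fix c assume "(\<Sum>i\<in>{..<rank}. mscale (c i) (a i * g (\<iota> i))) \<in> {0}"
    then show "\<forall>i\<in>{..<rank}. c i = 0" using ind by (auto simp: independent_columns_def)
  qed (use cmpoly.subspace_0[OF V(1)] in auto)
  then have "V = forms \<nu>"
    using cmpoly.subspace_eq_of_dim_le[OF V(2) finite_form_basis forms_subset_span V(1)] by (simp add: rank_def)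
  moreover obtain i where i: "i \<le> m" "x i \<noteq> 0" using point_coord[OF x(1)] by blast
  moreover have "var i ^ \<nu> \<in> forms \<nu>" using forms_power[OF forms_var[OF i(1)], of \<nu>] by simp
  ultimately have "var i ^ \<nu> \<in> V" by simp
  then show False using i(2) by (simp add: V_def mpoly_eval_power)
qed

lemma independent_imp_full:
  assumes "form_tuple D f" and ind: "independent_columns \<iota> a (f(m := q))"
  shows "full f"
proof -
  have f: "\<And>i. i < m \<Longrightarrow> f i \<in> forms D" using form_tupleD[OF assms(1)] by simp
  let ?J = "gen (tuple_list D f)"
  have J: "graded ?J" using graded_tuple f by blast
  note A = graded_add_gen[OF J q]
  have Asp: "add_gen D q ?J \<nu> \<subseteq> cmpoly.span (form_basis \<nu>)" using graded_subset[OF A] forms_subset_span by blast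
  have "cmpoly_dim {0} + card {..<rank} \<le> cmpoly_dim (add_gen D q ?J \<nu>)"
  proof (rule cmpoly.independent_mod_card_le[OF _ finite_form_basis Asp])
    fix k assume "k \<in> {..<rank}"
    show "a k * (f(m := q)) (\<iota> k) \<in> add_gen D q ?J \<nu>"
    proof (cases "\<iota> k = m")
      case True
      then show ?thesis using add_gen_mult_mem[OF J multiplier_forms[of k], of q D] \<nu>(2) by simp
    next
      case False
      then have "\<iota> k < m" using index_le[of k] by simp
      then have "a k * f (\<iota> k) \<in> ?J \<nu>" using gen_tuple_mem[of D f "\<iota> k" "a k" "\<nu> - D"] D f multiplier_forms[of k] \<nu>(2) by simp
      then show ?thesis using False add_gen_supset[of ?J \<nu> D q] by auto
    qed
  next
    fix c assume "(\<Sum>i\<in>{..<rank}. mscale (c i) (a i * (f(m := q)) (\<iota> i))) \<in> {0}"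
    then show "\<forall>i\<in>{..<rank}. c i = 0" using ind by (simp add: independent_columns_def)
  qed (use graded_zero[OF A] in auto)
  then show ?thesis unfolding full_def
    using cmpoly.subspace_eq_of_dim_le[OF graded_subset[OF A] finite_form_basis forms_subset_span graded_subspace[OF A]]
    by (simp add: rank_def)
qed

text \<open>Without a common zero, \<open>g m\<close> is a nonzerodivisor modulo the ideal of the
  other members. In a linear relation the rows with \<open>g m\<close> add up to
  \<open>w * g m\<close>, which lies in that ideal; hence so do \<open>w\<close> and
  \<open>w * q\<close>. So the same combination of rows with \<open>q\<close> depends on the
  remaining rows, and independence for \<open>q\<close> makes all coefficients vanish.\<close>

lemma dependent_imp_common_zero:
  assumes gt: "form_tuple D g" and ind: "independent_columns \<iota> a (g(m := q))"
    and dep: "\<not> independent_columns \<iota> a g"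
  shows "common_zero g"
proof (rule ccontr)
  assume nz: "\<not> common_zero g"
  note g = form_tupleD[OF gt]
  let ?J = "gen (tuple_list D g)" and ?A = "{..<rank - D ^ m}" and ?B = "{rank - D ^ m..<rank}"
  have f: "\<And>i. i < m \<Longrightarrow> g i \<in> forms D" using g by simp
  have full: "full g" using independent_imp_full[OF gt ind] .
  have J: "graded ?J" using graded_tuple f by blast
  have dJ: "cmpoly_dim (?J \<nu>) = rank - D ^ m" using full_imp[of g] f full by simp
  have split: "sum F {..<rank} = sum F ?A + sum F ?B" for F :: "nat \<Rightarrow> (nat, complex) mpoly"
  proof -
    have "{..<rank} = ?A \<union> ?B" by auto
    then show ?thesis by (metis finite_atLeastLessThan finite_lessThan ivl_disj_int(2) sum.union_disjoint lessThan_atLeast0 ivl_disj_int_two(3))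
  qed
  have gm: "g m \<in> forms D" using g by simp
  have "zeros (add_gen D (g m) ?J) = {}"
  proof (rule ccontr)
    assume "zeros (add_gen D (g m) ?J) \<noteq> {}"
    then obtain x where "point x" "\<forall>i<m. mpoly_eval x (g i) = 0" "mpoly_eval x (g m) = 0"
      using zeros_add_gen[OF J gm] zeros_tuple[of D g] D f by auto
    then have "common_zero g" unfolding common_zero_def by (metis le_neq_implies_less)
    then show False using nz by simp
  qed
  then have "primary (add_gen D (g m) ?J)" using primary_iff[OF graded_add_gen[OF J gm]] by simp
  then have nzd: "nonzerodivisor D (g m) ?J" using complete_intersection(1)[of D g "g m"] D f gm by blast
  obtain c k0 where c: "(\<Sum>k<rank. mscale (c k) (a k * g (\<iota> k))) = 0" "k0 < rank" "c k0 \<noteq> 0"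
    using dep by (auto simp: independent_columns_def)
  define w where "w = (\<Sum>k\<in>?B. mscale (c k) (a k))"
  have w: "w \<in> forms (\<nu> - D)" unfolding w_def using multiplier_forms by (intro forms_sum forms_mscale) auto
  have colJ: "a k * g (\<iota> k) \<in> ?J \<nu>" if "k \<in> ?A" for k
    using gen_tuple_mem[of D g "\<iota> k" "a k" "\<nu> - D"] D f index(1)[of k] multiplier_forms[of k] that \<nu>(2) by simp
  have colA: "a k * (g(m := q)) (\<iota> k) = a k * g (\<iota> k)" if "k \<in> ?A" for k
    using index(1)[of k] that by simp
  have sB: "(\<Sum>k\<in>?B. mscale (c k) (a k * y (\<iota> k))) = w * y m" for y
  proof -
    have "(\<Sum>k\<in>?B. mscale (c k) (a k * y (\<iota> k))) = (\<Sum>k\<in>?B. mscale (c k) (a k) * y m)"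
      using index(2) by (intro sum.cong) (auto simp: mult.assoc)
    then show ?thesis by (simp add: w_def sum_distrib_right)
  qed
  have "(\<Sum>k\<in>?A. mscale (c k) (a k * g (\<iota> k))) + w * g m = 0"
    using c(1) unfolding split sB .
  then have "w * g m = - (\<Sum>k\<in>?A. mscale (c k) (a k * g (\<iota> k)))" by (simp add: eq_neg_iff_add_eq_0 add.commute)
  also have "\<dots> \<in> ?J \<nu>" using colJ by (intro graded_uminus[OF J] graded_sum[OF J] graded_mscale[OF J])
  finally have "w * g m \<in> ?J ((\<nu> - D) + D)" using \<nu>(2) by simp
  then have "w \<in> ?J (\<nu> - D)" using nzd w by (auto simp: nonzerodivisor_def)
  then have wq: "w * q \<in> ?J \<nu>" using graded_mult'[OF J q, of w "\<nu> - D"] \<nu>(2) by simp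
  define v where "v = (\<lambda>k. a k * g (\<iota> k))"
  let ?S = "cmpoly.span (v ` ?A)"
  have SJ: "?S \<subseteq> ?J \<nu>"
    using colJ by (intro cmpoly.span_minimal graded_subspace[OF J]) (auto simp: v_def)
  have ext: "\<forall>k<rank. (if k \<in> ?A then x k else y k) = 0"
    if "(\<Sum>k\<in>?A. mscale (x k) (v k)) + (\<Sum>k\<in>?B. mscale (y k) (a k * (g(m := q)) (\<iota> k))) = 0" for x y
  proof -
    have "(\<Sum>k<rank. mscale (if k \<in> ?A then x k else y k) (a k * (g(m := q)) (\<iota> k))) = 0"
    proof -
      have "(\<Sum>k\<in>?A. mscale (if k \<in> ?A then x k else y k) (a k * (g(m := q)) (\<iota> k))) = (\<Sum>k\<in>?A. mscale (x k) (v k))"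
        by (intro sum.cong refl) (simp add: v_def colA del: fun_upd_apply)
      moreover have "(\<Sum>k\<in>?B. mscale (if k \<in> ?A then x k else y k) (a k * (g(m := q)) (\<iota> k))) =
          (\<Sum>k\<in>?B. mscale (y k) (a k * (g(m := q)) (\<iota> k)))"
        by (intro sum.cong refl) simp
      ultimately show ?thesis unfolding split using that by (simp only:)
    qed
    then show ?thesis
      using ind[unfolded independent_columns_def, THEN spec, of "\<lambda>k. if k \<in> ?A then x k else y k"] by blast
  qed
  have Jsp: "?J \<nu> \<subseteq> cmpoly.span (form_basis \<nu>)" using graded_subset[OF J] forms_subset_span by blast
  have "cmpoly_dim {0} + card ?A \<le> cmpoly_dim ?S"
  proof (rule cmpoly.independent_mod_card_le[OF _ finite_form_basis subset_trans[OF SJ Jsp]])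
    fix x assume "(\<Sum>i\<in>?A. mscale (x i) (v i)) \<in> {0}"
    then have e: "\<forall>k<rank. (if k \<in> ?A then x k else 0) = 0" using ext[of x "\<lambda>_. 0"] by simp
    show "\<forall>i\<in>?A. x i = 0"
    proof
      fix i assume "i \<in> ?A"
      then show "x i = 0" using e[rule_format, of i] by simp
    qed
  qed (auto simp: cmpoly.span_base cmpoly.span_zero)
  \<comment> \<open>The first \<open>rank - D ^ m\<close> rows are independent and as many as the
    dimension of this component, so they span it.\<close>
  then have "?S = ?J \<nu>"
    using cmpoly.subspace_eq_of_dim_le[OF SJ finite_form_basis Jsp cmpoly.subspace_span] dJ by simp
  then have "w * q \<in> cmpoly.span ({} \<union> v ` ?A)" using wq by simp
  then obtain y where y: "w * q = (\<Sum>k\<in>?A. mscale (y k) (v k))"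
    using cmpoly.span_Un_image_expand[of ?A "w * q" "{}" v] by auto
  have "(\<Sum>k\<in>?A. mscale (- y k) (v k)) + (\<Sum>k\<in>?B. mscale (c k) (a k * (g(m := q)) (\<iota> k))) = 0"
    unfolding sB using y by (simp add: single_uminus sum_negf)
  from ext[OF this] have cB: "c k = 0" if "k \<in> ?B" for k using that by fastforce
  then have "w = 0" by (simp add: w_def)
  then have "(\<Sum>k\<in>?A. mscale (c k) (v k)) = 0"
    using \<open>(\<Sum>k\<in>?A. mscale (c k) (a k * g (\<iota> k))) + w * g m = 0\<close> by (simp add: v_def)
  then have "\<forall>k<rank. (if k \<in> ?A then c k else 0) = 0" using ext[of c "\<lambda>_. 0"] by simp
  then have "c k0 = 0" using cB[of k0] c(2) by (cases "k0 \<in> ?A") auto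
  then show False using c(3) by simp
qed

context
  fixes F G :: "nat \<Rightarrow> (nat, complex) mpoly"
  assumes F: "form_tuple D F" and G: "form_tuple D G" and r: "D ^ m \<le> rank"
begin

lemma \<xi>_shift: "\<xi> j (a k * shift F t G (\<iota> k)) = \<xi> j (a k * F (\<iota> k)) + t * \<xi> j (a k * G (\<iota> k))"
proof -
  have "a k * shift F t G (\<iota> k) = a k * F (\<iota> k) + mscale t (a k * G (\<iota> k))"
    by (simp add: shift_def distrib_left mult.left_commute)
  then show ?thesis
    using column_forms[of F k] column_forms[of G k] form_tupleD[OF F index_le] form_tupleD[OF G index_le]
    by (simp add: \<xi>_add \<xi>_scale forms_mscale)
qed

lemma \<xi>_add_q:
  assumes "f \<in> forms D"
  shows "\<xi> j (a k * (f + mscale s q)) = \<xi> j (a k * f) + s * \<xi> j (a k * q)"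
proof -
  have e: "a k * (f + mscale s q) = a k * f + mscale s (a k * q)"
    by (simp add: distrib_left mult.left_commute)
  have "a k * f \<in> forms \<nu>" "a k * q \<in> forms \<nu>"
    using forms_mult[OF multiplier_forms[of k] assms] forms_mult[OF multiplier_forms[of k] q] \<nu>(2) by simp_all
  then show ?thesis unfolding e by (simp add: \<xi>_add \<xi>_scale forms_mscale)
qed

lemma poly_dets:
  "poly (eval_coeffs t (dets \<iota> a \<xi> F G)) s =
    det (mat rank rank (\<lambda>(k, j). \<xi> j (a k * ((shift F t G)(m := shift F t G m + mscale s q)) (\<iota> k))))"
proof -
  have m: "shift F t G m \<in> forms D" using form_tupleD[OF form_tuple_shift[OF F G]] by blast
  have "\<xi> j (a k * F (\<iota> k)) + t * \<xi> j (a k * G (\<iota> k)) + (if k < rank - D ^ m then 0 else s * \<xi> j (a k * q)) =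
      \<xi> j (a k * ((shift F t G)(m := shift F t G m + mscale s q)) (\<iota> k))" for k j
  proof (cases "k < rank - D ^ m")
    case True
    then show ?thesis using index(1)[OF True] \<xi>_shift[of j k t] by simp
  next
    case False
    then show ?thesis using index(2)[OF False] \<xi>_shift[of j k t] \<xi>_add_q[OF m, of j k s] by simp
  qed
  then show ?thesis unfolding dets_def poly_family_det by (simp only:)
qed

lemma degree_dets: "degree (dets \<iota> a \<xi> F G) \<le> D ^ m"
  unfolding dets_def by (rule family_det_top(1)[OF r])

text \<open>Taking the coefficient of \<open>s\<close> in every row that belongs to the last member
  amounts to replacing that member by \<open>q\<close>.\<close>

lemma dets_top:
  "poly (coeff (dets \<iota> a \<xi> F G) (D ^ m)) t =
    det (mat rank rank (\<lambda>(k, j). \<xi> j (a k * ((shift F t G)(m := q)) (\<iota> k))))"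
proof -
  have "(if k < rank - D ^ m then \<xi> j (a k * F (\<iota> k)) + t * \<xi> j (a k * G (\<iota> k)) else \<xi> j (a k * q)) =
      \<xi> j (a k * ((shift F t G)(m := q)) (\<iota> k))" for k j
  proof (cases "k < rank - D ^ m")
    case True
    then show ?thesis using index(1)[OF True] \<xi>_shift[of j k t] by simp
  next
    case False
    then show ?thesis using index(2)[OF False] by simp
  qed
  then show ?thesis unfolding dets_def family_det_top(2)[OF r] by (simp only:)
qed

lemma form_tuple_shift_upd: "f \<in> forms D \<Longrightarrow> form_tuple D ((shift F t G)(m := f))"
  by (intro form_tuple_upd form_tuple_shift F G)

lemma form_tuple_pencil: "form_tuple D ((shift F t G)(m := shift F t G m + mscale s q))"
  using form_tupleD[OF form_tuple_shift[OF F G]] q by (intro form_tuple_shift_upd forms_add forms_mscale) auto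

lemma dets_top_nonzero_iff:
  "poly (coeff (dets \<iota> a \<xi> F G) (D ^ m)) t \<noteq> 0 \<longleftrightarrow> independent_columns \<iota> a ((shift F t G)(m := q))"
  unfolding dets_top det_eq_0_iff[OF form_tuple_shift_upd[OF q]] by simp

lemma dets_root_iff: "poly (eval_coeffs t (dets \<iota> a \<xi> F G)) s = 0 \<longleftrightarrow>
    \<not> independent_columns \<iota> a ((shift F t G)(m := shift F t G m + mscale s q))"
  unfolding poly_dets by (rule det_eq_0_iff[OF form_tuple_pencil])

lemma root_of_common_zero:
  "common_zero ((shift F t G)(m := shift F t G m + mscale s q)) \<Longrightarrow> poly (eval_coeffs t (dets \<iota> a \<xi> F G)) s = 0"
  unfolding dets_root_iff by (rule common_zero_imp_dependent[OF form_tuple_pencil])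

lemma common_zero_of_root:
  assumes "poly (coeff (dets \<iota> a \<xi> F G) (D ^ m)) t \<noteq> 0" "poly (eval_coeffs t (dets \<iota> a \<xi> F G)) s = 0"
  shows "common_zero ((shift F t G)(m := shift F t G m + mscale s q))"
proof (rule dependent_imp_common_zero[OF form_tuple_pencil])
  show "independent_columns \<iota> a (((shift F t G)(m := shift F t G m + mscale s q))(m := q))"
    using assms(1) by (simp only: dets_top_nonzero_iff fun_upd_upd)
  show "\<not> independent_columns \<iota> a ((shift F t G)(m := shift F t G m + mscale s q))"
    using assms(2) unfolding dets_root_iff .
qed

lemma full_of_dets_top: "poly (coeff (dets \<iota> a \<xi> F G) (D ^ m)) t \<noteq> 0 \<Longrightarrow> full (shift F t G)"
  unfolding dets_top_nonzero_iff by (rule independent_imp_full[OF form_tuple_shift[OF F G]])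

end

end

lemma rank_ge:
  assumes "form_tuple D f" "full f"
  shows "D ^ m \<le> rank"
  using full_imp[of f] form_tupleD[OF assms(1)] assms(2) by simp

text \<open>The top coefficient of the determinant in \<open>s\<close> is a polynomial in
  \<open>t\<close> that is nonzero at \<open>0\<close>, and the tuple is full wherever it does not
  vanish. The coordinates are adapted to \<open>{0}\<close> only.\<close>

lemma full_cofinite:
  assumes F: "form_tuple D F" and G: "form_tuple D G" and full: "full F"
  shows "finite {t. \<not> full (shift F t G)}"
proof -
  note r = rank_ge[OF F full]
  obtain \<iota> a \<xi> where adm: "admissible \<iota> a \<xi>" and ind: "independent_columns \<iota> a (F(m := q))"
    using admissible_exists[OF F full, of "{0}" 0] graded_dim_le[OF graded_zero_ideal, of \<nu>] by (auto simp: rank_def)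
  let ?c = "coeff (dets \<iota> a \<xi> F G) (D ^ m)"
  have "poly ?c 0 \<noteq> 0" unfolding dets_top_nonzero_iff[OF adm F G r] using ind by simp
  then have "finite {t. poly ?c t = 0}" by (intro poly_roots_finite) auto
  then show ?thesis
    by (rule finite_subset[rotated]) (use full_of_dets_top[OF adm F G r] in blast)
qed

text \<open>At \<open>t = 0\<close> the determinant has \<open>D ^ m\<close> distinct roots in
  \<open>s\<close>, as many as its degree. This persists for almost all \<open>t\<close>, and each
  root then comes from a common zero.\<close>

lemma separated_cofinite:
  assumes F: "form_tuple D F" and G: "form_tuple D G" and sep: "separated F"
  shows "finite {t. \<not> separated (shift F t G)}"
proof -
  have full: "full F" using sep by (simp add: separated_def)
  obtain S where S: "finite S" "card S = D ^ m" "\<And>s. s \<in> S \<Longrightarrow> common_zero (F(m := F m + mscale s q))"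
    using sep by (auto simp: separated_def)
  note r = rank_ge[OF F full]
  obtain \<iota> a \<xi> where adm: "admissible \<iota> a \<xi>" and ind: "independent_columns \<iota> a (F(m := q))"
    using admissible_exists[OF F full, of "{0}" 0] graded_dim_le[OF graded_zero_ideal, of \<nu>] by (auto simp: rank_def)
  let ?\<delta> = "dets \<iota> a \<xi> F G"
  have c0: "poly (coeff ?\<delta> (D ^ m)) 0 \<noteq> 0" unfolding dets_top_nonzero_iff[OF adm F G r] using ind by simp
  then have "eval_coeffs 0 ?\<delta> \<noteq> 0" by (metis coeff_0 coeff_map_poly poly_0)
  then have "finite {s. poly (eval_coeffs 0 ?\<delta>) s = 0}" by (rule poly_roots_finite)
  moreover have "S \<subseteq> {s. poly (eval_coeffs 0 ?\<delta>) s = 0}"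
  proof
    fix s assume "s \<in> S"
    then show "s \<in> {s. poly (eval_coeffs 0 ?\<delta>) s = 0}"
      using root_of_common_zero[OF adm F G r, of 0 s] S(3) by simp
  qed
  ultimately have roots: "D ^ m \<le> card {s. poly (eval_coeffs 0 ?\<delta>) s = 0}" using S(2) card_mono by metis
  note deg = degree_dets[OF adm F G r]
  have "separated (shift F t G)"
    if t: "poly (coeff ?\<delta> (D ^ m)) t \<noteq> 0" "card {s. poly (eval_coeffs t ?\<delta>) s = 0} = D ^ m" for t
    unfolding separated_def
  proof (intro conjI exI[of _ "{s. poly (eval_coeffs t ?\<delta>) s = 0}"] ballI)
    show "full (shift F t G)" using full_of_dets_top[OF adm F G r t(1)] .
    show "finite {s. poly (eval_coeffs t ?\<delta>) s = 0}" using t(2) D by (intro card_ge_0_finite) simp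
    show "card {s. poly (eval_coeffs t ?\<delta>) s = 0} = D ^ m" by fact
    fix s assume "s \<in> {s. poly (eval_coeffs t ?\<delta>) s = 0}"
    then show "common_zero ((shift F t G)(m := shift F t G m + mscale s q))"
      using common_zero_of_root[OF adm F G r t(1)] by blast
  qed
  then show ?thesis
    by (intro finite_subset[OF _ distinct_roots_cofinite[OF deg c0 roots]]) blast
qed

text \<open>Up to a factor that is invertible at \<open>t = 0\<close>, the determinant \<open>\<delta>\<close> of the pencil divides \<open>p\<close>,
  because for almost all \<open>t\<close> it has \<open>D\<^sup>m\<close> simple zeros in \<open>s\<close>, and they are zeros of \<open>p\<close>. At
  \<open>t = s = 0\<close> all rows of the matrix come from the ideal, and the first \<open>d\<close> coordinates vanish on it.\<close>

lemma vanishing_on_line: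
  assumes J0: "graded J0" and FJ: "\<And>i. i \<le> m \<Longrightarrow> F i \<in> J0 D" and full: "full F"
    and G: "form_tuple D G" and sep: "separated (shift F 1 G)"
    and p: "\<And>g. form_tuple D g \<Longrightarrow> common_zero g \<Longrightarrow> mpoly_eval (coeff_point g) p = 0"
  shows "monom 1 (codim J0 \<nu>) dvd on_line p (coeff_point F) (coeff_point G)"
proof -
  have F: "form_tuple D F" using FJ graded_subset[OF J0] by (auto intro!: form_tupleI)
  note r = rank_ge[OF F full]
  have dle: "cmpoly_dim (J0 \<nu>) + codim J0 \<nu> \<le> rank"
    using graded_dim_le[OF J0, of \<nu>] by (simp add: codim_def rank_def)
  obtain \<iota> a \<xi> where adm: "admissible \<iota> a \<xi>" and ind: "independent_columns \<iota> a (F(m := q))"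
    and x0: "\<forall>j<codim J0 \<nu>. \<forall>x\<in>J0 \<nu>. \<xi> j x = 0"
    using admissible_exists[OF F full graded_subset[OF J0] dle] by blast
  let ?\<delta> = "dets \<iota> a \<xi> F G"
  \<comment> \<open>The restriction of \<open>p\<close> to the family \<open>F + t G\<close> with
    \<open>s q\<close> added to the last member; the last direction is zero, since no term in
    \<open>s t\<close> occurs.\<close>
  define r' where "r' = on_surface p (coeff_point F) (coeff_point G) (coeff_point (\<lambda>i. if i = m then q else 0)) (\<lambda>_. 0)"
  have r0: "poly r' 0 = on_line p (coeff_point F) (coeff_point G)"
    using poly_on_surface[of p "coeff_point F" "coeff_point G" "coeff_point (\<lambda>i. if i = m then q else 0)" "\<lambda>_. 0" 0]
    by (simp add: r'_def)
  have rts: "poly (eval_coeffs t r') s = mpoly_eval (coeff_point ((shift F t G)(m := shift F t G m + mscale s q))) p" for t s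
  proof -
    have "poly (eval_coeffs t r') s =
        mpoly_eval (\<lambda>v. coeff_point F v + s * coeff_point (\<lambda>i. if i = m then q else 0) v + t * coeff_point G v) p"
      by (simp add: poly_eval_coeffs r'_def poly_on_surface poly_on_line)
    also have "(\<lambda>v. coeff_point F v + s * coeff_point (\<lambda>i. if i = m then q else 0) v + t * coeff_point G v) =
        coeff_point ((shift F t G)(m := shift F t G m + mscale s q))"
      by (auto simp: coeff_point_def shift_def lookup_add lookup_const_mult)
    finally show ?thesis .
  qed
  define T where "T = {t. separated (shift F t G)}"
  \<comment> \<open>Separation is known at \<open>t = 1\<close>, so the pencil is restarted there
    and the parameter translated back.\<close>
  have "finite {t. \<not> separated (shift F (1 + t) G)}"
    using separated_cofinite[OF form_tuple_shift[OF F G] G sep] by (simp add: shift_shift)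
  then have "finite ((\<lambda>t. 1 + t) ` {t. \<not> separated (shift F (1 + t) G)})" by (rule finite_imageI)
  moreover have "- T \<subseteq> (\<lambda>t. 1 + t) ` {t. \<not> separated (shift F (1 + t) G)}"
  proof
    fix t assume "t \<in> - T"
    then show "t \<in> (\<lambda>t. 1 + t) ` {t. \<not> separated (shift F (1 + t) G)}"
      by (intro image_eqI[of _ _ "t - 1"]) (auto simp: T_def)
  qed
  ultimately have "finite (- T)" by (rule finite_subset[rotated])
  then have T: "infinite T" using infinite_UNIV_char_0[where ?'a = complex] finite_compl[of T] by blast
  have TS: "\<exists>S. finite S \<and> card S = D ^ m \<and> (\<forall>s\<in>S. poly (eval_coeffs t r') s = 0 \<and> poly (eval_coeffs t ?\<delta>) s = 0)"
    if t: "t \<in> T" for t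
  proof -
    obtain S where S: "finite S" "card S = D ^ m"
      "\<And>s. s \<in> S \<Longrightarrow> common_zero ((shift F t G)(m := shift F t G m + mscale s q))"
      using t by (auto simp: T_def separated_def)
    have "poly (eval_coeffs t r') s = 0 \<and> poly (eval_coeffs t ?\<delta>) s = 0" if s: "s \<in> S" for s
    proof
      show "poly (eval_coeffs t r') s = 0"
        unfolding rts by (rule p[OF form_tuple_pencil[OF adm F G r] S(3)[OF s]])
      show "poly (eval_coeffs t ?\<delta>) s = 0" by (rule root_of_common_zero[OF adm F G r S(3)[OF s]])
    qed
    then show ?thesis using S(1,2) by blast
  qed
  have c0: "poly (coeff ?\<delta> (D ^ m)) 0 \<noteq> 0" unfolding dets_top_nonzero_iff[OF adm F G r] using ind by simp
  have "monom 1 (codim J0 \<nu>) dvd poly ?\<delta> 0"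
    unfolding dets_def
  proof (rule family_det_order)
    show "codim J0 \<nu> \<le> rank" by (simp add: codim_def rank_def)
    fix k j assume j: "j < codim J0 \<nu>"
    have "a k * F (\<iota> k) \<in> J0 \<nu>"
      using graded_mult[OF J0 multiplier_forms[OF adm, of k] FJ[OF index_le[OF adm, of k]]] \<nu>(2) by simp
    then show "\<xi> j (a k * F (\<iota> k)) = 0" using x0 j by blast
  qed
  from pseudo_division_vanishing[OF degree_dets[OF adm F G r] c0 T TS this] show ?thesis by (simp add: r0)
qed

end

end

section \<open>The resultant\<close>

context projective_space
begin

text \<open>A last member \<open>h\<close> is chosen whose ratios to \<open>q\<close> differ at any
  two Fermat points, a condition on finitely many functionals. The values of \<open>s\<close> are
  then \<open>- h(x) / q(x)\<close>.\<close>

lemma separated_fermat: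
  assumes D: "0 < D" and q: "q \<in> forms D" and \<nu>: "D ^ m \<le> \<nu>" "D \<le> \<nu>"
    and full: "full D \<nu> q (fermat D)" and nz: "\<And>x. x \<in> fermat_points D \<Longrightarrow> mpoly_eval x q \<noteq> 0"
  shows "\<exists>H. form_tuple D H \<and> separated D \<nu> q H"
proof -
  let ?X = "fermat_points D"
  define K where "K = {(x, y). x \<in> ?X \<and> y \<in> ?X \<and> x \<noteq> y}"
  define \<phi> where "\<phi> = (\<lambda>(x, y) h. mpoly_eval x h * mpoly_eval y q - mpoly_eval y h * mpoly_eval x q)"
  have fX: "finite ?X" by (rule card_fermat_points(1)[OF D])
  have "finite K" by (rule finite_subset[of _ "?X \<times> ?X"]) (auto simp: K_def fX)
  moreover have "\<phi> k (p + r) = \<phi> k p + \<phi> k r" for k p r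
    by (cases k) (simp add: \<phi>_def mpoly_eval_add algebra_simps)
  moreover have "\<phi> k (mscale c p) = c * \<phi> k p" for k c p
    by (cases k) (simp only: \<phi>_def prod.case mpoly_eval_mscale, simp add: algebra_simps)
  moreover have "\<exists>p\<in>forms D. \<phi> k p \<noteq> 0" if "k \<in> K" for k
  proof -
    obtain x y where k: "k = (x, y)" "x \<in> ?X" "y \<in> ?X" "x \<noteq> y" using \<open>k \<in> K\<close> by (auto simp: K_def)
    have "\<not> proportional x y" using fermat_points_eqI[OF k(2,3)] k(4) by blast
    then obtain p where "p \<in> forms D" "mpoly_eval y p \<noteq> 0" "mpoly_eval x p = 0"
      using separating_form[of "{x}" y D] point_fermat_points k(2,3) D by auto
    then show ?thesis using nz[OF k(2)] by (intro bexI[of _ p]) (simp_all add: k(1) \<phi>_def)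
  qed
  ultimately obtain h where h: "h \<in> forms D" "\<forall>k\<in>K. \<phi> k h \<noteq> 0"
    using subspace_avoid_kernels[OF subspace_forms, of K \<phi>] by blast
  define H where "H = (fermat D)(m := h)"
  define \<sigma> where "\<sigma> = (\<lambda>x. - mpoly_eval x h / mpoly_eval x q)"
  have HD: "form_tuple D H"
    unfolding form_tuple_def H_def using forms_fermat h(1) by auto
  have fullH: "full D \<nu> q H" using full_cong[OF D q \<nu>, of H "fermat D"] full by (simp add: H_def)
  have inj: "inj_on \<sigma> ?X"
  proof (rule inj_onI, rule ccontr)
    fix x y assume xy: "x \<in> ?X" "y \<in> ?X" "\<sigma> x = \<sigma> y" "x \<noteq> y"
    then have "\<phi> (x, y) h \<noteq> 0" using h(2) by (auto simp: K_def)
    then show False using xy(3) nz[OF xy(1)] nz[OF xy(2)] by (simp add: \<phi>_def \<sigma>_def field_simps)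
  qed
  have "common_zero (H(m := H m + mscale s q))" if "s \<in> \<sigma> ` ?X" for s
  proof -
    from that obtain x where x: "x \<in> ?X" "s = \<sigma> x" by blast
    have "mpoly_eval x (h + mscale s q) = 0"
      using nz[OF x(1)] by (simp add: mpoly_eval_add mpoly_eval_diff mpoly_eval_mscale single_uminus x(2) \<sigma>_def)
    then have "\<forall>i\<le>m. mpoly_eval x ((H(m := H m + mscale s q)) i) = 0"
      using fermat_points_zero[OF x(1)] by (auto simp: H_def)
    then show ?thesis using point_fermat_points[OF x(1)] unfolding common_zero_def by blast
  qed
  then have "separated D \<nu> q H"
    unfolding separated_def[OF D q \<nu>] using fullH card_image[OF inj] card_fermat_points[OF D]
    by (intro conjI exI[of _ "\<sigma> ` ?X"]) auto
  then show ?thesis using HD by blast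
qed

text \<open>\<open>vanishing_on_line\<close> treats directions that lead from \<open>F\<close> to a
  separated tuple. The Taylor coefficients are polynomial in the direction, which gives all lines,
  and \<open>vanishes_on_lines_imp\<close> turns lines into partial derivatives.\<close>

lemma vanishing_at_full:
  assumes D: "0 < D" and q: "q \<in> forms D" and \<nu>: "D ^ m \<le> \<nu>" "D \<le> \<nu>"
    and H: "form_tuple D H" "separated D \<nu> q H"
    and J: "graded J" and F: "\<And>i. i \<le> m \<Longrightarrow> F i \<in> J D" and full: "full D \<nu> q F"
    and p: "\<And>g. form_tuple D g \<Longrightarrow> common_zero g \<Longrightarrow> mpoly_eval (coeff_point g) p = 0"
    and vs: "vs \<in> lists (coeff_vars m D)" "length vs < codim J \<nu>"
  shows "mpoly_eval (coeff_point F) (fold mpoly_pderiv vs p) = 0"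
proof -
  have FD: "form_tuple D F" using F graded_subset[OF J] by (auto intro!: form_tupleI)
  define W where "W = {coeff_point G | G. form_tuple D G}"
  show ?thesis
  proof (rule vanishes_on_lines_imp[of W "coeff_vars m D", OF _ _ _ vs])
    have "form_tuple D (\<lambda>_. 0)" by (simp add: form_tuple_def)
    then show "W \<noteq> {}" by (auto simp: W_def)
  next
    fix y v u assume "y \<in> W" and v: "v \<in> coeff_vars m D"
    then obtain G where G: "form_tuple D G" "y = coeff_point G" by (auto simp: W_def)
    obtain i b where ib: "v = (i, b)" by (cases v)
    then have b: "i \<le> m" "b \<in> monomials D" using v by (auto simp: coeff_vars_def monomials_def)
    have "form_tuple D (G(i := G i + Poly_Mapping.single b u))"
      using form_tupleD[OF G(1) b(1)] by (intro form_tuple_upd G(1) forms_add forms_single b(2))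
    moreover have "y(v := y v + u) = coeff_point (G(i := G i + Poly_Mapping.single b u))"
      unfolding G(2) ib by (auto simp: coeff_point_def lookup_add lookup_single when_def fun_eq_iff)
    ultimately show "y(v := y v + u) \<in> W" by (auto simp: W_def)
  next
    fix y assume "y \<in> W"
    then obtain G where G: "form_tuple D G" "y = coeff_point G" by (auto simp: W_def)
    \<comment> \<open>With this \<open>E\<close>, the tuple \<open>F + G + s E\<close> equals
      \<open>H + (s - 1) E\<close>. It is separated at \<open>s = 1\<close>, hence for almost all
      \<open>s\<close>; the direction of interest is \<open>s = 0\<close>.\<close>
    define E where "E = (\<lambda>i. H i - F i - G i)"
    have E: "form_tuple D E" using H(1) FD G(1) by (simp add: form_tuple_def E_def forms_diff)
    have sh: "shift F 1 (shift G s E) = shift H (s - 1) E" for s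
      by (rule ext) (simp add: shift_def E_def single_diff algebra_simps)
    have "finite {t. \<not> separated D \<nu> q (shift H t E)}" by (rule separated_cofinite[OF D q \<nu> H(1) E H(2)])
    then have "finite ((\<lambda>t. t + 1) ` {t. \<not> separated D \<nu> q (shift H t E)})" by (rule finite_imageI)
    moreover have "{s. \<not> separated D \<nu> q (shift F 1 (shift G s E))} \<subseteq> (\<lambda>t. t + 1) ` {t. \<not> separated D \<nu> q (shift H t E)}"
    proof
      fix s assume "s \<in> {s. \<not> separated D \<nu> q (shift F 1 (shift G s E))}"
      then show "s \<in> (\<lambda>t. t + 1) ` {t. \<not> separated D \<nu> q (shift H t E)}"
        by (intro image_eqI[of _ _ "s - 1"]) (auto simp: sh)
    qed
    ultimately have fin: "finite {s. \<not> separated D \<nu> q (shift F 1 (shift G s E))}" by (rule finite_subset[rotated])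
    show "\<forall>j<codim J \<nu>. coeff (on_line p (coeff_point F) y) j = 0"
    proof (intro allI impI)
      fix j assume j: "j < codim J \<nu>"
      obtain g where g: "\<And>s. coeff (on_line p (coeff_point F) (\<lambda>v. coeff_point G v + s * coeff_point E v)) j = poly g s"
        using coeff_on_line_direction[of p "coeff_point F" "coeff_point G" "coeff_point E" j] by blast
      have "poly g s = 0" if s: "separated D \<nu> q (shift F 1 (shift G s E))" for s
      proof -
        have "monom 1 (codim J \<nu>) dvd on_line p (coeff_point F) (coeff_point (shift G s E))"
          by (rule vanishing_on_line[OF D q \<nu> J F full form_tuple_shift[OF G(1) E] s p])
        then have "coeff (on_line p (coeff_point F) (coeff_point (shift G s E))) j = 0"
          using j by (simp add: monom_1_dvd_iff')
        then show ?thesis using g[of s] by (simp add: coeff_point_shift)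
      qed
      then have "{s. poly g s \<noteq> 0} \<subseteq> {s. \<not> separated D \<nu> q (shift F 1 (shift G s E))}" by blast
      then have "finite {s. poly g s \<noteq> 0}" using fin by (rule finite_subset)
      then have "g = 0" by (rule poly_zero_of_cofinite)
      then show "coeff (on_line p (coeff_point F) y) j = 0" using g[of 0] by (simp add: G(2))
    qed
  qed
qed

text \<open>\<open>F\<close> need not be full, but some tuple \<open>F0\<close> in
  \<open>J D\<close> is. Almost all tuples on the line from \<open>F\<close> towards
  \<open>F0\<close> are full and stay in \<open>J D\<close>, and the derivative of \<open>p\<close>
  restricted to this line is a polynomial in one variable.\<close>

lemma vanishing_on_ideal:
  assumes D: "0 < D" and J: "graded J"
    and X: "finite X" "\<And>x. x \<in> X \<Longrightarrow> point x"
      "\<And>x. point x \<Longrightarrow> (\<And>p. p \<in> J D \<Longrightarrow> mpoly_eval x p = 0) \<Longrightarrow> \<exists>y\<in>X. proportional y x"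
    and d: "\<And>n. n0 \<le> n \<Longrightarrow> codim J n = d" and F: "\<And>i. i \<le> m \<Longrightarrow> F i \<in> J D"
    and p: "\<And>g. form_tuple D g \<Longrightarrow> common_zero g \<Longrightarrow> mpoly_eval (coeff_point g) p = 0"
    and vs: "vs \<in> lists (coeff_vars m D)" "length vs < d"
  shows "mpoly_eval (coeff_point F) (fold mpoly_pderiv vs p) = 0"
proof -
  \<comment> \<open>The last coordinate point, where \<open>primary_replace_vars\<close> requires
    \<open>q\<close> to be nonzero.\<close>
  define e where "e = (\<lambda>i. if i = m then 1 else (0::complex))"
  have "point e" by (auto simp: point_def e_def)
  moreover have "finite (insert e (X \<union> fermat_points D))" using X(1) card_fermat_points(1)[OF D] by simp
  moreover have "x \<in> insert e (X \<union> fermat_points D) \<Longrightarrow> point x" for x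
    using \<open>point e\<close> X(2) point_fermat_points by blast
  ultimately obtain l where l: "l \<in> forms (Suc 0)" "mpoly_eval e l \<noteq> 0" "\<And>x. x \<in> X \<Longrightarrow> mpoly_eval x l \<noteq> 0"
    "\<And>x. x \<in> fermat_points D \<Longrightarrow> mpoly_eval x l \<noteq> 0"
    using linear_form_avoiding_points[of "insert e (X \<union> fermat_points D)"] by blast
  \<comment> \<open>A single \<open>q\<close> serves both \<open>F0\<close> and the Fermat system:
    it is nonzero at the zeros of \<open>J D\<close>, at the Fermat points and at
    \<open>e\<close>.\<close>
  define q where "q = l ^ D"
  have q: "q \<in> forms D" using forms_power[OF l(1), of D] by (simp add: q_def)
  have qX: "\<exists>h\<in>J D. mpoly_eval x h \<noteq> 0" if x: "point x" "mpoly_eval x q = 0" for x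
  proof (rule ccontr)
    assume "\<not> ?thesis"
    then obtain y where y: "y \<in> X" "proportional y x" using X(3)[OF x(1)] by blast
    then have "mpoly_eval x l \<noteq> 0" using proportional_nonzero[OF l(1) y(2) x(1) l(3)] by blast
    then show False using x(2) by (simp add: q_def mpoly_eval_power)
  qed
  have "mpoly_eval e q \<noteq> 0" using l(2) by (simp add: q_def mpoly_eval_power)
  then obtain F0 where F0: "\<And>i. i < m \<Longrightarrow> F0 i \<in> J D" "primary (add_gen D q (gen (tuple_list D F0)))"
    using primary_replace_vars[OF graded_subspace[OF J] graded_subset[OF J] D q qX] unfolding e_def by blast
  have nz: "mpoly_eval x q \<noteq> 0" if "x \<in> fermat_points D" for x
    using l(4)[OF that] by (simp add: q_def mpoly_eval_power)
  obtain N1 where N1: "add_gen D q (gen (tuple_list D F0)) N1 = forms N1" using F0(2) by (auto simp: primary_def)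
  obtain N2 where N2: "add_gen D q (gen (tuple_list D (fermat D))) N2 = forms N2"
    using primary_fermat[OF D q nz] by (auto simp: primary_def)
  \<comment> \<open>Large enough for \<open>F0\<close> and the Fermat system to be full, for the
    Hilbert function of \<open>J\<close> to be constant and for
    \<open>complete_intersection\<close>; the summand \<open>D\<close> makes room for multipliers of
    degree \<open>\<nu> - D\<close>.\<close>
  define \<nu> where "\<nu> = N1 + N2 + n0 + D ^ m + D"
  have \<nu>: "D ^ m \<le> \<nu>" "D \<le> \<nu>" by (auto simp: \<nu>_def)
  have "graded (gen (tuple_list D F0))"
    using F0(1) graded_subset[OF J] by (intro graded_gen form_list_tuple[OF D]) auto
  then have fullF0: "full D \<nu> q F0"
    unfolding full_def[OF D q \<nu>] by (intro primary_mono[of "add_gen D q (gen (tuple_list D F0))" N1 \<nu>] N1 graded_add_gen q) (auto simp: \<nu>_def)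
  have "graded (gen (tuple_list D (fermat D)))"
    using forms_fermat by (intro graded_gen form_list_tuple[OF D]) auto
  then have "full D \<nu> q (fermat D)"
    unfolding full_def[OF D q \<nu>] by (intro primary_mono[of "add_gen D q (gen (tuple_list D (fermat D)))" N2 \<nu>] N2 graded_add_gen q) (auto simp: \<nu>_def)
  then obtain H where H: "form_tuple D H" "separated D \<nu> q H"
    using separated_fermat[OF D q \<nu> _ nz] by blast
  have vsn: "length vs < codim J \<nu>" using d[of \<nu>] vs(2) by (simp add: \<nu>_def)
  \<comment> \<open>Fullness concerns only the first \<open>m\<close> members, so the last one is
    left alone.\<close>
  define E where "E = (\<lambda>i. if i < m then F0 i - F i else 0)"
  have EJ: "E i \<in> J D" if "i \<le> m" for i
    using that F0(1) F graded_zero[OF J] graded_diff[OF J] by (auto simp: E_def)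
  have FD: "form_tuple D F" and ED: "form_tuple D E"
    using F EJ graded_subset[OF J] by (auto intro!: form_tupleI)
  have "full D \<nu> q (shift F 1 E)"
    using full_cong[OF D q \<nu>, of "shift F 1 E" F0] fullF0 by (simp add: shift_def E_def)
  then have "finite {t. \<not> full D \<nu> q (shift F (1 + t) E)}"
    using full_cofinite[OF D q \<nu> form_tuple_shift[OF FD ED] ED] by (simp add: shift_shift)
  then have "finite ((\<lambda>t. 1 + t) ` {t. \<not> full D \<nu> q (shift F (1 + t) E)})" by (rule finite_imageI)
  moreover define g where "g = on_line (fold mpoly_pderiv vs p) (coeff_point F) (coeff_point E)"
  have "{t. poly g t \<noteq> 0} \<subseteq> (\<lambda>t. 1 + t) ` {t. \<not> full D \<nu> q (shift F (1 + t) E)}"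
  proof
    fix t assume t: "t \<in> {t. poly g t \<noteq> 0}"
    have "\<not> full D \<nu> q (shift F t E)"
    proof
      assume f: "full D \<nu> q (shift F t E)"
      have "shift F t E i \<in> J D" if "i \<le> m" for i
        unfolding shift_def using that F EJ by (intro graded_add[OF J] graded_mscale[OF J])
      then have "mpoly_eval (coeff_point (shift F t E)) (fold mpoly_pderiv vs p) = 0"
        using vanishing_at_full[OF D q \<nu> H J _ f p vs(1) vsn] by blast
      then show False using t by (simp add: g_def poly_on_line coeff_point_shift)
    qed
    then show "t \<in> (\<lambda>t. 1 + t) ` {t. \<not> full D \<nu> q (shift F (1 + t) E)}"
      by (intro image_eqI[of _ _ "t - 1"]) auto
  qed
  ultimately have "finite {t. poly g t \<noteq> 0}" by (rule finite_subset[rotated])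
  then have "g = 0" by (rule poly_zero_of_cofinite)
  then show ?thesis using poly_on_line[of "fold mpoly_pderiv vs p" "coeff_point F" "coeff_point E" 0] by (simp add: g_def)
qed

lemma common_zero_imp_proj_zeros:
  assumes g: "form_tuple D g" and "common_zero g"
  shows "proj_zeros m (g ` {..m}) \<noteq> {}"
proof -
  obtain x where x: "point x" "\<And>i. i \<le> m \<Longrightarrow> mpoly_eval x (g i) = 0" using assms(2) by (auto simp: common_zero_def)
  have "p \<in> forms D" "mpoly_eval x p = 0" if "p \<in> g ` {..m}" for p
    using that form_tupleD[OF g] x(2) by auto
  from proj_zeros_nonempty[of "g ` {..m}" D x, OF this(1) x(1) this(2)] show ?thesis by blast
qed

end

theorem theorem5p2:
  fixes m D :: nat
    and I :: "(nat, complex) mpoly set"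
    and R :: "(nat \<times> (nat \<Rightarrow>\<^sub>0 nat), int) mpoly"
    and F :: "nat \<Rightarrow> (nat, complex) mpoly"
  assumes "m \<ge> 1"
    and "homogeneous_ideal m I"
    and "D \<ge> 1"
    and "finite (proj_zeros m (ideal_part m I D))"
    and "proj_zeros m (ideal_part m I D) \<noteq> {}"
    and "is_resultant m D R"
    and "\<forall>i\<le>m. F i \<in> ideal_part m I D"
  shows "vanishes_to_order (coeff_vars m D) (complexify R) (coeff_point F) (ideal_degree m I)"
proof -
  interpret projective_space m .
  let ?J = "ideal_part m I"
  have D: "0 < D" using assms(3) by simp
  have J: "graded ?J" by (rule graded_ideal_part[OF assms(2)])
  have JD: "p \<in> forms D" if "p \<in> ?J D" for p using that graded_subset[OF J] by blast
  obtain X where X: "finite X" "\<And>x. x \<in> X \<Longrightarrow> point x"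
    "\<And>x. point x \<Longrightarrow> (\<And>p. p \<in> ?J D \<Longrightarrow> mpoly_eval x p = 0) \<Longrightarrow> \<exists>y\<in>X. proportional y x"
    using finite_representatives[of "?J D" D, OF JD assms(4)] by blast
  obtain l where l: "l \<in> forms (Suc 0)" "\<And>x. x \<in> X \<Longrightarrow> mpoly_eval x l \<noteq> 0"
    using linear_form_avoiding_points[OF X(1,2)] by blast
  \<comment> \<open>A linear form that avoids the finitely many zeros leaves none; hence the Hilbert
    function is eventually constant, and its value is the degree of \<open>I\<close>.\<close>
  have "zeros (add_gen (Suc 0) l ?J) = {}"
  proof (rule ccontr)
    assume "zeros (add_gen (Suc 0) l ?J) \<noteq> {}"
    then obtain x where x: "x \<in> zeros ?J" "mpoly_eval x l = 0" using zeros_add_gen[OF J l(1)] by blast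
    then have px: "point x" "\<And>p. p \<in> ?J D \<Longrightarrow> mpoly_eval x p = 0" by (auto simp: zeros_def)
    obtain y where "y \<in> X" "proportional y x" using X(3)[OF px] by blast
    then show False using proportional_nonzero[OF l(1) _ px(1) l(2)] x(2) by blast
  qed
  then have "primary (add_gen (Suc 0) l ?J)" using primary_iff[OF graded_add_gen[OF J l(1)]] by simp
  then obtain d n0 where d: "\<And>n. n0 \<le> n \<Longrightarrow> codim ?J n = d"
    using eventually_constant_codim[OF J l(1)] by blast
  have R: "mpoly_eval (coeff_point g) (complexify R) = 0" if "form_tuple D g" "common_zero g" for g
    using common_zero_imp_proj_zeros[OF that] assms(6) form_tupleD[OF that(1)] by (auto simp: is_resultant_def)
  have F: "F i \<in> ?J D" if "i \<le> m" for i using assms(7) that by blast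
  have deg: "ideal_degree m I = of_nat d" by (rule ideal_degree_eq[OF assms(2)]) (rule d)
  show ?thesis
    unfolding vanishes_to_order_def deg of_nat_less_iff
  proof (intro ballI impI)
    fix vs assume vs: "vs \<in> lists (coeff_vars m D)" "length vs < d"
    show "mpoly_eval (coeff_point F) (fold mpoly_pderiv vs (complexify R)) = 0"
      by (rule vanishing_on_ideal[of D ?J X n0 d F "complexify R" vs]) (use D J X d F R vs in auto)
  qed
qed

end
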